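(* Let $L=10^6$. Consider the following random subgraph $\mathcal{G}$ of the square lattice $\mathbb{Z}^2$ (with nearest-neighbour edges), depending on a parameter $\rho\in[0,1)$: keep all vertices; independently for every $i\in\mathbb{Z}$, with probability $\rho$ remove all vertical edges lying on the line $\{x=i\}$ (i.e. all edges $\{(i,j),(i,j+1)\}$, $j\in\mathbb{Z}$); independently for every $j\in\mathbb{Z}$ (and independently of the columns), with probability $\rho$ remove all horizontal edges lying on the line $\{y=j\}$ (i.e. all edges $\{(i,j),(i+1,j)\}$, $i\in\mathbb{Z}$). Conditionally on $\mathcal{G}$, perform Bernoulli bond percolation with parameter $p\in[0,1]$ on $\mathcal{G}$: each edge of $\mathcal{G}$ is open with probability $p$ and closed otherwise, independently. Let $\mathbb{P}$ denote the joint (annealed) law of the graph and the percolation. If $\rho\le L^{-16}$ and $p\ge (1-L^{-10})^{1/4}$, then $$\mathbb{P}\big[(0,0)\text{ is connected to infinity by an open path}\big]>0.$$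
   Context: "$(0,0)$ is connected to infinity" means that the open cluster of $(0,0)$ (the set of vertices joined to $(0,0)$ by a path of open edges of $\mathcal{G}$) is infinite. *)

theory Defs
  imports "HOL-Probability.Probability"
begin

text \<open>Independent random inputs of the annealed model:
  Col i   -- True iff all vertical edges on the line x = i are removed (prob. rho);
  Row j   -- True iff all horizontal edges on the line y = j are removed (prob. rho);
  VEdge i j -- percolation state (True = open, prob. p) of the edge {(i,j),(i,j+1)};
  HEdge i j -- percolation state (True = open, prob. p) of the edge {(i,j),(i+1,j)}.
  Percolation variables of edges not in the graph are sampled but ignored; this gives
  the same joint law as percolating only on the edges of the random graph.\<close>
datatype site = Col int | Row int | VEdge int int | HEdge int int

fun site_prob :: "real \<Rightarrow> real \<Rightarrow> site \<Rightarrow> real" where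
  "site_prob rho p (Col i) = rho"
| "site_prob rho p (Row j) = rho"
| "site_prob rho p (VEdge i j) = p"
| "site_prob rho p (HEdge i j) = p"

definition annealed :: "real \<Rightarrow> real \<Rightarrow> (site \<Rightarrow> bool) measure" where
  "annealed rho p = (\<Pi>\<^sub>M s\<in>UNIV. measure_pmf (bernoulli_pmf (site_prob rho p s)))"

definition open_edge :: "(site \<Rightarrow> bool) \<Rightarrow> int \<times> int \<Rightarrow> int \<times> int \<Rightarrow> bool" where
  "open_edge \<omega> u v \<longleftrightarrow>
     (\<exists>i j. ((u = (i, j) \<and> v = (i, j + 1)) \<or> (v = (i, j) \<and> u = (i, j + 1)))
            \<and> \<not> \<omega> (Col i) \<and> \<omega> (VEdge i j))
   \<or> (\<exists>i j. ((u = (i, j) \<and> v = (i + 1, j)) \<or> (v = (i, j) \<and> u = (i + 1, j)))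
            \<and> \<not> \<omega> (Row j) \<and> \<omega> (HEdge i j))"

definition open_cluster :: "(site \<Rightarrow> bool) \<Rightarrow> int \<times> int \<Rightarrow> (int \<times> int) set" where
  "open_cluster \<omega> x = {y. (x, y) \<in> {(u, v). open_edge \<omega> u v}\<^sup>*}"

end

theory Submission
  imports Defs
begin

text \<open>Multi-scale renormalisation, quenched in the removed lines.  The random environment is parsed, one
  coordinate at a time, into a hierarchy: at level \<open>k\<close> there are columns separated by gaps, each
  gap carrying a mass; \<open>width k\<close> consecutive columns with massless gaps between them form a
  column of level \<open>k+1\<close>, and everything between two such columns is merged into one gap whose mass is
  the total mass minus \<open>k+1\<close>.  The gap masses of each level are again i.i.d., and the subtraction makes
  their exponential moments converge to 1 fast enough that with positive probability the origin lies
  in the first column at every level.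

  For a fixed environment, the columns and rows of level \<open>k\<close> form a square lattice with independent
  random vertices and edges: a vertex (or an edge across a massless gap) fails with probability at most
  \<open>eps k\<close>, and an edge across a gap of mass \<open>g\<close> is open with probability at least
  \<open>(1 - eps k) * theta k ^ g\<close>.  A vertex of the next level is a square block with no two
  bad sites, which costs the square of \<open>eps k\<close> up to a factor; an edge of the next level needs only
  one of many disjoint parallel tracks to be open, which pays for the subtracted mass.  Since
  \<open>eps\<close> is summable, the blocks of the origin are all connected to one another with positive
  probability.\<close>

section \<open>The geometric renormalisation step\<close>

text \<open>A removed line is missing along its whole length, so a stack of removed columns is an
  infinite obstacle: it cannot be bypassed, only crossed at one of many rows. This is why the
  environment is fixed first and an edge across mass g may be as rare as theta^g.

  The constants come from one balance. \<open>eps\<close> must be summable, and an edge that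
  forgives mass r fails with probability about exp(-A theta^r / 2), so the number A of tracks has to
  grow with the level k. Merging units of 2A+2 entries multiplies the excess over 1 of the
  exponential moment by about 8A, while subtracting r divides it by (2^40)^r. With A growing like
  8^k, a fixed r would let the excess explode; hence r = k+1. This is affordable because theta stays
  above 1/4: A * 4^-(k+1) / 2 = 2^(k+17), and its negative exponential is below
  \<open>eps (Suc k)\<close>. Good blocks require 256 A^4 eps^2 to be at most the next eps, which
  the rate 12 = 4 * 3 in \<open>eps\<close> meets with equality.

  Only the first quadrant is explored: the environment is read along lines of nonnegative
  index.\<close>

text \<open>Coordinates are doubled: in each direction \<open>2i+1\<close> is the \<open>i\<close>-th line and \<open>2i\<close> the
  gap preceding it.  So a site is a vertex (both coordinates odd), an edge (exactly one odd) or meaningless.\<close>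

definition usable :: "nat \<times> nat \<Rightarrow> bool" where
  "usable s \<longleftrightarrow> odd (fst s) \<and> 0 < snd s \<or> odd (snd s) \<and> 0 < fst s"

text \<open>\<open>e I\<close> is the index of the \<open>I\<close>-th good unit, a unit having \<open>2A+2\<close> lines, hence
  \<open>4A+4\<close> doubled coordinates.  The coarse coordinate \<open>x\<close> stands for
  \<open>lo x, ..., lo (x+1) - 1\<close>.  The outermost lines of a good unit are left to the adjacent gaps,
  so that coarse vertices and coarse edges depend on disjoint sets of sites.\<close>

definition lo :: "nat \<Rightarrow> (nat \<Rightarrow> nat) \<Rightarrow> nat \<Rightarrow> nat" where
  "lo A e x = (if odd x then (4*A+4) * e (x div 2) + 3
     else if x = 0 then 0 else (4*A+4) * e (x div 2 - 1) + 4*A+2)"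

definition block :: "nat \<Rightarrow> (nat \<Rightarrow> nat) \<Rightarrow> (nat \<Rightarrow> nat) \<Rightarrow> nat \<times> nat \<Rightarrow> (nat \<times> nat) set" where
  "block A e e' s = {lo A e (fst s)..<lo A e (Suc (fst s))} \<times> {lo A e' (snd s)..<lo A e' (Suc (snd s))}"

definition goodbox :: "(nat \<times> nat \<Rightarrow> bool) \<Rightarrow> (nat \<times> nat) set \<Rightarrow> bool" where
  "goodbox F S \<longleftrightarrow> (\<forall>s\<in>S. \<forall>t\<in>S. usable s \<longrightarrow> usable t \<longrightarrow> s \<noteq> t \<longrightarrow> F s \<or> F t)"

text \<open>In use \<open>y\<close> is odd, \<open>l\<close> and \<open>h\<close> are gaps inside
  the two adjacent good units, and \<open>l+1\<close>, \<open>h-1\<close> are the outer lines of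
  these units. The last two products form a hook at each end: an edge to the next parallel line, the
  vertex there, and the edge leading into the block. A track thus occupies two lines, whence the
  spacing \<open>4*t\<close> in doubled coordinates.\<close>

definition track :: "nat \<Rightarrow> nat \<Rightarrow> nat \<Rightarrow> (nat \<times> nat) set" where
  "track l h y = {l..h} \<times> {y} \<union> {l+1, h-1} \<times> {y+1} \<union> {l, l+1, h-1, h} \<times> {y+2}"

definition crossing :: "(nat \<times> nat \<Rightarrow> bool) \<Rightarrow> nat \<Rightarrow> nat \<Rightarrow> nat \<Rightarrow> nat \<Rightarrow> bool" where
  "crossing F A l h y \<longleftrightarrow> (\<exists>t<A. \<forall>s\<in>track l h (y + 4*t). F s)"

definition coarsen :: "nat \<Rightarrow> (nat \<Rightarrow> nat) \<Rightarrow> (nat \<Rightarrow> nat) \<Rightarrow> (nat \<times> nat \<Rightarrow> bool) \<Rightarrow> nat \<times> nat \<Rightarrow> bool" where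
  "coarsen A e e' F s =
     (let x = fst s; y = snd s in
      if odd x \<and> odd y then goodbox F (block A e e' s)
      else if odd y \<and> 0 < x then crossing F A (lo A e x) (lo A e (Suc x) - 1) (lo A e' y)
      else if odd x \<and> 0 < y then crossing (F \<circ> prod.swap) A (lo A e' y) (lo A e' (Suc y) - 1) (lo A e x)
      else False)"

definition hlinked :: "(nat \<times> nat \<Rightarrow> bool) \<Rightarrow> ('v \<Rightarrow> 'v \<Rightarrow> bool) \<Rightarrow> (nat \<Rightarrow> nat \<Rightarrow> 'v) \<Rightarrow> bool" where
  "hlinked F R rep \<longleftrightarrow> (\<forall>i j. F (2*i+1, 2*j+1) \<longrightarrow> F (2*i+2, 2*j+1) \<longrightarrow> F (2*i+3, 2*j+1)
      \<longrightarrow> R (rep i j) (rep (Suc i) j))"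

definition linked :: "(nat \<times> nat \<Rightarrow> bool) \<Rightarrow> ('v \<Rightarrow> 'v \<Rightarrow> bool) \<Rightarrow> (nat \<Rightarrow> nat \<Rightarrow> 'v) \<Rightarrow> bool" where
  "linked F R rep \<longleftrightarrow> hlinked F R rep \<and> hlinked (F \<circ> prod.swap) R (\<lambda>i j. rep j i)"

text \<open>Two candidates suffice, as a good block has at most one bad site. Their fixed place next
  to the corner of the block lets the representative of the block of the origin be traced through
  all levels.\<close>

definition coarse_rep ::
  "nat \<Rightarrow> (nat \<Rightarrow> nat) \<Rightarrow> (nat \<Rightarrow> nat) \<Rightarrow> (nat \<times> nat \<Rightarrow> bool) \<Rightarrow> (nat \<Rightarrow> nat \<Rightarrow> 'v) \<Rightarrow> nat \<Rightarrow> nat \<Rightarrow> 'v" where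
  "coarse_rep A e e' F rep I J =
     (let i = (2*A+2) * e I + 1; j = (2*A+2) * e' J + 1
      in if F (2*i+1, 2*j+1) then rep i j else rep (Suc i) j)"

section \<open>Symmetry under exchange of the two coordinates\<close>

lemma usable_swap [simp]: "usable (prod.swap s) = usable s"
  by (auto simp: usable_def)

lemma goodbox_swap: "goodbox (F \<circ> prod.swap) (prod.swap ` S) = goodbox F S"
  by (simp add: goodbox_def inj_eq)

lemma block_swap: "block A e' e (prod.swap s) = prod.swap ` block A e e' s"
  by (auto simp: block_def)

lemma coarsen_swap: "coarsen A e e' F \<circ> prod.swap = coarsen A e' e (F \<circ> prod.swap)"
proof
  fix s
  have "(F \<circ> prod.swap) \<circ> prod.swap = F" by auto
  moreover have "goodbox F (block A e e' (prod.swap s)) = goodbox (F \<circ> prod.swap) (block A e' e s)"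
    using goodbox_swap[of "F \<circ> prod.swap" "block A e' e s"] block_swap[of A e e' s]
    by (simp add: comp_assoc)
  ultimately show "(coarsen A e e' F \<circ> prod.swap) s = coarsen A e' e (F \<circ> prod.swap) s"
    by (auto simp: coarsen_def Let_def)
qed

lemma linked_swap: "linked F R rep \<Longrightarrow> linked (F \<circ> prod.swap) R (\<lambda>i j. rep j i)"
proof -
  have "(F \<circ> prod.swap) \<circ> prod.swap = F" by auto
  then show "linked F R rep \<Longrightarrow> linked (F \<circ> prod.swap) R (\<lambda>i j. rep j i)"
    by (simp add: linked_def)
qed

section \<open>Connectivity inside good blocks and along tracks\<close>

lemma hlinked_run:
  assumes "hlinked F R rep" "equivp R" "\<And>x. 2*i+1 \<le> x \<Longrightarrow> x \<le> 2*(i+d)+1 \<Longrightarrow> F (x, 2*j+1)"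
  shows "R (rep i j) (rep (i+d) j)"
  using assms(3)
proof (induction d)
  case 0
  then show ?case using assms(2) by (simp add: equivp_reflp)
next
  case (Suc d)
  have "R (rep i j) (rep (i+d) j)" by (rule Suc.IH) (use Suc.prems in auto)
  moreover have "R (rep (i+d) j) (rep (Suc (i+d)) j)"
    using assms(1)[unfolded hlinked_def, rule_format, of "i+d" j] Suc.prems by simp
  ultimately show ?case using assms(2) by (metis add_Suc_right equivp_transp)
qed

lemma hlinked_row:
  assumes "hlinked F R rep" "equivp R"
    and "\<And>x. 2*i0+1 \<le> x \<Longrightarrow> x < 2*(i0+n) \<Longrightarrow> F (x, 2*j+1)"
    and "i \<in> {i0..<i0+n}" "i' \<in> {i0..<i0+n}"
  shows "R (rep i j) (rep i' j)"
proof -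
  have *: "R (rep i j) (rep i' j)" if "i \<le> i'" "i \<in> {i0..<i0+n}" "i' \<in> {i0..<i0+n}" for i i'
    using hlinked_run[OF assms(1,2), of i "i'-i" j] that assms(3) by auto
  show ?thesis
    using *[of i i'] *[of i' i] assms(2,4,5) by (metis equivp_symp linear)
qed

text \<open>One bad site cannot spoil two rows or two columns, so some full row and some full column
  exist; they form a cross to which every good vertex is linked. If the row of a vertex contains the
  bad site, its column does not: the two could only share the vertex itself, which is good.\<close>

lemma goodbox_connected:
  fixes i0 j0 n :: nat
  defines "S \<equiv> {2*i0+1..<2*(i0+n)} \<times> {2*j0+1..<2*(j0+n)}"
  assumes lnk: "linked F R rep" and R: "equivp R" and n: "2 \<le> n"
    and gb: "goodbox F S"
    and ij: "i \<in> {i0..<i0+n}" "j \<in> {j0..<j0+n}" "F (2*i+1, 2*j+1)"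
    and ij': "i' \<in> {i0..<i0+n}" "j' \<in> {j0..<j0+n}" "F (2*i'+1, 2*j'+1)"
  shows "R (rep i j) (rep i' j')"
proof -
  define row where "row j \<longleftrightarrow> (\<forall>x\<in>{2*i0+1..<2*(i0+n)}. F (x, 2*j+1))" for j
  define col where "col i \<longleftrightarrow> (\<forall>y\<in>{2*j0+1..<2*(j0+n)}. F (2*i+1, y))" for i
  have hl: "hlinked F R rep" and vl: "hlinked (F \<circ> prod.swap) R (\<lambda>i j. rep j i)"
    using lnk by (auto simp: linked_def)
  have gbD: "F s \<or> F t" if "s \<in> S" "t \<in> S" "usable s" "usable t" "s \<noteq> t" for s t
    using gb that unfolding goodbox_def by blast
  have rowR: "R (rep a j) (rep b j)" if "row j" "a \<in> {i0..<i0+n}" "b \<in> {i0..<i0+n}" for a b j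
    by (rule hlinked_row[OF hl R]) (use that in \<open>auto simp: row_def\<close>)
  have colR: "R (rep i a) (rep i b)" if "col i" "a \<in> {j0..<j0+n}" "b \<in> {j0..<j0+n}" for a b i
    by (rule hlinked_row[OF vl R]) (use that in \<open>auto simp: col_def\<close>)
  have "\<exists>j\<in>{j0..<j0+n}. row j"
  proof (rule ccontr)
    assume "\<not> ?thesis"
    then have "\<not> row j0" "\<not> row (Suc j0)" using n by auto
    then obtain x x' where "x \<in> {2*i0+1..<2*(i0+n)}" "\<not> F (x, 2*j0+1)"
      "x' \<in> {2*i0+1..<2*(i0+n)}" "\<not> F (x', 2*Suc j0+1)"
      unfolding row_def by blast
    then show False using gbD[of "(x, 2*j0+1)" "(x', 2*Suc j0+1)"] n
      by (auto simp: S_def usable_def)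
  qed
  then obtain jr where jr: "jr \<in> {j0..<j0+n}" "row jr" by blast
  have "\<exists>i\<in>{i0..<i0+n}. col i"
  proof (rule ccontr)
    assume "\<not> ?thesis"
    then have "\<not> col i0" "\<not> col (Suc i0)" using n by auto
    then obtain x x' where "x \<in> {2*j0+1..<2*(j0+n)}" "\<not> F (2*i0+1, x)"
      "x' \<in> {2*j0+1..<2*(j0+n)}" "\<not> F (2*Suc i0+1, x')"
      unfolding col_def by blast
    then show False using gbD[of "(2*i0+1, x)" "(2*Suc i0+1, x')"] n
      by (auto simp: S_def usable_def)
  qed
  then obtain ic where ic: "ic \<in> {i0..<i0+n}" "col ic" by blast
  have main: "R (rep i j) (rep ic jr)" if "i \<in> {i0..<i0+n}" "j \<in> {j0..<j0+n}" "F (2*i+1, 2*j+1)" for i j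
  proof (cases "row j")
    case True
    then show ?thesis using rowR[OF True that(1) ic(1)] colR[OF ic(2) that(2) jr(1)] R
      by (meson equivp_transp)
  next
    case False
    then obtain x where x: "x \<in> {2*i0+1..<2*(i0+n)}" "\<not> F (x, 2*j+1)" by (auto simp: row_def)
    have "col i" unfolding col_def
    proof
      fix y assume y: "y \<in> {2*j0+1..<2*(j0+n)}"
      show "F (2*i+1, y)"
      proof (rule ccontr)
        assume "\<not> F (2*i+1, y)"
        then show False using gbD[of "(2*i+1, y)" "(x, 2*j+1)"] x y that
          by (auto simp: S_def usable_def)
      qed
    qed
    then show ?thesis using colR[OF _ that(2) jr(1)] rowR[OF jr(2) that(1) ic(1)] R
      by (meson equivp_transp)
  qed
  show ?thesis using main[OF ij] main[OF ij'] R by (meson equivp_transp equivp_symp)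
qed

lemma block_inner:
  "block A e e' (2*I+1, 2*J+1) =
     {2*((2*A+2)*e I+1)+1..<2*((2*A+2)*e I+1+2*A)} \<times> {2*((2*A+2)*e' J+1)+1..<2*((2*A+2)*e' J+1+2*A)}"
  by (simp add: block_def lo_def algebra_simps numeral_3_eq_3)

text \<open>The fallback in \<open>coarse_rep\<close> moves horizontally and breaks the symmetry of
  the coordinates. This weaker property is invariant under the swap, so the vertical links follow
  from the horizontal ones.\<close>

definition represents :: "nat \<Rightarrow> (nat \<Rightarrow> nat) \<Rightarrow> (nat \<Rightarrow> nat) \<Rightarrow> (nat \<times> nat \<Rightarrow> bool) \<Rightarrow> (nat \<Rightarrow> nat \<Rightarrow> 'v)
    \<Rightarrow> (nat \<Rightarrow> nat \<Rightarrow> 'v) \<Rightarrow> bool" where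
  "represents A e e' F rep rep' \<longleftrightarrow> (\<forall>I J. goodbox F (block A e e' (2*I+1, 2*J+1)) \<longrightarrow>
     (\<exists>i\<in>{(2*A+2)*e I+1..<(2*A+2)*e I+1+2*A}. \<exists>j\<in>{(2*A+2)*e' J+1..<(2*A+2)*e' J+1+2*A}.
        F (2*i+1, 2*j+1) \<and> rep' I J = rep i j))"

lemma represents_swap:
  "represents A e e' F rep rep' \<Longrightarrow> represents A e' e (F \<circ> prod.swap) (\<lambda>i j. rep j i) (\<lambda>i j. rep' j i)"
  unfolding represents_def
proof (intro allI impI)
  fix I J
  assume *: "\<forall>I J. goodbox F (block A e e' (2*I+1, 2*J+1)) \<longrightarrow>
     (\<exists>i\<in>{(2*A+2)*e I+1..<(2*A+2)*e I+1+2*A}. \<exists>j\<in>{(2*A+2)*e' J+1..<(2*A+2)*e' J+1+2*A}.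
        F (2*i+1, 2*j+1) \<and> rep' I J = rep i j)"
    and g: "goodbox (F \<circ> prod.swap) (block A e' e (2*I+1, 2*J+1))"
  have "goodbox F (block A e e' (2*J+1, 2*I+1))"
    using g block_swap[of A e' e "(2*J+1, 2*I+1)"] goodbox_swap[of F "block A e e' (2*J+1, 2*I+1)"]
    by (metis block_swap swap_simp)
  then show "\<exists>i\<in>{(2*A+2)*e' I+1..<(2*A+2)*e' I+1+2*A}. \<exists>j\<in>{(2*A+2)*e J+1..<(2*A+2)*e J+1+2*A}.
        (F \<circ> prod.swap) (2*i+1, 2*j+1) \<and> rep' J I = rep j i"
    using *[rule_format, of J I] by auto
qed

lemma coarse_rep_represents:
  assumes "1 \<le> A"
  shows "represents A e e' F rep (coarse_rep A e e' F rep)"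
  unfolding represents_def
proof (intro allI impI)
  fix I J
  assume g: "goodbox F (block A e e' (2*I+1, 2*J+1))"
  define i where "i = (2*A+2) * e I + 1"
  define j where "j = (2*A+2) * e' J + 1"
  have "F (2*i+1, 2*j+1) \<or> F (2*Suc i+1, 2*j+1)"
    using g assms unfolding goodbox_def block_inner i_def[symmetric] j_def[symmetric]
    by (elim ballE[of _ _ "(2*i+1, 2*j+1)"] ballE[of _ _ "(2*Suc i+1, 2*j+1)"]) (auto simp: usable_def)
  moreover have "coarse_rep A e e' F rep I J = (if F (2*i+1, 2*j+1) then rep i j else rep (Suc i) j)"
    by (simp add: coarse_rep_def i_def j_def)
  ultimately have "\<exists>i'\<in>{i, Suc i}. F (2*i'+1, 2*j+1) \<and> coarse_rep A e e' F rep I J = rep i' j"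
    by auto
  then obtain i' where "i' \<in> {i, Suc i}" "F (2*i'+1, 2*j+1)" "coarse_rep A e e' F rep I J = rep i' j"
    by blast
  then have "\<exists>i'\<in>{i..<i+2*A}. \<exists>j'\<in>{j..<j+2*A}. F (2*i'+1, 2*j'+1) \<and> coarse_rep A e e' F rep I J = rep i' j'"
    using assms by (intro bexI[of _ i'] bexI[of _ j]) auto
  then show "\<exists>i\<in>{(2*A+2)*e I+1..<(2*A+2)*e I+1+2*A}. \<exists>j\<in>{(2*A+2)*e' J+1..<(2*A+2)*e' J+1+2*A}.
        F (2*i+1, 2*j+1) \<and> coarse_rep A e e' F rep I J = rep i j"
    by (simp add: i_def j_def)
qed

text \<open>The two parallel rows at each end of a track let it reach the adjacent block
  even if the unique bad site of that block happens to be the end point of the track.\<close>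

lemma coarsen_hlinked:
  assumes lnk: "linked F R rep" and R: "equivp R" and A: "1 \<le> A" and e: "strict_mono e"
    and rp: "represents A e e' F rep rep'"
  shows "hlinked (coarsen A e e' F) R rep'"
  unfolding hlinked_def
proof (intro allI impI)
  fix I J
  assume 1: "coarsen A e e' F (2*I+1, 2*J+1)" and 2: "coarsen A e e' F (2*I+2, 2*J+1)"
    and 3: "coarsen A e e' F (2*I+3, 2*J+1)"
  have hl: "hlinked F R rep" and vl: "hlinked (F \<circ> prod.swap) R (\<lambda>i j. rep j i)"
    using lnk by (auto simp: linked_def)
  define i0 where "i0 = (2*A+2) * e I + 1"
  define i1 where "i1 = (2*A+2) * e (Suc I) + 1"
  define j0 where "j0 = (2*A+2) * e' J + 1"
  have ii: "i0 + 2*A+2 \<le> i1"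
  proof -
    have "Suc (e I) \<le> e (Suc I)" using e by (simp add: Suc_leI strict_mono_Suc_iff)
    then have "(2*A+2) * Suc (e I) \<le> (2*A+2) * e (Suc I)" by (intro mult_le_mono2)
    then show ?thesis unfolding i0_def i1_def by simp
  qed
  have g1: "goodbox F ({2*i0+1..<2*(i0+2*A)} \<times> {2*j0+1..<2*(j0+2*A)})"
    using 1 by (simp add: coarsen_def block_inner[of A e e' I J, simplified] i0_def j0_def)
  have g3: "goodbox F ({2*i1+1..<2*(i1+2*A)} \<times> {2*j0+1..<2*(j0+2*A)})"
    using 3 block_inner[of A e e' "Suc I" J] by (simp add: coarsen_def i1_def j0_def numeral_3_eq_3)
  obtain a b where ab: "a \<in> {i0..<i0+2*A}" "b \<in> {j0..<j0+2*A}" "F (2*a+1, 2*b+1)" "rep' I J = rep a b"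
    using rp[unfolded represents_def, rule_format, of I J] g1
    unfolding block_inner i0_def j0_def by blast
  obtain c d where cd: "c \<in> {i1..<i1+2*A}" "d \<in> {j0..<j0+2*A}" "F (2*c+1, 2*d+1)" "rep' (Suc I) J = rep c d"
    using rp[unfolded represents_def, rule_format, of "Suc I" J] g3
    unfolding block_inner i1_def j0_def by blast
  have l: "lo A e (2*I+2) = 2*(i0+2*A)" by (simp add: lo_def i0_def algebra_simps)
  have h: "lo A e (Suc (2*I+2)) - 1 = 2*i1" by (simp add: lo_def i1_def algebra_simps)
  have y: "lo A e' (2*J+1) = 2*j0+1" by (simp add: lo_def j0_def algebra_simps)
  obtain t where t: "t < A" "\<And>s. s \<in> track (2*(i0+2*A)) (2*i1) (2*j0+1+4*t) \<Longrightarrow> F s"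
    using 2 l h y by (auto simp: coarsen_def crossing_def)
  \<comment> \<open>The track uses the lines \<open>j\<close> and \<open>Suc j\<close>. Below,
    \<open>p\<close> is the last column of the left block and \<open>Suc p\<close> the outer column
    of its unit; \<open>q\<close> and \<open>i1 = Suc q\<close> play the mirrored roles on the
    right.\<close>
  define j where "j = j0 + 2*t"
  define p where "p = i0+2*A-1"
  have p: "i0 + 2*A = Suc p" "2 \<le> A \<or> p = i0+1" using A by (auto simp: p_def)
  define q where "q = i1 - 1"
  have q: "i1 = Suc q" using ii by (simp add: q_def)
  have jj: "j \<in> {j0..<j0+2*A}" "Suc j \<in> {j0..<j0+2*A}" using t(1) by (auto simp: j_def)
  have tr: "F s" if "s \<in> track (2*Suc p) (2*Suc q) (2*j+1)" for s
    using t(2)[of s] that unfolding p(1) q by (simp add: j_def algebra_simps)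
  have pq: "p < q" using ii p q by simp
  have row: "F (x, 2*j+1)" if "2*Suc p \<le> x" "x \<le> 2*Suc q" for x
    by (rule tr) (use that in \<open>auto simp: track_def\<close>)
  have mid: "R (rep (Suc p) j) (rep q j)"
    using hlinked_run[OF hl R, of "Suc p" "q - Suc p" j] row pq by auto
  have up: "F (2*Suc p, 2*j+1)" "F (2*Suc p+1, 2*j+1)" "F (2*Suc p+1, 2*j+2)" "F (2*Suc p+1, 2*j+3)" "F (2*Suc p, 2*j+3)"
           "F (2*Suc q, 2*j+1)" "F (2*q+1, 2*j+1)" "F (2*q+1, 2*j+2)" "F (2*q+1, 2*j+3)" "F (2*Suc q, 2*j+3)"
    using pq by (auto intro!: tr simp: track_def)
  have "R (rep (Suc p) j) (rep (Suc p) (Suc j))"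
    using vl[unfolded hlinked_def, rule_format, of j "Suc p"] up by simp
  have "R (rep q j) (rep q (Suc j))"
    using vl[unfolded hlinked_def, rule_format, of j q] up by simp
  have left: "R (rep a b) (rep (Suc p) j)"
  proof (cases "F (2*p+1, 2*j+1)")
    case True
    have "R (rep a b) (rep p j)"
      by (rule goodbox_connected[OF lnk R _ g1 ab(1-3)]) (use True A jj p in auto)
    moreover have "R (rep p j) (rep (Suc p) j)"
      using hl[unfolded hlinked_def, rule_format, of p j] True up by (simp add: numeral_3_eq_3)
    ultimately show ?thesis using R by (meson equivp_transp)
  next
    case False
    have T: "F (2*p+1, 2*Suc j+1)"
      using g1[unfolded goodbox_def, rule_format, of "(2*p+1, 2*j+1)" "(2*p+1, 2*Suc j+1)"] False A jj p
      by (auto simp: usable_def)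
    have "R (rep a b) (rep p (Suc j))"
      by (rule goodbox_connected[OF lnk R _ g1 ab(1-3)]) (use T A jj p in auto)
    moreover have "R (rep p (Suc j)) (rep (Suc p) (Suc j))"
      using hl[unfolded hlinked_def, rule_format, of p "Suc j"] T up by (simp add: numeral_3_eq_3)
    ultimately show ?thesis using R \<open>R (rep (Suc p) j) (rep (Suc p) (Suc j))\<close>
      by (meson equivp_transp equivp_symp)
  qed
  have right: "R (rep c d) (rep q j)"
  proof (cases "F (2*i1+1, 2*j+1)")
    case True
    have "R (rep c d) (rep i1 j)"
      by (rule goodbox_connected[OF lnk R _ g3 cd(1-3)]) (use True A jj in auto)
    moreover have "R (rep q j) (rep i1 j)"
      using hl[unfolded hlinked_def, rule_format, of q j] True up q by (simp add: numeral_3_eq_3)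
    ultimately show ?thesis using R by (meson equivp_transp equivp_symp)
  next
    case False
    have T: "F (2*i1+1, 2*Suc j+1)"
      using g3[unfolded goodbox_def, rule_format, of "(2*i1+1, 2*j+1)" "(2*i1+1, 2*Suc j+1)"] False A jj
      by (auto simp: usable_def)
    have "R (rep c d) (rep i1 (Suc j))"
      by (rule goodbox_connected[OF lnk R _ g3 cd(1-3)]) (use T A jj in auto)
    moreover have "R (rep q (Suc j)) (rep i1 (Suc j))"
      using hl[unfolded hlinked_def, rule_format, of q "Suc j"] T up q by (simp add: numeral_3_eq_3)
    ultimately show ?thesis using R \<open>R (rep q j) (rep q (Suc j))\<close>
      by (meson equivp_transp equivp_symp)
  qed
  show "R (rep' I J) (rep' (Suc I) J)"
    using ab(4) cd(4) left mid right R by (metis equivp_transp equivp_symp)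
qed

lemma coarsen_linked:
  assumes lnk: "linked F R rep" and R: "equivp R" and A: "1 \<le> A" and e: "strict_mono e" "strict_mono e'"
  shows "linked (coarsen A e e' F) R (coarse_rep A e e' F rep)"
  unfolding linked_def coarsen_swap
  using coarsen_hlinked[OF lnk R A e(1) coarse_rep_represents[OF A]]
    coarsen_hlinked[OF linked_swap[OF lnk] R A e(2) represents_swap[OF coarse_rep_represents[OF A]]]
  by blast

section \<open>The probabilistic renormalisation step\<close>

abbreviation (in prob_space) indep_bools :: "('i \<Rightarrow> 'a \<Rightarrow> bool) \<Rightarrow> 'i set \<Rightarrow> bool" where
  "indep_bools \<equiv> indep_vars (\<lambda>_. count_space (UNIV :: bool set))"

text \<open>Here \<open>f j\<close> acts on the whole configuration and its locality is a
  hypothesis, so that \<open>coarsen\<close> and \<open>base_site\<close> fit without being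
  rewritten on restrictions. Finiteness of \<open>K j\<close> makes the product space discrete,
  which settles measurability.\<close>

lemma (in prob_space) indep_bools_local:
  fixes T :: "'i \<Rightarrow> 'a \<Rightarrow> bool"
  assumes T: "indep_bools T UNIV"
    and K: "\<And>j. j \<in> L \<Longrightarrow> finite (K j)" "disjoint_family_on K L"
    and f: "\<And>j F F'. j \<in> L \<Longrightarrow> (\<And>i. i \<in> K j \<Longrightarrow> F i = F' i) \<Longrightarrow> f j F = f j F'"
  shows "indep_bools (\<lambda>j \<omega>. f j (\<lambda>i. T i \<omega>)) L"
proof -
  have r: "indep_vars (\<lambda>j. PiM (K j) (\<lambda>_. count_space UNIV)) (\<lambda>j \<omega>. restrict (\<lambda>i. T i \<omega>) (K j)) L"
    by (rule indep_vars_restrict[OF T]) (use K in auto)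
  have "indep_bools (\<lambda>j \<omega>. f j (restrict (\<lambda>i. T i \<omega>) (K j))) L"
    by (rule indep_vars_compose2[OF r]) (simp add: count_space_PiM_finite K(1))
  also have "(\<lambda>j \<omega>. f j (restrict (\<lambda>i. T i \<omega>) (K j))) = 
    (\<lambda>j \<omega>. if j \<in> L then f j (\<lambda>i. T i \<omega>) else f j (restrict (\<lambda>i. T i \<omega>) (K j)))"
    using f by (fastforce simp: fun_eq_iff)
  finally show ?thesis
    by (rule indep_vars_cong[THEN iffD1, rotated -1]) auto
qed

lemma (in prob_space) indep_bools_prod:
  assumes "indep_bools X I" "finite J" "J \<subseteq> I"
  shows "\<P>(\<omega> in M. \<forall>i\<in>J. X i \<omega>) = (\<Prod>i\<in>J. \<P>(\<omega> in M. X i \<omega>))"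
proof (cases "J = {}")
  case True
  then show ?thesis by (simp add: prob_space)
next
  case False
  have "(\<Inter>i\<in>J. X i -` {True} \<inter> space M) = {\<omega>\<in>space M. \<forall>i\<in>J. X i \<omega>}"
    using False by auto
  moreover have "X i -` {True} \<inter> space M = {\<omega>\<in>space M. X i \<omega>}" for i by auto
  ultimately show ?thesis
    using indep_varsD[OF assms(1) False assms(2,3), of "\<lambda>_. {True}"] by simp
qed

lemma (in prob_space) indep_bools_sets:
  assumes "indep_bools X I" "i \<in> I"
  shows "{\<omega>\<in>space M. X i \<omega>} \<in> events"
proof -
  have "X i \<in> measurable M (count_space UNIV)"
    using assms by (auto simp: indep_vars_def)
  then show ?thesis by measurable
qed

lemma (in prob_space) indep_bools_neg:
  assumes "indep_bools X I"
  shows "indep_bools (\<lambda>i \<omega>. \<not> X i \<omega>) I"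
  using indep_vars_compose2[OF assms, of "\<lambda>_ b. \<not> b" "\<lambda>_. count_space UNIV"] by simp

lemma (in prob_space) prob_exists_attempt:
  assumes T: "indep_bools T UNIV" and S: "\<And>t. t < A \<Longrightarrow> finite (S t)" "disjoint_family_on S {..<A}"
    and p: "\<And>t. t < A \<Longrightarrow> \<pi> \<le> \<P>(\<omega> in M. \<forall>s\<in>S t. T s \<omega>)" and p1: "\<pi> \<le> 1"
  shows "1 - (1 - \<pi>) ^ A \<le> \<P>(\<omega> in M. \<exists>t<A. \<forall>s\<in>S t. T s \<omega>)"
proof -
  have ind: "indep_bools (\<lambda>t \<omega>. \<forall>s\<in>S t. T s \<omega>) {..<A}"
    by (rule indep_bools_local[OF T, where K=S]) (use S in auto)
  note ev = indep_bools_sets[OF ind]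
  have "\<P>(\<omega> in M. \<forall>t\<in>{..<A}. \<not> (\<forall>s\<in>S t. T s \<omega>)) = (\<Prod>t\<in>{..<A}. \<P>(\<omega> in M. \<not> (\<forall>s\<in>S t. T s \<omega>)))"
    by (rule indep_bools_prod[OF indep_bools_neg[OF ind]]) auto
  also have "\<dots> \<le> (\<Prod>t\<in>{..<A}. 1 - \<pi>)"
  proof (rule prod_mono, safe)
    fix t assume "t < A"
    then show "\<P>(\<omega> in M. \<not> (\<forall>s\<in>S t. T s \<omega>)) \<le> 1 - \<pi>"
      using prob_neg[OF ev[of t]] p[of t] by auto
  qed auto
  finally have "\<P>(\<omega> in M. \<forall>t\<in>{..<A}. \<not> (\<forall>s\<in>S t. T s \<omega>)) \<le> (1 - \<pi>) ^ A" by simp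
  moreover have "{\<omega>\<in>space M. \<exists>t<A. \<forall>s\<in>S t. T s \<omega>} = (\<Union>t\<in>{..<A}. {\<omega>\<in>space M. \<forall>s\<in>S t. T s \<omega>})" by auto
  then have "{\<omega>\<in>space M. \<exists>t<A. \<forall>s\<in>S t. T s \<omega>} \<in> events"
    using ev by auto
  from prob_neg[OF this] have "\<P>(\<omega> in M. \<forall>t\<in>{..<A}. \<not> (\<forall>s\<in>S t. T s \<omega>)) = 1 - \<P>(\<omega> in M. \<exists>t<A. \<forall>s\<in>S t. T s \<omega>)"
    by (simp add: Ball_def)
  ultimately show ?thesis by simp
qed

text \<open>Union bound over the ordered pairs of distinct usable sites; by independence each pair
  is bad with probability at most \<epsilon>^2.\<close>

lemma (in prob_space) prob_goodbox:
  assumes T: "indep_bools T UNIV" and S: "finite S"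
    and p: "\<And>s. s \<in> S \<Longrightarrow> usable s \<Longrightarrow> 1 - \<epsilon> \<le> \<P>(\<omega> in M. T s \<omega>)"
  shows "1 - real (card S)^2 * \<epsilon>^2 \<le> \<P>(\<omega> in M. goodbox (\<lambda>s. T s \<omega>) S)"
proof -
  define I where "I = {(s, t) \<in> S \<times> S. usable s \<and> usable t \<and> s \<noteq> t}"
  define B where "B = (\<lambda>(s, t). {\<omega>\<in>space M. \<not> T s \<omega> \<and> \<not> T t \<omega>})"
  have fin: "finite I" unfolding I_def using S by (auto intro: finite_subset[of _ "S \<times> S"])
  note ev = indep_bools_sets[OF indep_bools_neg[OF T]]
  have evB: "B i \<in> events" for i
  proof -
    have "B i = {\<omega>\<in>space M. \<not> T (fst i) \<omega>} \<inter> {\<omega>\<in>space M. \<not> T (snd i) \<omega>}"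
      by (auto simp: B_def split: prod.splits)
    then show ?thesis using ev by auto
  qed
  have pB: "prob (B i) \<le> \<epsilon>^2" if "i \<in> I" for i
  proof -
    obtain s t where i: "i = (s, t)" by (cases i)
    have q: "\<P>(\<omega> in M. \<not> T s \<omega>) \<le> \<epsilon>" if "s \<in> S" "usable s" for s
      using prob_neg[OF indep_bools_sets[OF T, of s]] p[OF that] by simp
    have "prob (B i) = \<P>(\<omega> in M. \<forall>i\<in>{s,t}. \<not> T i \<omega>)"
      by (simp add: B_def i)
    also have "\<dots> = (\<Prod>i\<in>{s,t}. \<P>(\<omega> in M. \<not> T i \<omega>))"
      by (rule indep_bools_prod[OF indep_bools_neg[OF T]]) auto
    also have "\<dots> = \<P>(\<omega> in M. \<not> T s \<omega>) * \<P>(\<omega> in M. \<not> T t \<omega>)"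
      using that by (simp add: I_def i)
    also have "\<dots> \<le> \<epsilon> * \<epsilon>"
      using that q[of s] q[of t] order_trans[OF measure_nonneg q[of s]] by (intro mult_mono) (auto simp: I_def i)
    finally show ?thesis by (simp add: power2_eq_square)
  qed
  have U: "{\<omega>\<in>space M. goodbox (\<lambda>s. T s \<omega>) S} = space M - (\<Union>i\<in>I. B i)"
    by (auto simp: goodbox_def I_def B_def)
  have "prob (\<Union>i\<in>I. B i) \<le> (\<Sum>i\<in>I. prob (B i))"
    by (rule measure_UNION_le[OF fin]) (use evB in auto)
  also have "\<dots> \<le> (\<Sum>i\<in>I. \<epsilon>^2)" by (rule sum_mono) (rule pB)
  also have "\<dots> \<le> real (card S)^2 * \<epsilon>^2"
  proof -
    have "card I \<le> card (S \<times> S)" by (rule card_mono) (use S in \<open>auto simp: I_def\<close>)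
    then have "real (card I) \<le> real (card S)^2" by (simp add: card_cartesian_product power2_eq_square flip: of_nat_mult)
    then show ?thesis by (simp add: mult_right_mono)
  qed
  finally show ?thesis
    unfolding U using evB fin by (subst prob_compl) auto
qed

definition wt :: "(nat \<Rightarrow> nat) \<Rightarrow> nat \<Rightarrow> nat" where
  "wt g x = (if odd x then 0 else g (x div 2))"

text \<open>A usable site has an odd coordinate, so at most one of the two weights is nonzero: both
  vanish at a vertex, and at an edge the sum is the mass of the gap it crosses.\<close>

definition (in prob_space) field :: "(nat \<times> nat \<Rightarrow> 'a \<Rightarrow> bool) \<Rightarrow> real \<Rightarrow> real \<Rightarrow> (nat \<Rightarrow> nat) \<Rightarrow> (nat \<Rightarrow> nat) \<Rightarrow> bool" where
  "field T \<epsilon> \<theta> g g' \<longleftrightarrow> indep_bools T UNIV \<and>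
     (\<forall>s. usable s \<longrightarrow> (1 - \<epsilon>) * \<theta> ^ (wt g (fst s) + wt g' (snd s)) \<le> \<P>(\<omega> in M. T s \<omega>))"

text \<open>Offset 0 of a good unit is the gap in front of it and is left free. The merged range
  runs to the end of the next good unit, whose inner gaps add nothing, and the subtraction of
  \<open>r\<close> truncates at 0. By the last clause skipped units are paid for by mass.
  \<open>G 0\<close> is unconstrained, since no usable site lies in the gap before the first
  column.\<close>

definition coarsening :: "nat \<Rightarrow> nat \<Rightarrow> (nat \<Rightarrow> nat) \<Rightarrow> (nat \<Rightarrow> nat) \<Rightarrow> (nat \<Rightarrow> nat) \<Rightarrow> bool" where
  "coarsening A r g e G \<longleftrightarrow> strict_mono e \<and>
     (\<forall>I. \<forall>s\<in>{1..2*A+1}. g ((2*A+2) * e I + s) = 0) \<and>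
     (\<forall>I. G (Suc I) = (\<Sum>i=(2*A+2)*Suc (e I)..<(2*A+2)*Suc (e (Suc I)). g i) - r) \<and>
     (\<forall>I. e (Suc I) \<le> Suc (e I) + (\<Sum>i=(2*A+2)*Suc (e I)..<(2*A+2)*Suc (e (Suc I)). g i))"

lemma (in prob_space) field_swap:
  assumes "field T \<epsilon> \<theta> g g'"
  shows "field (\<lambda>s. T (prod.swap s)) \<epsilon> \<theta> g' g"
proof -
  have "indep_bools (\<lambda>j \<omega>. (\<lambda>F. F (prod.swap j)) (\<lambda>i. T i \<omega>)) UNIV"
    by (rule indep_bools_local[where K="\<lambda>j. {prod.swap j}"])
       (use assms in \<open>auto simp: field_def disjoint_family_on_def\<close>)
  moreover have "(1 - \<epsilon>) * \<theta> ^ (wt g' (fst s) + wt g (snd s)) \<le> \<P>(\<omega> in M. T (prod.swap s) \<omega>)" if "usable s" for s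
    using assms[unfolded field_def, THEN conjunct2, rule_format, of "prod.swap s"] that
    by (simp add: add.commute)
  ultimately show ?thesis by (simp add: field_def)
qed

section \<open>Disjoint domains of dependence of the coarse sites\<close>

lemma lo_strict_mono:
  assumes "strict_mono e" "1 \<le> A"
  shows "strict_mono (lo A e)"
  unfolding strict_mono_Suc_iff
proof
  fix x
  have "e i + 1 \<le> e (Suc i)" for i using assms by (simp add: Suc_leI strict_mono_Suc_iff)
  then have *: "(4*A+4) * e i + (4*A+4) \<le> (4*A+4) * e (Suc i)" for i
    by (metis add_mult_distrib2 mult_le_mono2 nat_mult_1_right)
  show "lo A e x < lo A e (Suc x)"
  proof (cases "odd x")
    case True
    then show ?thesis using assms(2) by (auto simp: lo_def elim!: oddE)
  next
    case False
    then obtain i where "x = 2*i" by blast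
    then show ?thesis using *[of "i-1"] by (cases i) (auto simp: lo_def)
  qed
qed

lemma disjoint_spans:
  fixes l :: "nat \<Rightarrow> nat"
  assumes "strict_mono l" "x \<noteq> x'"
  shows "{l x..<l (Suc x)} \<inter> {l x'..<l (Suc x')} = {}"
proof -
  have "l (Suc x) \<le> l x'" if "x < x'" for x x'
    using that assms(1) by (simp add: strict_mono_less_eq Suc_leI)
  then show ?thesis using assms(2) by (cases "x < x'") (force simp: not_less_iff_gr_or_eq)+
qed

lemma disjoint_blocks:
  assumes "strict_mono e" "strict_mono e'" "1 \<le> A"
  shows "disjoint_family (block A e e')"
  unfolding disjoint_family_on_def
proof (intro ballI impI)
  fix s t :: "nat \<times> nat" assume "s \<noteq> t"
  then show "block A e e' s \<inter> block A e e' t = {}"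
    using disjoint_spans[OF lo_strict_mono[OF assms(1,3)], of "fst s" "fst t"]
      disjoint_spans[OF lo_strict_mono[OF assms(2,3)], of "snd s" "snd t"]
    unfolding block_def by (auto simp: prod_eq_iff)
qed

lemma track_block:
  assumes "strict_mono e" "1 \<le> A" "odd (snd s)" "t < A"
  shows "track (lo A e (fst s)) (lo A e (Suc (fst s)) - 1) (lo A e' (snd s) + 4*t) \<subseteq> block A e e' s"
proof -
  define l where "l = lo A e (fst s)"
  define h where "h = lo A e (Suc (fst s)) - 1"
  have h: "lo A e (Suc (fst s)) = Suc h" "l \<le> h"
    using lo_strict_mono[OF assms(1,2), unfolded strict_mono_Suc_iff, rule_format, of "fst s"]
    by (auto simp: h_def l_def)
  have "2 \<le> h - l \<or> h - l = 1 \<or> h = l" using h by arith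
  have len: "2 \<le> h - l"
  proof (cases "odd (fst s)")
    case True
    then obtain i where i: "fst s = 2*i+1" by (elim oddE)
    show ?thesis unfolding h_def l_def using assms(2) by (simp add: i lo_def)
  next
    case False
    then obtain i where i: "fst s = 2*i" by blast
    have "e (i-1) + 1 \<le> e i" if "i > 0" using assms that by (cases i) (simp_all add: Suc_leI strict_mono_Suc_iff)
    then have "(4*A+4) * e (i-1) + (4*A+4) \<le> (4*A+4) * e i" if "i > 0"
      using that by (metis add_mult_distrib2 mult_le_mono2 nat_mult_1_right)
    then show ?thesis unfolding h_def l_def by (cases "i = 0") (auto simp: i lo_def)
  qed
  \<comment> \<open>The last track, \<open>t = A-1\<close>, reaches offset 4(A-1)+2 = 4A-2, exactly
    the last of the 4A-1 doubled coordinates of a coarse line.\<close>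
  have "lo A e' (Suc (snd s)) = lo A e' (snd s) + (4*A-1)"
    using assms(2,3) by (auto simp: lo_def elim!: oddE)
  then show ?thesis using h len assms(4)
    unfolding block_def track_def l_def[symmetric] h(1) by (auto simp: l_def[symmetric] h_def[symmetric])
qed

lemma coarsen_local:
  assumes "strict_mono e" "strict_mono e'" "1 \<le> A"
    and "\<And>i. i \<in> block A e e' s \<Longrightarrow> F i = F' i"
  shows "coarsen A e e' F s = coarsen A e e' F' s"
proof -
  have 1: "goodbox F (block A e e' s) = goodbox F' (block A e e' s)"
    using assms(4) unfolding goodbox_def by blast
  have 2: "crossing F A (lo A e (fst s)) (lo A e (Suc (fst s)) - 1) (lo A e' (snd s)) =
      crossing F' A (lo A e (fst s)) (lo A e (Suc (fst s)) - 1) (lo A e' (snd s))" if "odd (snd s)"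
    unfolding crossing_def using track_block[OF assms(1,3) that] assms(4) by (meson subsetD)
  have 3: "crossing (F \<circ> prod.swap) A (lo A e' (snd s)) (lo A e' (Suc (snd s)) - 1) (lo A e (fst s)) =
      crossing (F' \<circ> prod.swap) A (lo A e' (snd s)) (lo A e' (Suc (snd s)) - 1) (lo A e (fst s))" if "odd (fst s)"
  proof -
    have sub: "prod.swap x \<in> block A e e' s"
      if "x \<in> track (lo A e' (snd s)) (lo A e' (Suc (snd s)) - 1) (lo A e (fst s) + 4*t)" "t < A" for x t
      using track_block[OF assms(2,3), of "prod.swap s" t e] that \<open>odd (fst s)\<close>
        block_swap[of A e e' "prod.swap s"] by auto
    then show ?thesis unfolding crossing_def comp_def using assms(4) by meson
  qed
  show ?thesis using 1 2 3 by (simp add: coarsen_def Let_def)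
qed

text \<open>Put y = \<theta>^(S-r) and K = A \<theta>^r / 2. Truncation gives \<theta>^r y <=
  \<theta>^S, so all attempts fail with probability at most exp(-K y). By convexity of exp on
  [-K, 0] this is at most 1 - y + y exp(-K), which keeps y as a factor of the success probability
  however small y is.\<close>

lemma attempts_bound:
  fixes \<theta> \<pi> \<epsilon> :: real
  assumes "0 < \<theta>" "\<theta> \<le> 1" "\<pi> \<le> 1" "\<theta> ^ S / 2 \<le> \<pi>" "exp (- (real A * \<theta> ^ r / 2)) \<le> \<epsilon>"
  shows "(1 - \<epsilon>) * \<theta> ^ (S - r) \<le> 1 - (1 - \<pi>) ^ A"
proof -
  define y where "y = \<theta> ^ (S - r)"
  define K where "K = real A * \<theta> ^ r / 2"
  have y: "0 \<le> y" "y \<le> 1" using assms by (auto simp: y_def power_le_one)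
  have "\<theta> ^ r * y \<le> \<theta> ^ S"
  proof (cases "S \<le> r")
    case True
    then show ?thesis using assms power_decreasing[of S r \<theta>] by (simp add: y_def)
  next
    case False
    then show ?thesis by (simp add: y_def flip: power_add)
  qed
  then have p: "\<theta> ^ r * y / 2 \<le> \<pi>" using assms(4) by simp
  have "(1 - \<pi>) ^ A \<le> exp (-\<pi>) ^ A"
    using assms(3) exp_ge_add_one_self[of "-\<pi>"] by (intro power_mono) auto
  also have "\<dots> = exp (- (real A * \<pi>))" by (simp flip: exp_of_nat_mult)
  also have "\<dots> \<le> exp (- (K * y))"
  proof -
    have "real A * (\<theta> ^ r * y / 2) \<le> real A * \<pi>" using p by (intro mult_left_mono) auto
    then show ?thesis by (simp add: K_def mult_ac)
  qed
  also have "\<dots> \<le> (1 - y) * exp 0 + y * exp (-K)"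
    using convex_onD[OF exp_convex, of y 0 "-K"] y by (simp add: mult_ac)
  also have "\<dots> \<le> 1 - (1 - \<epsilon>) * y"
    using assms(5) y mult_left_mono[of "exp (-K)" \<epsilon> y] by (simp add: K_def algebra_simps)
  finally show ?thesis by (simp add: y_def)
qed

lemma coarsening_zero:
  "coarsening A r g e G \<Longrightarrow> 1 \<le> s \<Longrightarrow> s \<le> 2*A+1 \<Longrightarrow> g ((2*A+2) * e I + s) = 0"
  by (simp add: coarsening_def)

lemma finite_track [simp]: "finite (track l h y)"
  by (simp add: track_def)

lemma finite_block [simp]: "finite (block A e e' s)"
  by (simp add: block_def)

lemma card_track: "l \<le> h \<Longrightarrow> card (track l h y) \<le> h - l + 7"
proof -
  assume "l \<le> h"
  have "card (track l h y) \<le> card ({l..h} \<times> {y}) + card ({l+1, h-1} \<times> {y+1}) + card ({l, l+1, h-1, h} \<times> {y+2})"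
    unfolding track_def by (meson card_Un_le add_mono order_trans order_refl)
  also have "\<dots> \<le> (Suc h - l) + 2 + 4"
    by (intro add_mono) (auto simp: card_cartesian_product card_insert_if)
  finally show ?thesis using \<open>l \<le> h\<close> by simp
qed

text \<open>A gap of the coarse lattice that swallows \<open>m\<close> bad units costs \<open>O(A m)\<close> further sites,
  each with failure probability \<open>\<epsilon>\<close>; since every bad unit carries mass at least one, this is
  absorbed by lowering \<open>\<theta>\<close> to \<open>\<theta>'\<close>.\<close>

lemma (in prob_space) prob_track:
  fixes I j :: nat
  assumes F: "field T \<epsilon> \<theta> g g'" and e: "coarsening A r g e G" and A: "1 \<le> A"
    and \<epsilon>: "0 \<le> \<epsilon>" "\<epsilon> \<le> 1" and \<theta>: "0 < \<theta>" "\<theta> \<le> 1"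
    and \<theta>': "0 < \<theta>'" "\<theta>' \<le> \<theta> * (1 - \<epsilon>) ^ (4*A+4)" and half: "1/2 \<le> (1 - \<epsilon>) ^ 11"
    and row: "g' (Suc j) = 0"
  defines "S \<equiv> \<Sum>i=(2*A+2)*Suc (e I)..<(2*A+2)*Suc (e (Suc I)). g i"
  defines "tr \<equiv> track (lo A e (2*I+2)) (lo A e (2*I+3) - 1) (2*j+1)"
  shows "\<theta>' ^ S / 2 \<le> \<P>(\<omega> in M. \<forall>s\<in>tr. T s \<omega>)"
proof -
  \<comment> \<open>In undoubled terms the track runs from the gap before the last line of unit
    \<open>e I\<close> to the gap after the first line of unit \<open>e (Suc I)\<close>. Both end
    gaps are interior to good units, hence massless.\<close>
  define l where "l = (2*A+2)*e I + 2*A+1"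
  define h where "h = (2*A+2)*e (Suc I) + 1"
  have e': "Suc (e I) \<le> e (Suc I)" "e (Suc I) \<le> Suc (e I) + S"
    using e unfolding coarsening_def S_def strict_mono_Suc_iff by (blast intro: Suc_leI)+
  note zero = coarsening_zero[OF e]
  have "(2*A+2) * Suc (e I) \<le> (2*A+2) * e (Suc I)" by (rule mult_le_mono2[OF e'(1)])
  then have lh: "l + 2 \<le> h" by (simp add: l_def h_def)
  have tr: "tr = track (2*l) (2*h) (2*j+1)"
    by (simp add: tr_def l_def h_def lo_def algebra_simps numeral_3_eq_3)
  have hl: "h - l \<le> (2*A+2) * S + 2"
  proof -
    have "(2*A+2) * e (Suc I) \<le> (2*A+2) * (Suc (e I) + S)" by (rule mult_le_mono2[OF e'(2)])
    then show ?thesis by (simp add: l_def h_def algebra_simps)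
  qed
  define w where "w s = wt g (fst s) + wt g' (snd s)" for s :: "nat \<times> nat"
  have us: "usable s" if "s \<in> tr" for s
    using that lh by (auto simp: tr track_def usable_def l_def)
  have gl: "g l = 0" using zero[of "2*A+1" I] by (simp add: l_def add_ac)
  have gh: "g h = 0" using zero[of 1 "Suc I"] by (simp add: h_def)
  have "(\<Sum>s\<in>tr. w s) \<le> (\<Sum>x\<in>{2*l..2*h}. wt g x)"
  proof -
    have z: "w s = 0" if "s \<in> tr" "s \<notin> {2*l..2*h} \<times> {2*j+1}" for s
      using that lh gl gh row by (auto simp: tr track_def w_def wt_def)
    have "(\<Sum>s\<in>tr. w s) = (\<Sum>s\<in>{2*l..2*h} \<times> {2*j+1}. w s)"
    proof (rule sum.mono_neutral_right)
      show "finite tr" by (simp add: tr)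
      show "{2*l..2*h} \<times> {2*j+1} \<subseteq> tr" unfolding tr track_def by blast
      show "\<forall>s\<in>tr - {2*l..2*h} \<times> {2*j+1}. w s = 0" using z by blast
    qed
    also have "\<dots> = (\<Sum>x\<in>{2*l..2*h}. wt g x)"
    proof -
      have "{2*l..2*h} \<times> {2*j+1} = (\<lambda>x. (x, 2*j+1)) ` {2*l..2*h}" by auto
      then show ?thesis by (simp add: sum.reindex inj_on_def w_def wt_def cong: if_cong)
    qed
    finally show ?thesis by simp
  qed
  also have "\<dots> = (\<Sum>x\<in>(\<lambda>i. 2*i) ` {l..h}. wt g x)"
  proof (rule sum.mono_neutral_right)
    show "\<forall>i\<in>{2 * l..2 * h} - (\<lambda>i. 2*i) ` {l..h}. wt g i = 0"
      by (auto simp: wt_def elim!: evenE)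
  qed auto
  also have "\<dots> = (\<Sum>i\<in>{l..h}. g i)"
    by (subst sum.reindex) (auto simp: inj_on_def wt_def)
  also have "\<dots> = (\<Sum>i\<in>{Suc l..h}. g i)"
    using gl lh by (subst sum.atLeast_Suc_atMost) auto
  also have "\<dots> \<le> S"
    unfolding S_def by (rule sum_mono2) (auto simp: l_def h_def algebra_simps)
  finally have W: "(\<Sum>s\<in>tr. w s) \<le> S" .
  \<comment> \<open>Twice the bound on \<open>h - l\<close> gives (4A+4)S + 4, and
    \<open>card_track\<close> adds 7. The part proportional to S is charged to \<theta>', the
    remaining 11 sites to the factor 1/2.\<close>
  have ctr: "card tr \<le> (4*A+4) * S + 11"
  proof -
    have "2 * ((2*A+2) * S) = (4*A+4) * S" by (simp add: algebra_simps)
    moreover have "card tr \<le> 2*h - 2*l + 7" unfolding tr by (rule card_track) (use lh in simp)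
    ultimately show ?thesis using lh hl by linarith
  qed
  have "\<theta>' ^ S * (1/2) \<le> (\<theta> * (1 - \<epsilon>) ^ (4*A+4)) ^ S * (1 - \<epsilon>) ^ 11"
    using \<theta>' half \<epsilon> by (intro mult_mono power_mono) auto
  also have "\<dots> = (1 - \<epsilon>) ^ ((4*A+4) * S + 11) * \<theta> ^ S"
  proof -
    have "(\<theta> * x ^ w) ^ S * x ^ 11 = x ^ (w * S + 11) * \<theta> ^ S" for x :: real and w
      by (simp add: power_mult_distrib power_add flip: power_mult)
    then show ?thesis .
  qed
  also have "\<dots> \<le> (1 - \<epsilon>) ^ card tr * \<theta> ^ (\<Sum>s\<in>tr. w s)"
  proof (rule mult_mono)
    show "(1 - \<epsilon>) ^ ((4*A+4) * S + 11) \<le> (1 - \<epsilon>) ^ card tr"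
      by (rule power_decreasing[OF ctr]) (use \<epsilon> in auto)
    show "\<theta> ^ S \<le> \<theta> ^ (\<Sum>s\<in>tr. w s)"
      by (rule power_decreasing[OF W]) (use \<theta> in auto)
  qed (use \<epsilon> \<theta> in auto)
  also have "\<dots> = (\<Prod>s\<in>tr. (1 - \<epsilon>) * \<theta> ^ w s)"
    by (simp add: prod.distrib power_sum)
  also have "\<dots> \<le> (\<Prod>s\<in>tr. \<P>(\<omega> in M. T s \<omega>))"
    using F us \<epsilon> \<theta> by (intro prod_mono) (auto simp: field_def w_def)
  also have "\<dots> = \<P>(\<omega> in M. \<forall>s\<in>tr. T s \<omega>)"
    by (rule indep_bools_prod[symmetric, of _ UNIV]) (use F in \<open>auto simp: field_def tr\<close>)
  finally show ?thesis by simp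
qed

lemma (in prob_space) prob_crossing:
  assumes F: "field T \<epsilon> \<theta> g g'" and e: "coarsening A r g e G" and e': "coarsening A r g' e' G'" and A: "1 \<le> A"
    and \<epsilon>: "0 \<le> \<epsilon>" "\<epsilon> \<le> 1" and \<theta>: "0 < \<theta>" "\<theta> \<le> 1"
    and \<theta>': "0 < \<theta>'" "\<theta>' \<le> \<theta> * (1 - \<epsilon>) ^ (4*A+4)" and half: "1/2 \<le> (1 - \<epsilon>) ^ 11"
    and \<epsilon>': "exp (- (real A * \<theta>' ^ r / 2)) \<le> \<epsilon>'"
  shows "(1 - \<epsilon>') * \<theta>' ^ G (Suc I)
      \<le> \<P>(\<omega> in M. crossing (\<lambda>s. T s \<omega>) A (lo A e (2*I+2)) (lo A e (2*I+3) - 1) (lo A e' (2*J+1)))"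
proof -
  define S where "S = (\<Sum>i=(2*A+2)*Suc (e I)..<(2*A+2)*Suc (e (Suc I)). g i)"
  define tr where "tr y = track (lo A e (2*I+2)) (lo A e (2*I+3) - 1) y" for y
  have G: "G (Suc I) = S - r" using e by (simp add: coarsening_def S_def)
  have T: "indep_bools T UNIV" using F by (simp add: field_def)
  have dis: "disjoint_family_on (\<lambda>t. tr (lo A e' (2*J+1) + 4*t)) {..<A}"
    by (auto simp: disjoint_family_on_def tr_def track_def)
  have "(1 - \<epsilon>) ^ (4*A+4) \<le> 1" using \<epsilon> by (simp add: power_le_one)
  then have "\<theta> * (1 - \<epsilon>) ^ (4*A+4) \<le> 1 * 1" using \<theta> \<epsilon> by (intro mult_mono) auto
  then have \<theta>1: "\<theta>' \<le> 1" using \<theta>' by simp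
  have p: "\<theta>' ^ S / 2 \<le> \<P>(\<omega> in M. \<forall>s\<in>tr (lo A e' (2*J+1) + 4*t). T s \<omega>)" if "t < A" for t
  proof -
    \<comment> \<open>The gap between the two lines of track \<open>t\<close> has offset 2t+2 <= 2A
      in its unit, so it is an inner, massless gap.\<close>
    have "(2*A+2) * e' J + 1 + 2*t + 1 = (2*A+2) * e' J + (2*t+2)" by simp
    moreover have "g' ((2*A+2) * e' J + (2*t+2)) = 0"
      by (rule coarsening_zero[OF e']) (use that in auto)
    ultimately have "g' (Suc ((2*A+2) * e' J + 1 + 2*t)) = 0"
      by simp
    from prob_track[OF F e A \<epsilon> \<theta> \<theta>' half this]
    have "\<theta>' ^ S / 2 \<le> \<P>(\<omega> in M. \<forall>s\<in>tr (2*((2*A+2) * e' J + 1 + 2*t)+1). T s \<omega>)"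
      unfolding tr_def S_def .
    moreover have "lo A e' (2*J+1) + 4*t = 2*((2*A+2) * e' J + 1 + 2*t)+1"
      by (simp add: lo_def algebra_simps)
    ultimately show ?thesis by (simp only:)
  qed
  have "\<theta>' ^ S \<le> 1" using \<theta>1 \<theta>' by (simp add: power_le_one)
  then have "(1 - \<epsilon>') * \<theta>' ^ (S - r) \<le> 1 - (1 - \<theta>' ^ S / 2) ^ A"
    using \<theta>' \<theta>1 \<epsilon>' by (intro attempts_bound) auto
  also have "\<dots> \<le> \<P>(\<omega> in M. \<exists>t<A. \<forall>s\<in>tr (lo A e' (2*J+1) + 4*t). T s \<omega>)"
    by (rule prob_exists_attempt[OF T _ dis p]) (use \<open>\<theta>' ^ S \<le> 1\<close> in \<open>auto simp: tr_def\<close>)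
  finally show ?thesis by (simp add: crossing_def tr_def G)
qed

text \<open>Independence is \<open>coarsen_local\<close> on disjoint blocks. A block has (4A-1)^2
  sites, all of weight 0, hence fewer than 256 A^4 ordered pairs for \<open>prob_goodbox\<close>.
  Vertical edges are horizontal edges of the swapped field.\<close>

lemma (in prob_space) field_coarsen:
  assumes F: "field T \<epsilon> \<theta> g g'" and e: "coarsening A r g e G" and e': "coarsening A r g' e' G'" and A: "1 \<le> A"
    and \<epsilon>: "0 \<le> \<epsilon>" "\<epsilon> \<le> 1" and \<theta>: "0 < \<theta>" "\<theta> \<le> 1"
    and \<theta>': "0 < \<theta>'" "\<theta>' \<le> \<theta> * (1 - \<epsilon>) ^ (4*A+4)" and half: "1/2 \<le> (1 - \<epsilon>) ^ 11"
    and \<epsilon>': "exp (- (real A * \<theta>' ^ r / 2)) \<le> \<epsilon>'" "256 * real A ^ 4 * \<epsilon>^2 \<le> \<epsilon>'"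
  shows "field (\<lambda>s \<omega>. coarsen A e e' (\<lambda>s. T s \<omega>) s) \<epsilon>' \<theta>' G G'"
proof -
  have sm: "strict_mono e" "strict_mono e'" using e e' by (auto simp: coarsening_def)
  have T: "indep_bools T UNIV" using F by (simp add: field_def)
  have "indep_bools (\<lambda>s \<omega>. coarsen A e e' (\<lambda>s. T s \<omega>) s) UNIV"
    by (rule indep_bools_local[OF T finite_block disjoint_blocks[OF sm A], where f="\<lambda>s F. coarsen A e e' F s"])
       (rule coarsen_local[OF sm A])
  moreover have "(1 - \<epsilon>') * \<theta>' ^ (wt G (fst s) + wt G' (snd s)) \<le> \<P>(\<omega> in M. coarsen A e e' (\<lambda>s. T s \<omega>) s)"
    if us: "usable s" for s
  proof -
    obtain x y where s: "s = (x, y)" by (cases s)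
    consider (box) I J where "x = 2*I+1" "y = 2*J+1" | (hor) I J where "x = 2*I+2" "y = 2*J+1"
      | (ver) I J where "x = 2*I+1" "y = 2*J+2"
    proof -
      have "odd x \<and> odd y \<or> (even x \<and> 0 < x \<and> odd y) \<or> (odd x \<and> even y \<and> 0 < y)"
        using us by (auto simp: usable_def s)
      moreover have "\<exists>I. n = 2*I+1" if "odd n" for n :: nat using that by (auto elim: oddE)
      moreover have "\<exists>I. n = 2*I+2" if "even n" "0 < n" for n :: nat using that by presburger
      ultimately show thesis using that by metis
    qed
    then show ?thesis
    proof cases
      case box
      define S where "S = block A e e' s"
      have p: "1 - \<epsilon> \<le> \<P>(\<omega> in M. T t \<omega>)" if t: "t \<in> S" "usable t" for t
      proof -
        have z: "wt f u = 0" if "u \<in> {2*(c+1)+1..<2*(c+1+2*A)}" "\<forall>s\<in>{1..2*A+1}. f (c + s) = 0"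
          for f :: "nat \<Rightarrow> nat" and c u
        proof (cases "odd u")
          case False
          then obtain i where i: "u = 2*i" by blast
          define s where "s = i - c"
          have "i = c + s" "s \<in> {1..2*A+1}" using that(1) i by (auto simp: s_def)
          then have "f i = 0" using that(2) by (simp only:)
          then show ?thesis by (simp add: wt_def i)
        qed (simp add: wt_def)
        note t' = t(1)[unfolded S_def s box block_inner mem_Times_iff]
        have "wt g (fst t) = 0"
          using e z[of "fst t" "(2*A+2) * e I" g, OF conjunct1[OF t']] unfolding coarsening_def by blast
        moreover have "wt g' (snd t) = 0"
          using e' z[of "snd t" "(2*A+2) * e' J" g', OF conjunct2[OF t']] unfolding coarsening_def by blast
        moreover have "(1 - \<epsilon>) * \<theta> ^ (wt g (fst t) + wt g' (snd t)) \<le> \<P>(\<omega> in M. T t \<omega>)"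
          using F t(2) unfolding field_def by blast
        ultimately show ?thesis by simp
      qed
      have "card S = (4*A - 1)^2"
        unfolding S_def s box block_inner card_cartesian_product by (simp add: power2_eq_square)
      then have "card S \<le> (4*A)^2" by (metis diff_le_self power_mono zero_le)
      then have "real (card S) \<le> real ((4*A)^2)" by (simp only: of_nat_le_iff)
      then have "real (card S)^2 \<le> (real ((4*A)^2))^2" by (intro power_mono) simp_all
      then have "real (card S)^2 * \<epsilon>^2 \<le> 256 * real A ^ 4 * \<epsilon>^2"
        by (intro mult_right_mono) (auto simp: power_mult_distrib)
      then have "1 - \<epsilon>' \<le> 1 - real (card S)^2 * \<epsilon>^2" using \<epsilon>' by simp
      also have "\<dots> \<le> \<P>(\<omega> in M. goodbox (\<lambda>s. T s \<omega>) S)"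
        by (rule prob_goodbox[OF T _ p]) (auto simp: S_def)
      finally show ?thesis by (simp add: s box wt_def coarsen_def S_def)
    next
      case hor
      then show ?thesis
        using prob_crossing[OF F e e' A \<epsilon> \<theta> \<theta>' half \<epsilon>'(1), of I J]
        by (simp add: s wt_def coarsen_def numeral_3_eq_3)
    next
      case ver
      then show ?thesis
        using prob_crossing[OF field_swap[OF F] e' e A \<epsilon> \<theta> \<theta>' half \<epsilon>'(1), of J I]
        by (simp add: s wt_def coarsen_def numeral_3_eq_3 comp_def)
    qed
  qed
  ultimately show ?thesis by (simp add: field_def)
qed

section \<open>Merging an i.i.d. sequence\<close>

text \<open>A sequence is cut into units of \<open>n\<close> entries; \<open>good_unit\<close> is the first unit
  satisfying \<open>G\<close>.  Everything up to and including it is merged into a single entry.\<close>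

definition good_unit :: "nat \<Rightarrow> ('a stream \<Rightarrow> bool) \<Rightarrow> 'a stream \<Rightarrow> nat" where
  "good_unit n G s = (LEAST u. G (sdrop (n * u) s))"

definition merged :: "nat \<Rightarrow> ('a stream \<Rightarrow> bool) \<Rightarrow> ('a \<Rightarrow> nat) \<Rightarrow> 'a stream \<Rightarrow> nat" where
  "merged n G m s = (\<Sum>i<n * Suc (good_unit n G s). m (s !! i))"

text \<open>The unit at which the \<open>I\<close>-th merge begins, that is, the one right after the
  preceding good unit; so the \<open>I\<close>-th good unit is
  \<open>start n G s (Suc I) - 1\<close>.\<close>

primrec start :: "nat \<Rightarrow> ('a stream \<Rightarrow> bool) \<Rightarrow> 'a stream \<Rightarrow> nat \<Rightarrow> nat" where
  "start n G s 0 = 0"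
| "start n G s (Suc I) = Suc (start n G s I + good_unit n G (sdrop (n * start n G s I) s))"

definition merge :: "nat \<Rightarrow> ('a stream \<Rightarrow> bool) \<Rightarrow> ('a \<Rightarrow> nat) \<Rightarrow> nat \<Rightarrow> 'a stream \<Rightarrow> nat stream" where
  "merge n G m r s = to_stream (\<lambda>I. merged n G m (sdrop (n * start n G s I) s) - r)"

lemma start_shift:
  "start n G s (Suc I) = Suc (good_unit n G s) + start n G (sdrop (n * Suc (good_unit n G s)) s) I"
proof (induction I)
  case 0
  then show ?case by simp
next
  case (Suc I)
  define t where "t = sdrop (n * Suc (good_unit n G s)) s"
  have IH: "start n G s (Suc I) = Suc (good_unit n G s) + start n G t I"
    using Suc.IH by (simp only: t_def)
  have "sdrop (n * start n G s (Suc I)) s = sdrop (n * start n G t I) t"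
    by (simp only: IH t_def sdrop_add distrib_left)
  then have "start n G s (Suc (Suc I)) = Suc (start n G s (Suc I) + good_unit n G (sdrop (n * start n G t I) t))"
    by (simp only: start.simps(2)[of n G s "Suc I"])
  also have "\<dots> = Suc (Suc (good_unit n G s) + start n G t I + good_unit n G (sdrop (n * start n G t I) t))"
    by (simp only: IH)
  also have "\<dots> = Suc (good_unit n G s) + start n G t (Suc I)"
    by simp
  finally show ?case by (simp only: t_def)
qed

text \<open>Regeneration: after the first good unit the construction restarts on the remaining
  stream. The law of \<open>merge\<close> is computed by peeling off heads in this way.\<close>

lemma merge_unfold:
  "merge n G m r s = (merged n G m s - r) ## merge n G m r (sdrop (n * Suc (good_unit n G s)) s)"
proof -
  have "(\<lambda>I. merged n G m (sdrop (n * start n G s I) s) - r) =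
     case_nat (merged n G m s - r) (\<lambda>I. merged n G m (sdrop (n * start n G (sdrop (n * Suc (good_unit n G s)) s) I)
        (sdrop (n * Suc (good_unit n G s)) s)) - r)" (is "_ = ?g")
  proof
    fix I
    show "merged n G m (sdrop (n * start n G s I) s) - r = ?g I"
    proof (cases I)
      case 0
      then show ?thesis by simp
    next
      case (Suc J)
      then show ?thesis
        unfolding Suc nat.case start_shift by (simp only: sdrop_add distrib_left)
    qed
  qed
  then show ?thesis unfolding merge_def by (simp only: to_stream_nat_case)
qed

lemma merge_nth: "merge n G m r s !! I = merged n G m (sdrop (n * start n G s I) s) - r"
  by (simp add: merge_def to_stream_def)

lemma merged_start:
  "merged n G m (sdrop (n * start n G s I) s) = (\<Sum>i=n * start n G s I..<n * start n G s (Suc I). m (s !! i))"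
proof -
  define a where "a = n * start n G s I"
  define b where "b = n * Suc (good_unit n G (sdrop a s))"
  have "n * start n G s (Suc I) = b + a"
    by (simp add: a_def b_def distrib_left add_ac)
  then show ?thesis
    using sum.shift_bounds_nat_ivl[of "\<lambda>i. m (s !! i)" 0 a b]
    by (simp add: merged_def sdrop_snth lessThan_atLeast0 add.commute flip: a_def b_def del: mult_Suc_right)
qed

lemma measurable_of_bool [measurable (raw)]: "Measurable.pred M P \<Longrightarrow> (\<lambda>x. of_bool (P x) :: ennreal) \<in> borel_measurable M"
  by (simp add: of_bool_def)

text \<open>\<open>G_cong\<close> makes the goodness of disjoint units independent;
  \<open>G_zero\<close> says that a bad unit has positive mass. The locale is used with n = 1 to
  pass from removal flags to gaps, and with n = \<open>width k\<close> at level
  \<open>k\<close>.\<close>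

locale merging = prob_space N for N :: "'a::countable measure" +
  fixes n :: nat and G :: "'a stream \<Rightarrow> bool" and m :: "'a \<Rightarrow> nat"
  assumes sets_N [measurable_cong]: "sets N = sets (count_space UNIV)"
    and n: "1 \<le> n"
    and G_cong: "\<And>s s'. stake n s = stake n s' \<Longrightarrow> G s = G s'"
    and G_zero: "\<And>s. \<forall>i<n. m (s !! i) = 0 \<Longrightarrow> G s"
begin

section \<open>Regeneration of an i.i.d. stream at its first good unit\<close>

abbreviation S where "S \<equiv> stream_space N"

sublocale S: prob_space S by (rule prob_space_stream_space)

lemma space_N [simp]: "space N = UNIV"
  using sets_eq_imp_space_eq[OF sets_N] by simp

lemma sets_S: "sets S = sets (stream_space (count_space UNIV))"
  by (rule sets_stream_space_cong[OF sets_N])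

lemma space_S [simp]: "space S = UNIV"
  by (simp add: space_stream_space)

lemma measurable_m [measurable]: "m \<in> measurable N (count_space UNIV)"
  by (simp cong: measurable_cong_sets add: sets_N)

lemma measurable_stake_list: "stake k \<in> measurable S (count_space UNIV)"
proof -
  have "{s. stake k s = xs} \<in> sets S" for xs
  proof (cases "length xs = k")
    case True
    have "{s. stake k s = xs} = sstart UNIV xs"
      using True by (auto simp: sstart_eq list_eq_iff_nth_eq)
    then show ?thesis using sets_sstart[of UNIV xs] by (simp add: sets_S)
  next
    case False
    then have "{s. stake k s = xs} = {}" by auto
    then show ?thesis by simp
  qed
  then show ?thesis
    by (subst measurable_count_space_eq2_countable) (auto simp: vimage_def)
qed

lemma measurable_G [measurable]: "Measurable.pred S G"
proof -
  \<comment> \<open>The arbitrary tail is harmless because \<open>G\<close> sees only n entries; it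
    exhibits \<open>G\<close> as a function of a list, and lists form a discrete space.\<close>
  have "G s = G (stake n s @- undefined)" for s
    by (rule G_cong) (simp add: stake_shift)
  then have "G = (\<lambda>xs. G (xs @- undefined)) \<circ> stake n" by auto
  moreover have "(\<lambda>xs. G (xs @- undefined)) \<in> measurable (count_space UNIV) (count_space UNIV)" by simp
  ultimately show ?thesis
    using measurable_comp[OF measurable_stake_list] by metis
qed

text \<open>Prefix and tail of an i.i.d. stream are independent, so the tail may be resampled after
  a fixed time. All later independence claims are reduced to this one.\<close>

lemma nn_integral_stake_sdrop:
  assumes [measurable]: "f \<in> borel_measurable S"
  shows "(\<integral>\<^sup>+s. f s \<partial>S) = (\<integral>\<^sup>+s. \<integral>\<^sup>+s'. f (stake k s @- s') \<partial>S \<partial>S)"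
  using assms
proof (induction k arbitrary: f)
  case 0
  then show ?case by (simp add: S.emeasure_space_1[simplified])
next
  case (Suc k)
  note [measurable] = Suc.prems
  have [measurable]: "(\<lambda>s. \<integral>\<^sup>+s'. f (stake (Suc k) s @- s') \<partial>S) \<in> borel_measurable S"
    using measurable_comp[OF measurable_stake_list, of "\<lambda>xs. \<integral>\<^sup>+s'. f (xs @- s') \<partial>S" borel "Suc k"] 
    by (simp add: comp_def del: stake.simps)
  have "(\<integral>\<^sup>+s. f s \<partial>S) = (\<integral>\<^sup>+x. \<integral>\<^sup>+s. f (x ## s) \<partial>S \<partial>N)"
    by (rule nn_integral_stream_space) measurable
  also have "\<dots> = (\<integral>\<^sup>+x. \<integral>\<^sup>+s. \<integral>\<^sup>+s'. f (x ## stake k s @- s') \<partial>S \<partial>S \<partial>N)"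
    by (intro nn_integral_cong Suc.IH) measurable
  also have "\<dots> = (\<integral>\<^sup>+s. \<integral>\<^sup>+s'. f (stake (Suc k) s @- s') \<partial>S \<partial>S)"
    by (subst nn_integral_stream_space[of "\<lambda>s. \<integral>\<^sup>+s'. f (stake (Suc k) s @- s') \<partial>S"]) simp_all
  finally show ?case .
qed


definition mass :: "nat \<Rightarrow> 'a stream \<Rightarrow> nat" where
  "mass k s = (\<Sum>i<k. m (s !! i))"

definition first :: "nat \<Rightarrow> 'a stream \<Rightarrow> bool" where
  "first u s \<longleftrightarrow> G (sdrop (n * u) s) \<and> (\<forall>v<u. \<not> G (sdrop (n * v) s))"

text \<open>The share of the event that unit \<open>u\<close> is the first good one. Fixing
  \<open>u\<close> makes the random cut deterministic, so the strong Markov property becomes an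
  induction on \<open>u\<close>; \<open>f\<close> must stay general there, because mass already
  passed shifts its argument.\<close>

definition part :: "nat \<Rightarrow> (nat \<Rightarrow> ennreal) \<Rightarrow> ('a stream \<Rightarrow> ennreal) \<Rightarrow> ennreal" where
  "part u f h = (\<integral>\<^sup>+s. of_bool (first u s) * f (mass (n * Suc u) s) * h (sdrop (n * Suc u) s) \<partial>S)"

lemma measurable_mass [measurable]: "mass k \<in> measurable S (count_space UNIV)"
  unfolding mass_def[abs_def] by measurable

lemma measurable_first [measurable]: "Measurable.pred S (first u)"
  unfolding first_def[abs_def] by measurable

lemma measurable_f_mass [measurable]: "(\<lambda>s. f (mass k s) :: ennreal) \<in> borel_measurable S"
  using measurable_compose[OF measurable_mass, of f borel] by simp

lemma G_stake: "G (stake n s @- s') = G s"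
  by (rule G_cong) (simp add: stake_shift)

lemma mass_stake: "mass n (stake n s @- s') = mass n s"
  by (simp add: mass_def shift_snth_less)

lemma part_0:
  assumes [measurable]: "h \<in> borel_measurable S"
  shows "part 0 f h = (\<integral>\<^sup>+s. of_bool (G s) * f (mass n s) \<partial>S) * (\<integral>\<^sup>+s. h s \<partial>S)"
proof -
  have "part 0 f h = (\<integral>\<^sup>+s. of_bool (G s) * f (mass n s) * h (sdrop n s) \<partial>S)"
    by (simp add: part_def first_def)
  also have "\<dots> = (\<integral>\<^sup>+s. \<integral>\<^sup>+s'. of_bool (G s) * f (mass n s) * h s' \<partial>S \<partial>S)"
    by (subst nn_integral_stake_sdrop[where k=n]) (simp_all add: G_stake mass_stake sdrop_shift)
  also have "\<dots> = (\<integral>\<^sup>+s. of_bool (G s) * f (mass n s) \<partial>S) * (\<integral>\<^sup>+s. h s \<partial>S)"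
    by (simp add: nn_integral_cmult nn_integral_multc)
  finally show ?thesis .
qed

lemma first_Suc: "first (Suc u) s \<longleftrightarrow> \<not> G s \<and> first u (sdrop n s)"
  by (auto simp: first_def All_less_Suc2)

lemma mass_add: "mass (n + k) s = mass n s + mass k (sdrop n s)"
proof -
  have "mass (n + k) s = mass n s + (\<Sum>i=n..<n+k. m (s !! i))"
    unfolding mass_def lessThan_atLeast0 by (simp add: sum.atLeastLessThan_concat)
  also have "(\<Sum>i=n..<n+k. m (s !! i)) = mass k (sdrop n s)"
    unfolding mass_def lessThan_atLeast0 sdrop_snth
    using sum.shift_bounds_nat_ivl[of "\<lambda>i. m (s !! i)" 0 n k] by (simp add: add.commute)
  finally show ?thesis .
qed

lemma part_Suc:
  assumes [measurable]: "h \<in> borel_measurable S"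
  shows "part (Suc u) f h = (\<integral>\<^sup>+s. of_bool (\<not> G s) * part u (\<lambda>x. f (mass n s + x)) h \<partial>S)"
proof -
  have "part (Suc u) f h = (\<integral>\<^sup>+s. of_bool (\<not> G s) * (of_bool (first u (sdrop n s)) *
      f (mass n s + mass (n * Suc u) (sdrop n s)) * h (sdrop (n * Suc u) (sdrop n s))) \<partial>S)"
    unfolding part_def
  proof (rule nn_integral_cong)
    fix s :: "'a stream"
    have "n * Suc (Suc u) = n + n * Suc u" by simp
    moreover have "sdrop (n + n * Suc u) s = sdrop (n * Suc u) (sdrop n s)"
      by (simp only: sdrop_add)
    ultimately show "of_bool (first (Suc u) s) * f (mass (n * Suc (Suc u)) s) * h (sdrop (n * Suc (Suc u)) s) =
      of_bool (\<not> G s) * (of_bool (first u (sdrop n s)) *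
      f (mass n s + mass (n * Suc u) (sdrop n s)) * h (sdrop (n * Suc u) (sdrop n s)))"
      by (simp only: first_Suc mass_add) (simp add: mult_ac)
  qed
  also have "\<dots> = (\<integral>\<^sup>+s. \<integral>\<^sup>+s'. of_bool (\<not> G s) * (of_bool (first u s') *
      f (mass n s + mass (n * Suc u) s') * h (sdrop (n * Suc u) s')) \<partial>S \<partial>S)"
  proof (subst nn_integral_stake_sdrop[where k=n])
    have [measurable]: "(\<lambda>s. f (mass n s + mass (n * Suc u) (sdrop n s))) \<in> borel_measurable S"
      using measurable_f_mass[of f "n + n * Suc u"] by (simp only: mass_add)
    show "(\<lambda>s. of_bool (\<not> G s) * (of_bool (first u (sdrop n s)) * f (mass n s + mass (n * Suc u) (sdrop n s)) *
           h (sdrop (n * Suc u) (sdrop n s)))) \<in> borel_measurable S"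
      by measurable
  qed (simp add: G_stake mass_stake sdrop_shift del: mult_Suc_right)
  also have "\<dots> = (\<integral>\<^sup>+s. of_bool (\<not> G s) * part u (\<lambda>x. f (mass n s + x)) h \<partial>S)"
    unfolding part_def
  proof (rule nn_integral_cong, rule nn_integral_cmult)
    fix s
    have [measurable]: "(\<lambda>s'. f (mass n s + mass (n * Suc u) s')) \<in> borel_measurable S"
      using measurable_f_mass[of "\<lambda>x. f (mass n s + x)"] by simp
    show "(\<lambda>s'. of_bool (first u s') * f (mass n s + mass (n * Suc u) s') * h (sdrop (n * Suc u) s')) \<in> borel_measurable S"
      by measurable
  qed
  finally show ?thesis .
qed

lemma part_factor:
  assumes h: "h \<in> borel_measurable S"
  shows "part u f h = part u f (\<lambda>_. 1) * (\<integral>\<^sup>+s. h s \<partial>S)"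
proof (induction u arbitrary: f)
  case 0
  then show ?case
    using S.emeasure_space_1 by (simp add: part_0 h)
next
  case (Suc u)
  have meas: "(\<lambda>s. of_bool (\<not> G s) * part u (\<lambda>x. f (mass n s + x)) (\<lambda>_. 1)) \<in> borel_measurable S"
    using measurable_f_mass[of "\<lambda>y. part u (\<lambda>x. f (y + x)) (\<lambda>_. 1)" n] by measurable
  have "part (Suc u) f h = (\<integral>\<^sup>+s. of_bool (\<not> G s) * part u (\<lambda>x. f (mass n s + x)) (\<lambda>_. 1) * (\<integral>\<^sup>+s. h s \<partial>S) \<partial>S)"
    by (subst part_Suc[OF h], subst Suc.IH) (simp add: mult_ac)
  also have "\<dots> = part (Suc u) f (\<lambda>_. 1) * (\<integral>\<^sup>+s. h s \<partial>S)"
    by (subst nn_integral_multc[OF meas]) (simp add: part_Suc)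
  finally show ?case .
qed

end

definition weight :: "real \<Rightarrow> nat \<Rightarrow> ennreal" where
  "weight z k = ennreal (z ^ k)"

context merging
begin

lemma bad_event [measurable]: "{s. \<not> G s} \<in> sets S"
proof -
  have "{s\<in>space S. \<not> G s} \<in> sets S" by measurable
  then show ?thesis by simp
qed

lemma heavy_event [measurable]: "{s. m (s !! i) \<noteq> 0} \<in> sets S"
proof -
  have "{s\<in>space S. m (s !! i) \<noteq> 0} \<in> sets S" by measurable
  then show ?thesis by simp
qed

text \<open>No unit is ever good iff the first is bad and the same holds for the shifted stream. By
  independence P(B) = P(bad) P(B), so P(bad) < 1 forces P(B) = 0.\<close>

lemma AE_good:
  assumes q: "emeasure S {s. \<not> G s} < 1"
  shows "AE s in S. \<exists>u. G (sdrop (n * u) s)"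
proof -
  define B where "B = {s. \<forall>u. \<not> G (sdrop (n * u) s)}"
  have "{s\<in>space S. \<forall>u. \<not> G (sdrop (n * u) s)} \<in> sets S" by measurable
  then have [measurable]: "B \<in> sets S" by (simp add: B_def)
  have B: "s \<in> B \<longleftrightarrow> \<not> G s \<and> sdrop n s \<in> B" for s
  proof -
    have "(\<forall>u. \<not> G (sdrop (n * u) s)) \<longleftrightarrow> \<not> G (sdrop (n * 0) s) \<and> (\<forall>u. \<not> G (sdrop (n * Suc u) s))"
      by (metis not0_implies_Suc)
    then show ?thesis by (simp add: B_def)
  qed
  have "emeasure S B = (\<integral>\<^sup>+s. of_bool (\<not> G s) * indicator B (sdrop n s) \<partial>S)"
  proof -
    have "indicator B s = (of_bool (\<not> G s) * indicator B (sdrop n s) :: ennreal)" for s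
      by (subst indicator_def, subst B) (simp add: indicator_def)
    then have "(\<integral>\<^sup>+s. indicator B s \<partial>S) = (\<integral>\<^sup>+s. of_bool (\<not> G s) * indicator B (sdrop n s) \<partial>S)"
      by (rule nn_integral_cong)
    moreover have "(\<integral>\<^sup>+s. indicator B s \<partial>S) = emeasure S B"
      by (rule nn_integral_indicator) measurable
    ultimately show ?thesis by (simp only:)
  qed
  also have "\<dots> = (\<integral>\<^sup>+s. \<integral>\<^sup>+s'. of_bool (\<not> G s) * indicator B s' \<partial>S \<partial>S)"
    by (subst nn_integral_stake_sdrop[where k=n]) (simp_all add: G_stake sdrop_shift)
  also have "\<dots> = (\<integral>\<^sup>+s. of_bool (\<not> G s) \<partial>S) * emeasure S B"
    by (simp add: nn_integral_cmult nn_integral_multc)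
  also have "(\<integral>\<^sup>+s. of_bool (\<not> G s) \<partial>S) = emeasure S {s. \<not> G s}"
    by (subst nn_integral_indicator[OF bad_event, symmetric], rule nn_integral_cong) (simp add: indicator_def)
  finally have *: "emeasure S B = emeasure S {s. \<not> G s} * emeasure S B" .
  have "emeasure S B = 0"
  proof (rule ccontr)
    assume "emeasure S B \<noteq> 0"
    then have "emeasure S {s. \<not> G s} * emeasure S B < 1 * emeasure S B"
      using q by (intro ennreal_mult_strict_right_mono) (auto simp: less_top[symmetric] zero_less_iff_neq_zero S.emeasure_finite)
    then show False using * by simp
  qed
  then have "B \<in> null_sets S" by (intro null_setsI) measurable
  then show ?thesis using AE_not_in[of B S] by (simp add: B_def)
qed

lemma first_good_unit:
  assumes "\<exists>u. G (sdrop (n * u) s)"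
  shows "first u s \<longleftrightarrow> u = good_unit n G s"
proof -
  have "G (sdrop (n * good_unit n G s) s)"
    unfolding good_unit_def using assms by (rule LeastI_ex)
  moreover have "\<not> G (sdrop (n * v) s)" if "v < good_unit n G s" for v
    using that unfolding good_unit_def by (rule not_less_Least)
  ultimately show ?thesis unfolding first_def by (metis linorder_neqE_nat)
qed

lemma merged_mass: "merged n G m s = mass (n * Suc (good_unit n G s)) s"
  by (simp add: merged_def mass_def)

lemma measurable_good_unit [measurable]: "good_unit n G \<in> measurable S (count_space UNIV)"
  unfolding good_unit_def[abs_def] by measurable

lemma measurable_merged [measurable]: "merged n G m \<in> measurable S (count_space UNIV)"
  unfolding merged_mass[abs_def]
  by (rule measurable_compose_countable[of "\<lambda>u s. mass (n * Suc u) s"]) measurable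

lemma measurable_start [measurable]: "(\<lambda>s. start n G s I) \<in> measurable S (count_space UNIV)"
proof (induction I)
  case (Suc I)
  note [measurable] = Suc
  have [measurable]: "(\<lambda>s. good_unit n G (sdrop (n * start n G s I) s)) \<in> measurable S (count_space UNIV)"
    by (rule measurable_compose_countable[of "\<lambda>u s. good_unit n G (sdrop (n * u) s)"]) measurable
  show ?case by simp
qed simp

lemma measurable_merge [measurable]:
  "merge n G m r \<in> measurable S (stream_space (count_space UNIV))"
proof (rule measurable_stream_space2)
  fix I
  have "(\<lambda>s. merged n G m (sdrop (n * start n G s I) s)) \<in> measurable S (count_space UNIV)"
    by (rule measurable_compose_countable[of "\<lambda>u s. merged n G m (sdrop (n * u) s)"]) measurable
  then show "(\<lambda>s. merge n G m r s !! I) \<in> measurable S (count_space UNIV)"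
    unfolding merge_nth by measurable
qed

lemma nn_integral_merged:
  assumes q: "emeasure S {s. \<not> G s} < 1" and [measurable]: "h \<in> borel_measurable S"
  shows "(\<integral>\<^sup>+s. f (merged n G m s) * h (sdrop (n * Suc (good_unit n G s)) s) \<partial>S) = (\<Sum>u. part u f h)"
proof -
  have "(\<integral>\<^sup>+s. f (merged n G m s) * h (sdrop (n * Suc (good_unit n G s)) s) \<partial>S) =
    (\<integral>\<^sup>+s. (\<Sum>u. of_bool (first u s) * f (mass (n * Suc u) s) * h (sdrop (n * Suc u) s)) \<partial>S)"
  proof (rule nn_integral_cong_AE, use AE_good[OF q] in eventually_elim)
    case (elim s)
    then show ?case
      by (subst suminf_finite[of "{good_unit n G s}"]) (simp_all add: first_good_unit merged_mass)
  qed
  also have "\<dots> = (\<Sum>u. part u f h)"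
    unfolding part_def by (rule nn_integral_suminf) measurable
  finally show ?thesis .
qed

text \<open>Strong Markov property: the merged head is independent of the stream after the cut,
  which again has law \<open>S\<close>.\<close>

lemma nn_integral_merged_rest:
  assumes q: "emeasure S {s. \<not> G s} < 1" and [measurable]: "h \<in> borel_measurable S"
  shows "(\<integral>\<^sup>+s. f (merged n G m s) * h (sdrop (n * Suc (good_unit n G s)) s) \<partial>S) =
     (\<integral>\<^sup>+s. f (merged n G m s) \<partial>S) * (\<integral>\<^sup>+s. h s \<partial>S)"
proof -
  have "(\<Sum>u. part u f h) = (\<Sum>u. part u f (\<lambda>_. 1)) * (\<integral>\<^sup>+s. h s \<partial>S)"
    by (subst part_factor) simp_all
  then show ?thesis
    using nn_integral_merged[OF q, of h f] nn_integral_merged[OF q, of "\<lambda>_. 1" f] by simp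
qed

definition merged_law :: "nat \<Rightarrow> nat measure" where
  "merged_law r = distr S (count_space UNIV) (\<lambda>s. merged n G m s - r)"

lemma prob_space_merged_law: "prob_space (merged_law r)"
  unfolding merged_law_def by (rule S.prob_space_distr) measurable

lemma sets_merged_law: "sets (merged_law r) = sets (count_space UNIV)"
  by (simp add: merged_law_def)

text \<open>Merged masses are again i.i.d. It suffices to compare the cylinders
  \<open>sstart UNIV xs\<close>, by induction on \<open>xs\<close> with \<open>merge_unfold\<close>
  and the strong Markov property.\<close>

lemma distr_merge:
  assumes q: "emeasure S {s. \<not> G s} < 1"
  shows "distr S (stream_space (count_space UNIV)) (merge n G m r) = stream_space (merged_law r)"
proof (rule stream_space_eq_sstart[of UNIV])
  interpret L: prob_space "merged_law r" by (rule prob_space_merged_law)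
  show "prob_space (distr S (stream_space (count_space UNIV)) (merge n G m r))"
    by (rule S.prob_space_distr) measurable
  show "prob_space (stream_space (merged_law r))"
    by (rule L.prob_space_stream_space)
  show setsL: "sets (stream_space (merged_law r)) = sets (stream_space (count_space UNIV))"
    by (rule sets_stream_space_cong[OF sets_merged_law])
  fix xs :: "nat list"
  have [measurable]: "sstart UNIV xs \<in> sets (stream_space (merged_law r))" for xs
    using sets_sstart[of UNIV xs] setsL by blast
  have "(\<integral>\<^sup>+s. indicator (sstart UNIV xs) (merge n G m r s) \<partial>S) = 
      (\<integral>\<^sup>+t. indicator (sstart UNIV xs) t \<partial>stream_space (merged_law r))"
  proof (induction xs)
    case Nil
    interpret LS: prob_space "stream_space (merged_law r)" by (rule L.prob_space_stream_space)
    have "space (stream_space (merged_law r)) = UNIV"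
      by (simp add: space_stream_space merged_law_def)
    then show ?case using S.emeasure_space_1 LS.emeasure_space_1 by simp
  next
    case (Cons x xs)
    have "(\<integral>\<^sup>+s. indicator (sstart UNIV (x # xs)) (merge n G m r s) \<partial>S) =
      (\<integral>\<^sup>+s. of_bool (merged n G m s - r = x) * indicator (sstart UNIV xs) (merge n G m r (sdrop (n * Suc (good_unit n G s)) s)) \<partial>S)"
      by (subst merge_unfold) (auto intro!: nn_integral_cong simp: indicator_def simp del: mult_Suc_right)
    also have "\<dots> = (\<integral>\<^sup>+s. of_bool (merged n G m s - r = x) \<partial>S) * (\<integral>\<^sup>+s. indicator (sstart UNIV xs) (merge n G m r s) \<partial>S)"
      by (rule nn_integral_merged_rest[OF q, where f="\<lambda>y. of_bool (y - r = x)"]) measurable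
    also have "\<dots> = (\<integral>\<^sup>+y. of_bool (y = x) \<partial>merged_law r) * (\<integral>\<^sup>+t. indicator (sstart UNIV xs) t \<partial>stream_space (merged_law r))"
      unfolding Cons.IH by (simp add: merged_law_def nn_integral_distr)
    also have "\<dots> = (\<integral>\<^sup>+y. \<integral>\<^sup>+t. of_bool (y = x) * indicator (sstart UNIV xs) t \<partial>stream_space (merged_law r) \<partial>merged_law r)"
      by (simp add: nn_integral_cmult nn_integral_multc merged_law_def)
    also have "\<dots> = (\<integral>\<^sup>+t. indicator (sstart UNIV (x # xs)) t \<partial>stream_space (merged_law r))"
      by (subst L.nn_integral_stream_space) (auto intro!: nn_integral_cong simp: indicator_def)
    finally show ?case .
  qed
  then show "emeasure (distr S (stream_space (count_space UNIV)) (merge n G m r)) (sstart UNIV xs) =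
      emeasure (stream_space (merged_law r)) (sstart UNIV xs)"
    by (subst (asm) nn_integral_indicator) (simp_all add: nn_integral_distr flip: nn_integral_indicator)
qed auto


section \<open>Exponential moments under merging\<close>

lemma nn_integral_mass:
  assumes z: "1 \<le> z"
  shows "(\<integral>\<^sup>+s. weight z (mass k s) \<partial>S) = (\<integral>\<^sup>+x. weight z (m x) \<partial>N) ^ k"
proof (induction k)
  case 0
  then show ?case using S.emeasure_space_1 by (simp add: mass_def weight_def)
next
  case (Suc k)
  have wm [measurable]: "(\<lambda>x. weight z (m x)) \<in> borel_measurable N"
    using measurable_compose[OF measurable_m, of "weight z" borel] by simp
  have "(\<integral>\<^sup>+s. weight z (mass (Suc k) s) \<partial>S) = (\<integral>\<^sup>+x. \<integral>\<^sup>+s. weight z (mass (Suc k) (x ## s)) \<partial>S \<partial>N)"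
    by (rule nn_integral_stream_space) measurable
  also have "\<dots> = (\<integral>\<^sup>+x. \<integral>\<^sup>+s. weight z (m x) * weight z (mass k s) \<partial>S \<partial>N)"
    using z by (intro nn_integral_cong)
      (simp add: mass_def weight_def sum.lessThan_Suc_shift power_add ennreal_mult' del: sum.lessThan_Suc)
  also have "\<dots> = (\<integral>\<^sup>+x. weight z (m x) \<partial>N) ^ Suc k"
    by (simp add: nn_integral_cmult nn_integral_multc Suc)
  finally show ?case .
qed

lemma heavy_unit_le:
  shows "emeasure S (\<Union>i<n. {s. m (s !! i) \<noteq> 0}) \<le> of_nat n * emeasure N {x. m x \<noteq> 0}"
    and "(\<Union>i<n. {s. m (s !! i) \<noteq> 0}) \<in> sets S"
proof -
  have [measurable]: "{x. m x \<noteq> 0} \<in> sets N" by (simp add: sets_N)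
  have P: "emeasure S {s. m (s !! i) \<noteq> 0} = emeasure N {x. m x \<noteq> 0}" for i
  proof (induction i)
    case 0
    have "emeasure S {s. m (s !! 0) \<noteq> 0} = (\<integral>\<^sup>+s. indicator {x. m x \<noteq> 0} (shd s) \<partial>S)"
      by (subst nn_integral_indicator[symmetric], rule heavy_event) (auto intro!: nn_integral_cong simp: indicator_def)
    also have "\<dots> = emeasure N {x. m x \<noteq> 0}"
      using S.emeasure_space_1 by (subst nn_integral_stream_space) simp_all
    finally show ?case .
  next
    case (Suc i)
    have "emeasure S {s. m (s !! Suc i) \<noteq> 0} = (\<integral>\<^sup>+s. indicator {s. m (s !! i) \<noteq> 0} (stl s) \<partial>S)"
      by (subst nn_integral_indicator[symmetric], rule heavy_event) (auto intro!: nn_integral_cong simp: indicator_def)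
    also have "\<dots> = (\<integral>\<^sup>+s. indicator {s. m (s !! i) \<noteq> 0} s \<partial>S)"
      using emeasure_space_1 by (subst nn_integral_stream_space) simp_all
    also have "\<dots> = emeasure S {s. m (s !! i) \<noteq> 0}"
      by (rule nn_integral_indicator[OF heavy_event])
    finally show ?case using Suc by simp
  qed
  show "(\<Union>i<n. {s. m (s !! i) \<noteq> 0}) \<in> sets S"
    by (rule sets.finite_UN) (simp, rule heavy_event)
  have "emeasure S (\<Union>i<n. {s. m (s !! i) \<noteq> 0}) \<le> (\<Sum>i<n. emeasure S {s. m (s !! i) \<noteq> 0})"
    by (rule emeasure_subadditive_finite) (simp, use heavy_event in blast)
  also have "\<dots> = of_nat n * emeasure N {x. m x \<noteq> 0}"
    by (simp only: P sum_constant card_lessThan)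
  finally show "emeasure S (\<Union>i<n. {s. m (s !! i) \<noteq> 0}) \<le> of_nat n * emeasure N {x. m x \<noteq> 0}" .
qed

lemma bad_unit_le:
  "emeasure S {s. \<not> G s} \<le> of_nat n * emeasure N {x. m x \<noteq> 0}"
  by (rule order_trans[OF emeasure_mono[OF _ heavy_unit_le(2)] heavy_unit_le(1)]) (use G_zero in blast)

text \<open>As z >= 2, the weight is at least 2 wherever the mass is nonzero, so the excess moment d
  dominates the probability of a nonzero mass. One number thus controls both tails and bad
  units.\<close>

lemma heavy_le:
  assumes z: "2 \<le> z" and d: "(\<integral>\<^sup>+x. weight z (m x) \<partial>N) \<le> ennreal (1 + d)" "0 \<le> d"
  shows "emeasure N {x. m x \<noteq> 0} \<le> ennreal d"
proof -
  have [measurable]: "{x. m x \<noteq> 0} \<in> sets N" by (simp add: sets_N)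
  have wm [measurable]: "(\<lambda>x. weight z (m x)) \<in> borel_measurable N"
    using measurable_compose[OF measurable_m, of "weight z" borel] by simp
  have "1 + emeasure N {x. m x \<noteq> 0} = (\<integral>\<^sup>+x. 1 + indicator {x. m x \<noteq> 0} x \<partial>N)"
    using emeasure_space_1 by (simp add: nn_integral_add)
  also have "\<dots> \<le> (\<integral>\<^sup>+x. weight z (m x) \<partial>N)"
  proof (rule nn_integral_mono)
    fix x
    show "1 + indicator {x. m x \<noteq> 0} x \<le> weight z (m x)"
    proof (cases "m x = 0")
      case False
      have "2 \<le> z ^ m x"
        using power_increasing[of 1 "m x" z] z False by simp
      then have "ennreal 2 \<le> weight z (m x)" unfolding weight_def by (rule ennreal_leI)
      then show ?thesis using False by simp
    qed (simp add: weight_def)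
  qed
  also have "\<dots> \<le> 1 + ennreal d" using d by simp
  finally show ?thesis by (simp add: ennreal_add_left_cancel_le)
qed

text \<open>Split by the index of the first good unit: each bad unit contributes a factor y and the
  final good one a factor x, where x + y <= 1 + \<kappa>. The moment is the geometric sum x/(1-y).
  The hypothesis 1/6 yields y <= 3nd <= 1/2, whence x/(1-y) <= 1 + \<kappa>/(1-y) <= 1 +
  2\<kappa>.\<close>

lemma merged_moment:
  assumes z: "2 \<le> z" and d: "(\<integral>\<^sup>+x. weight z (m x) \<partial>N) \<le> ennreal (1 + d)" "0 \<le> d" and nd: "real n * d \<le> 1/6"
  shows "(\<integral>\<^sup>+s. weight z (merged n G m s) \<partial>S) \<le> ennreal (1 + 4 * real n * d)"
    and "emeasure S {s. \<not> G s} < 1"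
proof -
  define \<kappa> where "\<kappa> = 2 * real n * d"
  define a where "a = (\<integral>\<^sup>+s. of_bool (G s) * weight z (mass n s) \<partial>S)"
  define b where "b = (\<integral>\<^sup>+s. of_bool (\<not> G s) * weight z (mass n s) \<partial>S)"
  have "emeasure S {s. \<not> G s} \<le> ennreal (real n) * emeasure N {x. m x \<noteq> 0}"
    using bad_unit_le by (simp add: ennreal_of_nat_eq_real_of_nat)
  also have "\<dots> \<le> ennreal (real n) * ennreal d"
    by (intro mult_left_mono heavy_le[OF z d]) simp
  finally have "emeasure S {s. \<not> G s} \<le> ennreal (real n) * ennreal d" .
  then have PG: "emeasure S {s. \<not> G s} \<le> ennreal (real n * d)" using d by (simp add: ennreal_mult)
  also have "\<dots> < ennreal 1" using nd d by (intro ennreal_lessI) auto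
  finally show q: "emeasure S {s. \<not> G s} < 1" by simp
  have ab: "a + b \<le> ennreal (1 + \<kappa>)"
  proof -
    have "a + b = (\<integral>\<^sup>+s. weight z (mass n s) \<partial>S)"
      unfolding a_def b_def by (subst nn_integral_add[symmetric]) (auto intro!: nn_integral_cong)
    also have "\<dots> = (\<integral>\<^sup>+x. weight z (m x) \<partial>N) ^ n" using z by (intro nn_integral_mass) simp
    also have "\<dots> \<le> ennreal (1 + d) ^ n" by (intro power_mono d) simp
    also have "\<dots> = ennreal ((1 + d) ^ n)" using d(2) by (subst ennreal_power) simp_all
    also have "\<dots> \<le> ennreal (1 + \<kappa>)"
    proof (rule ennreal_leI)
      have "(1 + d) ^ n \<le> exp d ^ n" using d by (intro power_mono) auto
      also have "\<dots> = exp (real n * d)" by (simp add: exp_of_nat_mult)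
      also have "\<dots> \<le> 1 + real n * d + (real n * d)\<^sup>2" using nd d by (intro exp_bound) auto
      also have "(real n * d)\<^sup>2 \<le> real n * d"
        using nd d mult_left_le[of "real n * d" "real n * d"] by (simp add: power2_eq_square)
      finally show "(1 + d) ^ n \<le> 1 + \<kappa>" by (simp add: \<kappa>_def mult_ac)
    qed
    finally show ?thesis .
  qed
  have fin: "a < \<infinity>" "b < \<infinity>"
  proof -
    have "a + b < \<infinity>" using ab by (rule le_less_trans) simp
    then show "a < \<infinity>" "b < \<infinity>" by (auto simp: less_top)
  qed
  have b: "b \<le> ennreal (\<kappa> + real n * d)"
  proof -
    have "b + 1 = (\<integral>\<^sup>+s. of_bool (\<not> G s) * weight z (mass n s) + 1 \<partial>S)"
      unfolding b_def using S.emeasure_space_1 by (simp add: nn_integral_add)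
    \<comment> \<open>On a bad unit the two sides agree, on a good one this is 1 <= weight. It
      bounds b by the excess of the whole moment plus the probability of a bad unit, without
      Hoelder-type losses.\<close>
    also have "\<dots> \<le> (\<integral>\<^sup>+s. weight z (mass n s) + indicator {s. \<not> G s} s \<partial>S)"
    proof (rule nn_integral_mono)
      fix s
      have "ennreal 1 \<le> weight z (mass n s)" unfolding weight_def using z by (intro ennreal_leI) (simp add: one_le_power)
      then show "of_bool (\<not> G s) * weight z (mass n s) + 1 \<le> weight z (mass n s) + indicator {s. \<not> G s} s"
        by (simp add: indicator_def)
    qed
    also have "\<dots> = (a + b) + emeasure S {s. \<not> G s}"
    proof -
      have "a + b = (\<integral>\<^sup>+s. weight z (mass n s) \<partial>S)"
        unfolding a_def b_def by (subst nn_integral_add[symmetric]) (auto intro!: nn_integral_cong)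
      then show ?thesis by (simp add: nn_integral_add)
    qed
    also have "\<dots> \<le> ennreal (1 + \<kappa>) + ennreal (real n * d)" by (rule add_mono[OF ab PG])
    also have "\<dots> = ennreal (\<kappa> + real n * d) + 1"
      using d by (simp add: \<kappa>_def add_ac flip: ennreal_plus ennreal_1)
    finally show ?thesis by (simp add: ennreal_add_left_cancel_le add.commute)
  qed
  define x where "x = enn2real a"
  define y where "y = enn2real b"
  have xy: "a = ennreal x" "b = ennreal y" "0 \<le> x" "0 \<le> y" using fin by (auto simp: x_def y_def)
  have k0: "0 \<le> \<kappa>" using d by (simp add: \<kappa>_def)
  have kd: "\<kappa> = 2 * (real n * d)" by (simp add: \<kappa>_def)
  have "y \<le> \<kappa> + real n * d" using b k0 d(2) unfolding xy(2) by (subst (asm) ennreal_le_iff) simp_all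
  then have y: "y \<le> 1/2" using kd nd by linarith
  have "ennreal (x + y) \<le> ennreal (1 + \<kappa>)"
    using ab unfolding xy(1,2) by (subst ennreal_plus) (use xy in auto)
  then have x: "x + y \<le> 1 + \<kappa>" by (subst (asm) ennreal_le_iff) (use k0 in simp_all)
  \<comment> \<open>The free constant \<open>c\<close> collects the weights of the bad units already
    passed, so that the induction closes.\<close>
  have part: "part u (\<lambda>k. c * weight z k) (\<lambda>_. 1) = c * ennreal (x * y ^ u)" for u c
  proof (induction u arbitrary: c)
    case 0
    have "part 0 (\<lambda>k. c * weight z k) (\<lambda>_. 1) = (\<integral>\<^sup>+s. c * (of_bool (G s) * weight z (mass n s)) \<partial>S)"
      using S.emeasure_space_1 by (simp add: part_0 mult_ac)
    also have "\<dots> = c * a" unfolding a_def by (rule nn_integral_cmult) measurable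
    finally show ?case by (simp add: xy)
  next
    case (Suc u)
    have w: "weight z (i + j) = weight z i * weight z j" for i j
      using z by (simp add: weight_def power_add ennreal_mult')
    have "part (Suc u) (\<lambda>k. c * weight z k) (\<lambda>_. 1) = (\<integral>\<^sup>+s. of_bool (\<not> G s) * part u (\<lambda>k. c * weight z (mass n s) * weight z k) (\<lambda>_. 1) \<partial>S)"
      by (subst part_Suc) (simp_all add: w mult.assoc)
    also have "\<dots> = (\<integral>\<^sup>+s. (c * ennreal (x * y ^ u)) * (of_bool (\<not> G s) * weight z (mass n s)) \<partial>S)"
      unfolding Suc.IH by (simp add: mult_ac)
    also have "\<dots> = (c * ennreal (x * y ^ u)) * b" unfolding b_def by (rule nn_integral_cmult) measurable
    also have "\<dots> = c * ennreal (x * y ^ Suc u)" using xy by (simp add: mult_ac flip: ennreal_mult)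
    finally show ?case .
  qed
  have "(\<integral>\<^sup>+s. weight z (merged n G m s) \<partial>S) = (\<Sum>u. part u (weight z) (\<lambda>_. 1))"
    using nn_integral_merged[OF q, of "\<lambda>_. 1" "weight z"] by simp
  also have "\<dots> = (\<Sum>u. ennreal (x * y ^ u))"
    using part[of _ 1] by simp
  also have "\<dots> = ennreal (x * (1 / (1 - y)))"
  proof (rule suminf_ennreal_eq)
    show "(\<lambda>u. x * y ^ u) sums (x * (1 / (1 - y)))"
      using y xy by (intro sums_mult geometric_sums) auto
  qed (use xy in auto)
  also have "\<dots> \<le> ennreal (1 + 4 * real n * d)"
  proof (rule ennreal_leI)
    have "x \<le> (1 - y) + \<kappa>" using x by simp
    also have "\<dots> \<le> (1 - y) + \<kappa> * (2 * (1 - y))"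
      using mult_left_mono[of 1 "2 * (1-y)" \<kappa>] y k0 by auto
    also have "\<dots> = (1 + 2 * \<kappa>) * (1 - y)" by (simp add: algebra_simps)
    finally have "x / (1 - y) \<le> 1 + 2 * \<kappa>" using y by (simp add: divide_le_eq)
    then show "x * (1 / (1 - y)) \<le> 1 + 4 * real n * d" by (simp add: kd mult.assoc)
  qed
  finally show "(\<integral>\<^sup>+s. weight z (merged n G m s) \<partial>S) \<le> ennreal (1 + 4 * real n * d)" .
qed

text \<open>Pointwise z^(k-r) - 1 <= z^(-r) (z^k - 1), with truncated k-r: subtracting r divides the
  excess moment by z^r. The inequality is used with the negative terms moved across, as
  \<open>ennreal\<close> subtraction truncates.\<close>

lemma merged_law_moment:
  assumes z: "2 \<le> z" and d: "(\<integral>\<^sup>+x. weight z (m x) \<partial>N) \<le> ennreal (1 + d)" "0 \<le> d" and nd: "real n * d \<le> 1/6"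
  shows "(\<integral>\<^sup>+x. weight z x \<partial>merged_law r) \<le> ennreal (1 + 4 * real n * d / z ^ r)"
proof -
  define c where "c = 1 / z ^ r"
  have c: "0 \<le> c" using z by (simp add: c_def)
  have [measurable]: "(\<lambda>s. weight z (merged n G m s - k)) \<in> borel_measurable S" for k
    using measurable_compose[OF measurable_merged, of "\<lambda>x. weight z (x - k)" borel] by simp
  note [measurable] = this[of 0, simplified]
  have "(\<integral>\<^sup>+x. weight z x \<partial>merged_law r) + ennreal c = (\<integral>\<^sup>+s. weight z (merged n G m s - r) + ennreal c \<partial>S)"
    unfolding merged_law_def using S.emeasure_space_1 by (simp add: nn_integral_distr nn_integral_add)
  also have "\<dots> \<le> (\<integral>\<^sup>+s. 1 + ennreal c * weight z (merged n G m s) \<partial>S)"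
  proof (rule nn_integral_mono)
    fix s
    define k where "k = merged n G m s"
    have "z ^ (k - r) + c \<le> 1 + c * z ^ k"
    proof (cases "k \<le> r")
      case True
      then show ?thesis using z c mult_left_mono[of 1 "z ^ k" c] by (simp add: one_le_power)
    next
      case False
      then have "z ^ k = z ^ (k - r) * z ^ r" by (simp flip: power_add)
      then have "c * z ^ k = z ^ (k - r)" using z by (simp add: c_def)
      moreover have "c \<le> 1" using z by (simp add: c_def one_le_power)
      ultimately show ?thesis by simp
    qed
    then have "ennreal (z ^ (k - r) + c) \<le> ennreal (1 + c * z ^ k)" by (rule ennreal_leI)
    moreover have "ennreal (z ^ (k - r) + c) = weight z (k - r) + ennreal c"
      using z c by (simp add: weight_def)
    moreover have "ennreal (1 + c * z ^ k) = 1 + ennreal c * weight z k"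
      using z c by (simp add: weight_def ennreal_mult)
    ultimately show "weight z (merged n G m s - r) + ennreal c \<le> 1 + ennreal c * weight z (merged n G m s)"
      by (simp add: k_def)
  qed
  also have "\<dots> = 1 + ennreal c * (\<integral>\<^sup>+s. weight z (merged n G m s) \<partial>S)"
    using S.emeasure_space_1 by (simp add: nn_integral_add nn_integral_cmult)
  also have "\<dots> \<le> 1 + ennreal c * ennreal (1 + 4 * real n * d)"
    by (intro add_left_mono mult_left_mono merged_moment[OF z d nd]) simp
  also have "\<dots> = ennreal (1 + 4 * real n * d / z ^ r) + ennreal c"
    using c d z by (simp add: c_def algebra_simps add_divide_distrib flip: ennreal_mult ennreal_plus ennreal_1)
  finally show ?thesis by (simp add: ennreal_add_left_cancel_le add.commute)
qed


text \<open>Good units beyond every index: this guarantees that each \<open>LEAST\<close> met while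
  computing \<open>start\<close> is attained.\<close>

definition recurrent :: "'a stream \<Rightarrow> bool" where
  "recurrent s \<longleftrightarrow> (\<forall>j. \<exists>u. G (sdrop (n * (j + u)) s))"

lemma AE_recurrent:
  assumes q: "emeasure S {s. \<not> G s} < 1"
  shows "AE s in S. recurrent s"
  unfolding recurrent_def AE_all_countable
proof
  fix j
  have "distr S S (sdrop (n * j)) = S"
  proof (rule measure_eqI)
    fix X assume "X \<in> sets (distr S S (sdrop (n * j)))"
    then have [measurable]: "X \<in> sets S" by simp
    have "emeasure (distr S S (sdrop (n * j))) X = (\<integral>\<^sup>+s. indicator X s \<partial>distr S S (sdrop (n * j)))"
      by simp
    also have "\<dots> = (\<integral>\<^sup>+s. indicator X (sdrop (n * j) s) \<partial>S)"
      by (rule nn_integral_distr) measurable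
    also have "\<dots> = (\<integral>\<^sup>+s. \<integral>\<^sup>+s'. indicator X s' \<partial>S \<partial>S)"
      by (subst nn_integral_stake_sdrop[where k="n * j"]) (simp_all add: sdrop_shift)
    also have "\<dots> = emeasure S X" using S.emeasure_space_1 by simp
    finally show "emeasure (distr S S (sdrop (n * j))) X = emeasure S X" .
  qed simp
  then have "AE s in distr S S (sdrop (n * j)). \<exists>u. G (sdrop (n * u) s)"
    using AE_good[OF q] by (simp only:)
  then have "AE s in S. \<exists>u. G (sdrop (n * u) (sdrop (n * j) s))"
    by (rule AE_distrD[rotated]) measurable
  then show "AE s in S. \<exists>u. G (sdrop (n * (j + u)) s)"
    by (simp add: distrib_left)
qed

end

section \<open>The hierarchy of gaps\<close>

definition half_width :: "nat \<Rightarrow> nat" where "half_width k = 2 ^ (3*k+20)"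
definition width :: "nat \<Rightarrow> nat" where "width k = 2 * half_width k + 2"

text \<open>Entry 0 is the gap in front of the unit, not inside it, and may carry any mass.\<close>

definition flat :: "nat \<Rightarrow> nat stream \<Rightarrow> bool" where
  "flat n s \<longleftrightarrow> (\<forall>i\<in>{1..<n}. s !! i = 0)"

text \<open>A flag \<open>True\<close> marks a removed line, so at level 0 an entry counts the
  removed lines just before a kept one; nothing is subtracted there.\<close>

primrec gaps :: "bool stream \<Rightarrow> nat \<Rightarrow> nat stream" where
  "gaps b 0 = merge 1 (\<lambda>s. \<not> shd s) of_bool 0 b"
| "gaps b (Suc k) = merge (width k) (flat (width k)) (\<lambda>x. x) (Suc k) (gaps b k)"

definition line_index :: "bool stream \<Rightarrow> nat \<Rightarrow> nat" where
  "line_index b I = start 1 (\<lambda>s. \<not> shd s) b (Suc I) - 1"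

definition unit_index :: "bool stream \<Rightarrow> nat \<Rightarrow> nat \<Rightarrow> nat" where
  "unit_index b k I = start (width k) (flat (width k)) (gaps b k) (Suc I) - 1"

text \<open>Each unit skipped before the first good one carries mass at least one by
  \<open>G_zero\<close>. This is how the length of a gap is controlled by its mass.\<close>

lemma good_unit_le_merged:
  assumes G_zero: "\<And>s. \<forall>i<n. m (s !! i) = 0 \<Longrightarrow> G s"
  shows "good_unit n G s \<le> merged n G m s"
proof -
  have "u \<le> (\<Sum>i<n * u. m (s !! i))" if "u \<le> good_unit n G s" for u
    using that
  proof (induction u)
    case (Suc u)
    have "\<not> G (sdrop (n * u) s)"
      using Suc.prems not_less_Least[of u "\<lambda>u. G (sdrop (n * u) s)"] by (simp add: good_unit_def)
    then obtain i where i: "i < n" "m (sdrop (n * u) s !! i) \<noteq> 0" using G_zero by blast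
    then have "1 \<le> m (s !! (n * u + i))" by (simp add: sdrop_snth)
    also have "\<dots> \<le> (\<Sum>i=n * u..<n * u + n. m (s !! i))"
      by (rule member_le_sum) (use i in auto)
    finally have "u + 1 \<le> (\<Sum>i<n * u. m (s !! i)) + (\<Sum>i=n * u..<n * u + n. m (s !! i))"
      using Suc by (intro add_mono) auto
    also have "\<dots> = (\<Sum>i<n * u + n. m (s !! i))"
      unfolding lessThan_atLeast0 by (rule sum.atLeastLessThan_concat) auto
    finally show ?case by (simp add: add.commute)
  qed simp
  from this[of "good_unit n G s"] show ?thesis
    unfolding merged_def by (rule order_trans[OF _ sum_mono2]) auto
qed

lemma good_unit_is_good:
  assumes "\<forall>j. \<exists>u. G (sdrop (n * (j + u)) s)"
  shows "G (sdrop (n * (start n G s (Suc I) - 1)) s)"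
proof -
  define j where "j = start n G s I"
  have "\<exists>u. G (sdrop (n * u) (sdrop (n * j) s))"
    using assms by (auto simp: distrib_left)
  then have "G (sdrop (n * good_unit n G (sdrop (n * j) s)) (sdrop (n * j) s))"
    unfolding good_unit_def by (rule LeastI_ex)
  then show ?thesis by (simp add: distrib_left j_def)
qed

lemma good_unit_0: "G s \<Longrightarrow> good_unit n G s = 0"
  by (simp add: good_unit_def)

lemma width_ge: "1 \<le> width k" "half_width k \<ge> 1"
  by (simp_all add: width_def half_width_def)

lemma flat_zero: "\<forall>i<n. (s !! i) = 0 \<Longrightarrow> flat n s"
  by (simp add: flat_def)

lemma coarsening_gaps:
  assumes "\<forall>j. \<exists>u. flat (width k) (sdrop (width k * (j + u)) (gaps b k))"
  shows "coarsening (half_width k) (Suc k) ((!!) (gaps b k)) (unit_index b k) ((!!) (gaps b (Suc k)))"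
proof -
  define n where "n = width k"
  define s where "s = gaps b k"
  define st where "st = start n (flat n) s"
  have n: "2 * half_width k + 2 = n" by (simp add: n_def width_def)
  have e: "unit_index b k I = st (Suc I) - 1" for I by (simp add: unit_index_def st_def n_def s_def)
  have st: "st (Suc I) = Suc (unit_index b k I)" for I unfolding e by (simp add: st_def)
  have e_Suc: "unit_index b k (Suc I) = Suc (unit_index b k I) + good_unit n (flat n) (sdrop (n * st (Suc I)) s)" for I
    unfolding e[of "Suc I"] st[symmetric] by (simp add: st_def)
  have 1: "strict_mono (unit_index b k)"
    unfolding strict_mono_Suc_iff using e_Suc by simp
  have 2: "s !! (n * unit_index b k I + i) = 0" if "i \<in> {1..2*half_width k+1}" for I i
  proof -
    have "flat n (sdrop (n * unit_index b k I) s)"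
      unfolding e st_def by (rule good_unit_is_good) (use assms in \<open>simp add: n_def s_def\<close>)
    then show ?thesis using that n by (auto simp: flat_def sdrop_snth add.commute)
  qed
  have mer: "merged n (flat n) (\<lambda>x. x) (sdrop (n * st (Suc I)) s) =
      (\<Sum>i=n * Suc (unit_index b k I)..<n * Suc (unit_index b k (Suc I)). s !! i)" for I
    using merged_start[of n "flat n" "\<lambda>x. x" s "Suc I"] by (simp only: flip: st_def) (simp only: st)
  have 3: "gaps b (Suc k) !! Suc I = (\<Sum>i=n * Suc (unit_index b k I)..<n * Suc (unit_index b k (Suc I)). s !! i) - Suc k" for I
    unfolding mer[symmetric] by (simp add: merge_nth n_def s_def st_def del: start.simps snth.simps)
  have 4: "unit_index b k (Suc I) \<le> Suc (unit_index b k I) + (\<Sum>i=n * Suc (unit_index b k I)..<n * Suc (unit_index b k (Suc I)). s !! i)" for I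
  proof -
    have "good_unit n (flat n) (sdrop (n * st (Suc I)) s) \<le> merged n (flat n) (\<lambda>x. x) (sdrop (n * st (Suc I)) s)"
      by (rule good_unit_le_merged) (rule flat_zero)
    then show ?thesis unfolding mer using e_Suc[of I] by linarith
  qed
  show ?thesis
    unfolding coarsening_def n s_def[symmetric] using 1 2 3 4 by blast
qed

lemma unit_index_0:
  assumes "\<forall>i<width k. gaps b k !! i = 0"
  shows "unit_index b k 0 = 0"
  unfolding unit_index_def start.simps
  using good_unit_0[where G="flat (width k)" and n="width k", OF flat_zero[OF assms]] by simp

lemma line_index:
  assumes "\<forall>j. \<exists>u. \<not> shd (sdrop (1 * (j + u)) b)"
  shows "strict_mono (line_index b)" "\<not> b !! line_index b I"
    "line_index b (Suc I) \<le> Suc (line_index b I) + gaps b 0 !! Suc I"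
    "line_index b 0 \<le> gaps b 0 !! 0"
proof -
  define G where "G = (\<lambda>s. \<not> shd s)"
  define st where "st = start 1 G b"
  have e: "line_index b I = st (Suc I) - 1" for I by (simp add: line_index_def st_def G_def)
  have st: "st (Suc I) = Suc (line_index b I)" for I unfolding e by (simp add: st_def)
  have e_Suc: "line_index b (Suc I) = Suc (line_index b I) + good_unit 1 G (sdrop (1 * st (Suc I)) b)" for I
    unfolding e[of "Suc I"] st[symmetric] by (simp add: st_def)
  show "strict_mono (line_index b)"
    unfolding strict_mono_Suc_iff using e_Suc by simp
  have "G (sdrop (1 * line_index b I) b)"
    unfolding e st_def by (rule good_unit_is_good) (use assms in \<open>simp add: G_def\<close>)
  then show "\<not> b !! line_index b I" by (simp add: G_def)
  have Gz: "\<And>s. \<forall>i<1. (of_bool (s !! i) :: nat) = 0 \<Longrightarrow> G s" by (simp add: G_def)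
  have "good_unit 1 G (sdrop (1 * st (Suc I)) b) \<le> gaps b 0 !! Suc I"
    using good_unit_le_merged[where s="sdrop (1 * st (Suc I)) b" and n=1 and G=G and m=of_bool, OF Gz]
    by (simp add: merge_nth st_def G_def[symmetric] del: start.simps snth.simps)
  then show "line_index b (Suc I) \<le> Suc (line_index b I) + gaps b 0 !! Suc I"
    unfolding e_Suc by (rule add_left_mono)
  show "line_index b 0 \<le> gaps b 0 !! 0"
    using good_unit_le_merged[where s=b and n=1 and G=G and m=of_bool, OF Gz]
    by (simp add: merge_nth line_index_def G_def[symmetric] del: snth.simps)
qed

definition env_good :: "bool stream \<Rightarrow> bool" where
  "env_good b \<longleftrightarrow> (\<forall>j. \<exists>u. \<not> shd (sdrop (1 * (j + u)) b)) \<and>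
     (\<forall>k j. \<exists>u. flat (width k) (sdrop (width k * (j + u)) (gaps b k))) \<and>
     (\<forall>k. \<forall>i<width k. gaps b k !! i = 0)"

text \<open>Bound on the excess over 1 of the moment with base 2^40 at level k. The rate 13 exceeds
  the growth 3 of \<open>width\<close>, so heavy first units are summable; one recursion step yields
  2^-(50k+116), well below the required 2^-(13k+113).\<close>

definition defect :: "nat \<Rightarrow> real" where "defect k = 1 / 2 ^ (13*k+100)"

section \<open>Laws of the gap masses and probability of a good environment\<close>

lemma merging_base: "merging (measure_pmf (bernoulli_pmf rho)) 1 (\<lambda>s. \<not> shd s) of_bool"
  by (intro merging.intro prob_space_measure_pmf merging_axioms.intro) simp_all

lemma merging_flat:
  assumes "prob_space N" "sets N = sets (count_space UNIV)"
  shows "merging N (width k) (flat (width k)) (\<lambda>x. x)"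
proof -
  interpret prob_space N by fact
  have c: "flat (width k) s = flat (width k) s'" if "stake (width k) s = stake (width k) s'" for s s'
  proof -
    have "s !! i = s' !! i" if "i < width k" for i
      using \<open>stake (width k) s = stake (width k) s'\<close> that by (metis stake_nth)
    then show ?thesis by (simp add: flat_def)
  qed
  show ?thesis
    by (intro merging.intro assms(1) merging_axioms.intro assms(2) width_ge c) (assumption, rule flat_zero)
qed

lemma width_le: "real (width k) \<le> 2 ^ (3*k+22)"
proof -
  have "real (width k) = 2 ^ (3*k+21) + 2" by (simp add: width_def half_width_def power_add)
  also have "\<dots> \<le> 2 ^ (3*k+21) + 2 ^ (3*k+21)" using power_increasing[of 1 "3*k+21" "2::real"] by simp
  also have "\<dots> = 2 ^ (3*k+22)" by (simp add: power_add)
  finally show ?thesis .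
qed

lemma width_defect: "real (width k) * defect k \<le> 1 / 2 ^ (10*k+78)"
proof -
  have "real (width k) * defect k \<le> 2 ^ (3*k+22) * defect k"
    using width_le by (intro mult_right_mono) (simp_all add: defect_def)
  also have "\<dots> = 1 / 2 ^ (10*k+78)"
  proof -
    have "(2::real) ^ (13*k+100) = 2 ^ (3*k+22) * 2 ^ (10*k+78)" by (simp flip: power_add)
    then show ?thesis by (simp add: defect_def)
  qed
  finally show ?thesis .
qed

lemma defect_Suc: "4 * real (width k) * defect k / (2^40) ^ Suc k \<le> defect (Suc k)"
proof -
  have "4 * real (width k) * defect k / (2^40) ^ Suc k = 4 * (real (width k) * defect k) / (2^40) ^ Suc k" by simp
  also have "\<dots> \<le> 4 * (1 / 2 ^ (10*k+78)) / (2^40) ^ Suc k"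
    by (intro divide_right_mono mult_left_mono width_defect) auto
  also have "\<dots> = 1 / 2 ^ (50*k+116)"
  proof -
    have "((2::real)^40) ^ Suc k = 2 ^ (40 * Suc k)" by (rule power_mult[symmetric])
    moreover have "(2::real) ^ (10*k+78) * 2 ^ (40 * Suc k) = 2 ^ (50*k+118)" by (simp flip: power_add)
    moreover have "(2::real) ^ (50*k+118) = 4 * 2 ^ (50*k+116)" by (simp add: power_add)
    ultimately show ?thesis by simp
  qed
  also have "\<dots> \<le> defect (Suc k)"
    unfolding defect_def by (intro divide_left_mono power_increasing) auto
  finally show ?thesis .
qed

definition gap_law :: "nat measure \<Rightarrow> nat \<Rightarrow> bool" where
  "gap_law N k \<longleftrightarrow> prob_space N \<and> sets N = sets (count_space UNIV) \<and>
     (\<integral>\<^sup>+x. weight (2^40) x \<partial>N) \<le> ennreal (1 + defect k)"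

lemma width_defect_small: "real (width k) * defect k \<le> 1/6"
proof -
  have "(1::real) / 2 ^ (10*k+78) \<le> 1 / 2 ^ 3"
    by (intro divide_left_mono power_increasing) auto
  from order_trans[OF width_defect this] show ?thesis by simp
qed

text \<open>The excess is below 2^40 * rho. The bound 2^-110 leaves room for the factor 4 lost in
  the merge to level 0, where \<open>defect 0\<close> = 2^-100.\<close>

lemma bernoulli_moment:
  assumes "0 \<le> rho" "rho \<le> 1 / 10 ^ 96"
  shows "(\<integral>\<^sup>+x. weight (2^40) (of_bool x) \<partial>measure_pmf (bernoulli_pmf rho)) \<le> ennreal (1 + 1 / 2 ^ 110)"
proof -
  have r: "rho \<le> 1" using assms by (simp add: field_simps) 
  have "(\<integral>\<^sup>+x. weight (2^40) (of_bool x) \<partial>measure_pmf (bernoulli_pmf rho)) = ennreal ((2^40) * rho + (1 - rho))"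
    using assms r by (simp add: weight_def nn_integral_measure_pmf nn_integral_count_space_finite UNIV_bool ennreal_mult'[symmetric] mult.commute flip: ennreal_plus)
  also have "\<dots> \<le> ennreal (1 + 1 / 2 ^ 110)"
  proof (rule ennreal_leI)
    have "(2^40) * rho \<le> 2^40 * (1 / 10 ^ 96)" using assms by (intro mult_left_mono) auto
    also have "\<dots> \<le> 1 / 2 ^ 110" by simp
    finally show "(2^40) * rho + (1 - rho) \<le> 1 + 1 / 2 ^ 110" using assms by simp
  qed
  finally show ?thesis .
qed

lemma gap_law_Suc:
  assumes N: "gap_law N k"
  defines "SS \<equiv> stream_space (count_space UNIV)"
  shows "\<exists>N'. gap_law N' (Suc k) \<and> distr (stream_space N) SS (merge (width k) (flat (width k)) (\<lambda>x. x) (Suc k)) = stream_space N'"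
    and "AE s in stream_space N. \<forall>j. \<exists>u. flat (width k) (sdrop (width k * (j + u)) s)"
    and "emeasure (stream_space N) (\<Union>i<width k. {s. s !! i \<noteq> 0}) \<le> ennreal (1 / 2 ^ (10*k+78))"
    and "(\<Union>i<width k. {s. s !! i \<noteq> 0}) \<in> sets (stream_space N)"
    and "merge (width k) (flat (width k)) (\<lambda>x. x) (Suc k) \<in> measurable (stream_space N) SS"
proof -
  interpret merging N "width k" "flat (width k)" "\<lambda>x. x"
    by (rule merging_flat) (use N in \<open>auto simp: gap_law_def\<close>)
  have d: "(\<integral>\<^sup>+x. weight (2^40) x \<partial>N) \<le> ennreal (1 + defect k)" "0 \<le> defect k"
    using N by (auto simp: gap_law_def defect_def)
  have z: "(2::real) \<le> 2^40" by simp
  note q = merged_moment(2)[OF z d width_defect_small]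
  have "(\<integral>\<^sup>+x. weight (2^40) x \<partial>merged_law (Suc k)) \<le> ennreal (1 + 4 * real (width k) * defect k / (2^40) ^ Suc k)"
    by (rule merged_law_moment[OF z d width_defect_small])
  also have "\<dots> \<le> ennreal (1 + defect (Suc k))"
    by (intro ennreal_leI add_left_mono defect_Suc)
  finally have "gap_law (merged_law (Suc k)) (Suc k)"
    by (simp add: gap_law_def prob_space_merged_law sets_merged_law)
  then show "\<exists>N'. gap_law N' (Suc k) \<and> distr (stream_space N) SS (merge (width k) (flat (width k)) (\<lambda>x. x) (Suc k)) = stream_space N'"
    using distr_merge[OF q] unfolding SS_def by blast
  show "AE s in stream_space N. \<forall>j. \<exists>u. flat (width k) (sdrop (width k * (j + u)) s)"
    using AE_recurrent[OF q] by (simp add: recurrent_def)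
  show "merge (width k) (flat (width k)) (\<lambda>x. x) (Suc k) \<in> measurable (stream_space N) SS"
    unfolding SS_def by measurable
  show "(\<Union>i<width k. {s. s !! i \<noteq> 0}) \<in> sets (stream_space N)" by (rule heavy_unit_le(2))
  have "emeasure (stream_space N) (\<Union>i<width k. {s. s !! i \<noteq> 0}) \<le> of_nat (width k) * emeasure N {x. x \<noteq> 0}"
    by (rule heavy_unit_le(1))
  also have "\<dots> \<le> of_nat (width k) * ennreal (defect k)"
    by (intro mult_left_mono heavy_le[OF z d]) simp
  also have "\<dots> = ennreal (real (width k) * defect k)"
    using d(2) by (simp add: ennreal_mult ennreal_of_nat_eq_real_of_nat)
  also have "\<dots> \<le> ennreal (1 / 2 ^ (10*k+78))" by (intro ennreal_leI width_defect)
  finally show "emeasure (stream_space N) (\<Union>i<width k. {s. s !! i \<noteq> 0}) \<le> ennreal (1 / 2 ^ (10*k+78))" .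
qed

context
  fixes rho :: real
  assumes rho: "0 \<le> rho" "rho \<le> 1 / 10 ^ 96"
begin

abbreviation (input) flags :: "bool stream measure" where
  "flags \<equiv> stream_space (measure_pmf (bernoulli_pmf rho))"

lemma gaps_law:
  "(\<lambda>b. gaps b k) \<in> measurable flags (stream_space (count_space UNIV)) \<and>
   (\<exists>N. gap_law N k \<and> distr flags (stream_space (count_space UNIV)) (\<lambda>b. gaps b k) = stream_space N)"
proof (induction k)
  case 0
  interpret merging "measure_pmf (bernoulli_pmf rho)" 1 "\<lambda>s. \<not> shd s" of_bool
    by (rule merging_base)
  have z: "(2::real) \<le> 2^40" by simp
  note mm = bernoulli_moment[OF rho]
  have "(\<integral>\<^sup>+x. weight (2^40) x \<partial>merged_law 0) \<le> ennreal (1 + 4 * real 1 * (1 / 2^110) / (2^40) ^ 0)"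
    by (rule merged_law_moment[OF z mm]) auto
  also have "\<dots> \<le> ennreal (1 + defect 0)"
    by (intro ennreal_leI) (simp add: defect_def)
  finally have "gap_law (merged_law 0) 0"
    unfolding gap_law_def using prob_space_merged_law sets_merged_law by blast
  moreover have "emeasure S {s. \<not> \<not> shd s} < 1"
    by (rule merged_moment(2)[OF z mm]) auto
  then have "distr flags (stream_space (count_space UNIV)) (merge 1 (\<lambda>s. \<not> shd s) of_bool 0) = stream_space (merged_law 0)"
    by (rule distr_merge)
  moreover have "merge 1 (\<lambda>s. \<not> shd s) of_bool 0 \<in> measurable flags (stream_space (count_space UNIV))"
    by measurable
  ultimately show ?case by (auto simp: eta_contract_eq)
next
  case (Suc k)
  then obtain N where N: "gap_law N k" "distr flags (stream_space (count_space UNIV)) (\<lambda>b. gaps b k) = stream_space N"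
    and m: "(\<lambda>b. gaps b k) \<in> measurable flags (stream_space (count_space UNIV))" by blast
  have setsN: "sets (stream_space N) = sets (stream_space (count_space UNIV))"
    using N(1) by (intro sets_stream_space_cong) (simp add: gap_law_def)
  have m2: "merge (width k) (flat (width k)) (\<lambda>x. x) (Suc k) \<in> measurable (stream_space (count_space UNIV)) (stream_space (count_space UNIV))"
    using gap_law_Suc(5)[OF N(1)] by (simp cong: measurable_cong_sets add: setsN)
  have eq: "(\<lambda>b. gaps b (Suc k)) = merge (width k) (flat (width k)) (\<lambda>x. x) (Suc k) \<circ> (\<lambda>b. gaps b k)" by auto
  obtain N' where "gap_law N' (Suc k)"
     "distr (stream_space N) (stream_space (count_space UNIV)) (merge (width k) (flat (width k)) (\<lambda>x. x) (Suc k)) = stream_space N'"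
    using gap_law_Suc(1)[OF N(1)] by blast
  moreover have "distr flags (stream_space (count_space UNIV)) (\<lambda>b. gaps b (Suc k)) =
     distr (distr flags (stream_space (count_space UNIV)) (\<lambda>b. gaps b k)) (stream_space (count_space UNIV)) (merge (width k) (flat (width k)) (\<lambda>x. x) (Suc k))"
    unfolding eq by (rule distr_distr[OF m2 m, symmetric])
  ultimately show ?case
    unfolding eq using measurable_comp[OF m m2] N(2) by (metis (no_types, lifting))
qed

text \<open>Recurrence holds almost surely; only the massless first units cost probability, at most
  (1/8) 2^-k at level k. Giving a measurable superset \<open>X\<close> of the bad environments
  bypasses the measurability of \<open>env_good\<close>.\<close>

lemma env_good_prob:
  "\<exists>X\<in>sets flags. emeasure flags X \<le> ennreal (1/4) \<and> (\<forall>b. b \<notin> X \<longrightarrow> env_good b)"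
proof -
  let ?SS = "stream_space (count_space UNIV) :: nat stream measure"
  interpret base: merging "measure_pmf (bernoulli_pmf rho)" 1 "\<lambda>s. \<not> shd s" of_bool
    by (rule merging_base)
  have q0: "emeasure flags {s. \<not> \<not> shd s} < 1"
    by (rule base.merged_moment(2)[OF _ bernoulli_moment[OF rho]]) auto
  have ae0: "AE b in flags. \<forall>j. \<exists>u. \<not> shd (sdrop (1 * (j + u)) b)"
    using base.AE_recurrent[OF q0] unfolding base.recurrent_def .
  have "AE b in flags. \<forall>k. \<forall>j. \<exists>u. flat (width k) (sdrop (width k * (j + u)) (gaps b k))"
    unfolding AE_all_countable[of "\<lambda>k b. \<forall>j. \<exists>u. flat (width k) (sdrop (width k * (j + u)) (gaps b k))"]
  proof
    fix k
    obtain N where N: "gap_law N k" "distr flags ?SS (\<lambda>b. gaps b k) = stream_space N"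
      and m: "(\<lambda>b. gaps b k) \<in> measurable flags ?SS" using gaps_law[of k] by blast
    show "AE b in flags. \<forall>j. \<exists>u. flat (width k) (sdrop (width k * (j + u)) (gaps b k))"
      by (rule AE_distrD[OF m]) (use gap_law_Suc(2)[OF N(1)] N(2) in \<open>simp only:\<close>)
  qed
  with ae0 have "AE b in flags. (\<forall>j. \<exists>u. \<not> shd (sdrop (1 * (j + u)) b)) \<and>
     (\<forall>k j. \<exists>u. flat (width k) (sdrop (width k * (j + u)) (gaps b k)))" by eventually_elim blast
  then obtain Y where Y: "Y \<in> sets flags" "emeasure flags Y = 0"
     "{b\<in>space flags. \<not> ((\<forall>j. \<exists>u. \<not> shd (sdrop (1 * (j + u)) b)) \<and>
     (\<forall>k j. \<exists>u. flat (width k) (sdrop (width k * (j + u)) (gaps b k))))} \<subseteq> Y"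
    by (elim AE_E) auto
  define H where "H k = {b. gaps b k \<in> (\<Union>i<width k. {s. s !! i \<noteq> 0})}" for k
  have H: "H k \<in> sets flags" "emeasure flags (H k) \<le> ennreal (1 / 2 ^ (10*k+78))" for k
  proof -
    obtain N where N: "gap_law N k" "distr flags ?SS (\<lambda>b. gaps b k) = stream_space N"
      and m: "(\<lambda>b. gaps b k) \<in> measurable flags ?SS" using gaps_law[of k] by blast
    have setsN: "sets (stream_space N) = sets ?SS"
      using N(1) by (intro sets_stream_space_cong) (simp add: gap_law_def)
    have s: "(\<Union>i<width k. {s. s !! i \<noteq> 0}) \<in> sets ?SS"
      using gap_law_Suc(4)[OF N(1)] setsN by blast
    have Hv: "H k = (\<lambda>b. gaps b k) -` (\<Union>i<width k. {s. s !! i \<noteq> 0}) \<inter> space flags"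
      by (auto simp: H_def)
    show "H k \<in> sets flags" unfolding Hv by (rule measurable_sets[OF m s])
    have "emeasure flags (H k) = emeasure (stream_space N) (\<Union>i<width k. {s. s !! i \<noteq> 0})"
      unfolding Hv N(2)[symmetric] by (rule emeasure_distr[OF m s, symmetric])
    then show "emeasure flags (H k) \<le> ennreal (1 / 2 ^ (10*k+78))" using gap_law_Suc(3)[OF N(1)] by simp
  qed
  have "emeasure flags (\<Union>k. H k) \<le> (\<Sum>k. emeasure flags (H k))"
    by (rule emeasure_subadditive_countably) (use H(1) in auto)
  also have "\<dots> \<le> (\<Sum>k. ennreal (1/8 * (1/2)^k))"
  proof (rule suminf_le)
    fix k
    have "(1::real) / 2 ^ (10*k+78) \<le> 1 / 2 ^ (k+3)" by (intro divide_left_mono power_increasing) auto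
    also have "\<dots> = 1/8 * (1/2)^k" by (simp add: power_add power_one_over)
    finally show "emeasure flags (H k) \<le> ennreal (1/8 * (1/2)^k)"
      using H(2)[of k] by (meson ennreal_leI order_trans)
  qed auto
  also have "\<dots> = ennreal (1/8 * (1 / (1 - 1/2)))"
    by (rule suminf_ennreal_eq, simp, rule sums_mult, rule geometric_sums) simp
  finally have HU: "emeasure flags (\<Union>k. H k) \<le> ennreal (1/4)" by simp
  have "emeasure flags (Y \<union> (\<Union>k. H k)) \<le> emeasure flags Y + emeasure flags (\<Union>k. H k)"
    by (rule emeasure_subadditive) (use Y H in auto)
  also have "\<dots> \<le> ennreal (1/4)" using Y HU by simp
  finally have "emeasure flags (Y \<union> (\<Union>k. H k)) \<le> ennreal (1/4)" .
  moreover have "Y \<union> (\<Union>k. H k) \<in> sets flags" using Y H by auto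
  moreover have "env_good b" if "b \<notin> Y \<union> (\<Union>k. H k)" for b
  proof -
    have "b \<in> space flags" by simp
    then show ?thesis using that Y(3) unfolding env_good_def H_def by blast
  qed
  ultimately show ?thesis by blast
qed

end

section \<open>Percolation in a fixed environment\<close>

definition eps :: "nat \<Rightarrow> real" where "eps k = 1 / 2 ^ (12*k+100)"
text \<open>Decreases from 1/2 to 1/4. The step of size 2^-k / 8 absorbs the factor
  \<open>(1 - eps k) ^ (4 * half_width k + 4)\<close>, whose deficit is at most 2^-(9k+77).\<close>

definition theta :: "nat \<Rightarrow> real" where "theta k = 1/4 + (1/2)^k / 4"

section \<open>Inequalities linking the constants of consecutive levels\<close>

lemma eps_bounds: "0 < eps k" "eps k \<le> 1/2^100"
proof -
  show "0 < eps k" by (simp add: eps_def)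
  show "eps k \<le> 1/2^100" unfolding eps_def by (intro divide_left_mono power_increasing) auto
qed

lemma theta_bounds: "1/4 \<le> theta k" "theta k \<le> 1"
proof -
  have "(1/2::real)^k \<le> 1" by (simp add: power_le_one)
  then show "1/4 \<le> theta k" "theta k \<le> 1" unfolding theta_def by auto
qed

lemma theta_Suc: "theta (Suc k) \<le> theta k * (1 - eps k) ^ (4 * half_width k + 4)"
proof -
  define t where "t = (1/2::real)^k"
  have t: "0 < t" "t \<le> 1" by (auto simp: t_def power_le_one)
  have "real (4 * half_width k + 4) * eps k = 2 * real (width k) * eps k" by (simp add: width_def)
  also have "\<dots> \<le> 2 * 2 ^ (3*k+22) * eps k"
    by (intro mult_right_mono mult_left_mono width_le) (simp_all add: eps_def)
  also have "\<dots> = 1 / 2 ^ (9*k+77)"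
  proof -
    have "(2::real) ^ (12*k+100) = 2 * 2 ^ (3*k+22) * 2 ^ (9*k+77)" by (simp flip: power_add power_Suc)
    then show ?thesis by (simp add: eps_def)
  qed
  also have "\<dots> \<le> 1 / 2 ^ (k+2)" by (intro divide_left_mono power_increasing) auto
  also have "\<dots> = t / 4" by (simp add: t_def power_add power_one_over)
  finally have x: "real (4 * half_width k + 4) * eps k \<le> t / 4" .
  have "theta (Suc k) = 1/4 + t / 8" by (simp add: theta_def t_def)
  also have "\<dots> \<le> (1/4 + t/4) * (1 - t/4)"
    using mult_left_mono[of t 1 t] t by (simp add: algebra_simps)
  also have "\<dots> \<le> theta k * (1 - real (4 * half_width k + 4) * eps k)"
    using x t by (intro mult_mono) (auto simp: theta_def t_def)
  also have "\<dots> \<le> theta k * (1 - eps k) ^ (4 * half_width k + 4)"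
    using Bernoulli_inequality[of "- eps k" "4 * half_width k + 4"] eps_bounds[of k] theta_bounds[of k]
    by (intro mult_left_mono) auto
  finally show ?thesis .
qed

lemma eps_half: "1/2 \<le> (1 - eps k) ^ 11"
  using Bernoulli_inequality[of "- eps k" 11] eps_bounds[of k] by simp

lemma eps_crossing: "exp (- (real (half_width k) * theta (Suc k) ^ Suc k / 2)) \<le> eps (Suc k)"
proof -
  have n: "12*k + 112 \<le> (2::nat) ^ (k+17)"
  proof (induction k)
    case (Suc k)
    have "(2::nat) ^ (Suc k + 17) = 2 * 2 ^ (k+17)" by (simp only: add_Suc power_Suc)
    moreover have "12 * Suc k + 112 = 12*k + 124" by simp
    ultimately show ?case using Suc.IH by linarith
  qed simp
  have "real (half_width k) * (1/4) ^ Suc k / 2 = 2 ^ (k+17)"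
  proof -
    have "(4::real) ^ Suc k = 2 ^ (2 * Suc k)" by (simp add: power_mult)
    moreover have "(2::real) ^ (3*k+20) = 2 ^ (2 * Suc k) * 2 * 2 ^ (k+17)" by (simp flip: power_add power_Suc power_Suc2)
    ultimately show ?thesis by (simp add: half_width_def power_one_over)
  qed
  moreover have "(1/4) ^ Suc k \<le> theta (Suc k) ^ Suc k" by (intro power_mono theta_bounds) simp
  then have "real (half_width k) * (1/4) ^ Suc k / 2 \<le> real (half_width k) * theta (Suc k) ^ Suc k / 2"
    by (intro divide_right_mono mult_left_mono) auto
  moreover have "real (12*k+112) \<le> 2 ^ (k+17)" using n by (metis of_nat_le_iff of_nat_numeral of_nat_power)
  ultimately have "exp (- (real (half_width k) * theta (Suc k) ^ Suc k / 2)) \<le> exp (- real (12*k+112))"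
    by simp
  also have "\<dots> = exp (-1) ^ (12*k+112)" by (simp flip: exp_of_nat_mult)
  also have "\<dots> \<le> (1/2) ^ (12*k+112)"
  proof (intro power_mono)
    show "exp (-1) \<le> (1/2::real)" using exp_ge_add_one_self[of 1] by (simp add: exp_minus field_simps)
  qed simp
  also have "\<dots> = eps (Suc k)" by (simp add: eps_def power_one_over)
  finally show ?thesis .
qed

lemma eps_box: "256 * real (half_width k) ^ 4 * (eps k)^2 \<le> eps (Suc k)"
proof -
  have a: "real (half_width k) ^ 4 = 2 ^ (12*k+80)" by (simp add: half_width_def flip: power_mult)
  have b: "(eps k)^2 = 1 / 2 ^ (24*k+200)" by (simp add: eps_def power_one_over power_divide flip: power_mult)
  have "(2::real) ^ (24*k+200) = 2^8 * 2 ^ (12*k+80) * 2 ^ (12*k+112)" by (simp flip: power_add del: power_numeral)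
  then show ?thesis unfolding a b by (simp add: eps_def add.commute)
qed

text \<open>A removed column lacks only its vertical edges, so a kept row still runs across it. A
  level-0 edge is the straight path along a kept line between two consecutive kept transversal
  lines.\<close>

definition base_site :: "(nat \<Rightarrow> nat) \<Rightarrow> (nat \<Rightarrow> nat) \<Rightarrow> nat \<times> nat \<Rightarrow> (site \<Rightarrow> bool) \<Rightarrow> bool" where
  "base_site X Y s \<omega> = (let x = fst s; y = snd s in
     if odd x \<and> odd y then True
     else if odd y \<and> 0 < x then \<forall>i\<in>{X (x div 2 - 1)..<X (x div 2)}. \<omega> (HEdge (int i) (int (Y (y div 2))))
     else if odd x \<and> 0 < y then \<forall>j\<in>{Y (y div 2 - 1)..<Y (y div 2)}. \<omega> (VEdge (int (X (x div 2))) (int j))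
     else False)"

definition base_edges :: "(nat \<Rightarrow> nat) \<Rightarrow> (nat \<Rightarrow> nat) \<Rightarrow> nat \<times> nat \<Rightarrow> site set" where
  "base_edges X Y s = (let x = fst s; y = snd s in
     if odd x \<and> odd y then {}
     else if odd y \<and> 0 < x then (\<lambda>i. HEdge (int i) (int (Y (y div 2)))) ` {X (x div 2 - 1)..<X (x div 2)}
     else if odd x \<and> 0 < y then (\<lambda>j. VEdge (int (X (x div 2))) (int j)) ` {Y (y div 2 - 1)..<Y (y div 2)}
     else {})"

lemma even_span_eq:
  fixes X :: "nat \<Rightarrow> nat"
  assumes "strict_mono X" "even x" "0 < x" "even x'" "0 < x'"
    and "i \<in> {X (x div 2 - 1)..<X (x div 2)}" "i \<in> {X (x' div 2 - 1)..<X (x' div 2)}"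
  shows "x = x'"
proof -
  have "Suc (x div 2 - 1) = x div 2" "Suc (x' div 2 - 1) = x' div 2" using assms by presburger+
  then have "x div 2 - 1 = x' div 2 - 1"
    using disjoint_spans[OF assms(1), of "x div 2 - 1" "x' div 2 - 1"] assms(6,7) by (metis IntI empty_iff)
  then show ?thesis using assms by presburger
qed

lemma disjoint_base_edges:
  assumes "strict_mono X" "strict_mono Y"
  shows "disjoint_family (base_edges X Y)"
  unfolding disjoint_family_on_def
proof (intro ballI impI, rule ccontr)
  fix s t :: "nat \<times> nat"
  assume st: "s \<noteq> t" and "base_edges X Y s \<inter> base_edges X Y t \<noteq> {}"
  then obtain f where f: "f \<in> base_edges X Y s" "f \<in> base_edges X Y t" by blast
  have inj: "X a = X b \<longleftrightarrow> a = b" "Y a = Y b \<longleftrightarrow> a = b" for a b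
    using assms by (auto simp: strict_mono_eq)
  have odd_eq: "a = b" if "odd a" "odd b" "a div 2 = b div 2" for a b :: nat using that by presburger
  show False
  proof (cases "even (fst s)")
    case True
    then have s: "odd (snd s)" "0 < fst s" using f(1) by (auto simp: base_edges_def Let_def split: if_splits)
    then obtain i where i: "f = HEdge (int i) (int (Y (snd s div 2)))" "i \<in> {X (fst s div 2 - 1)..<X (fst s div 2)}"
      using f(1) True s by (auto simp: base_edges_def Let_def)
    have t: "even (fst t)" "odd (snd t)" "0 < fst t" "snd s div 2 = snd t div 2" "i \<in> {X (fst t div 2 - 1)..<X (fst t div 2)}"
      using f(2) i(1) inj by (auto simp: base_edges_def Let_def split: if_splits)
    have "fst s = fst t" by (rule even_span_eq[OF assms(1) True s(2) t(1,3) i(2) t(5)])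
    then show False using st odd_eq[OF s(1) t(2,4)] by (simp add: prod_eq_iff)
  next
    case False
    then have s: "even (snd s)" "0 < snd s" using f(1) by (auto simp: base_edges_def Let_def split: if_splits)
    then obtain i where i: "f = VEdge (int (X (fst s div 2))) (int i)" "i \<in> {Y (snd s div 2 - 1)..<Y (snd s div 2)}"
      using f(1) False s by (auto simp: base_edges_def Let_def)
    have t: "even (snd t)" "odd (fst t)" "0 < snd t" "fst s div 2 = fst t div 2" "i \<in> {Y (snd t div 2 - 1)..<Y (snd t div 2)}"
      using f(2) i(1) inj by (auto simp: base_edges_def Let_def split: if_splits)
    have "snd s = snd t" by (rule even_span_eq[OF assms(2) s t(1,3) i(2) t(5)])
    then show False using st odd_eq[OF False t(2,4)] by (simp add: prod_eq_iff)
  qed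
qed

section \<open>The annealed measure and the level-0 field\<close>

lemma annealed_prob_space: "prob_space (annealed rho p)"
  unfolding annealed_def by (intro prob_space_PiM prob_space_measure_pmf)

lemma space_annealed [simp]: "space (annealed rho p) = UNIV"
  by (simp add: annealed_def space_PiM)

lemma sets_annealed: "sets (annealed rho p) = sets (\<Pi>\<^sub>M s\<in>UNIV. count_space UNIV)"
  unfolding annealed_def by (intro sets_PiM_cong) auto

lemma annealed_component:
  "distr (annealed rho p) (count_space UNIV) (\<lambda>\<omega>. \<omega> s) = measure_pmf (bernoulli_pmf (site_prob rho p s))"
proof -
  have "distr (annealed rho p) (count_space UNIV) (\<lambda>\<omega>. \<omega> s) =
    distr (annealed rho p) (measure_pmf (bernoulli_pmf (site_prob rho p s))) (\<lambda>\<omega>. \<omega> s)"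
    by (rule distr_cong) auto
  also have "\<dots> = measure_pmf (bernoulli_pmf (site_prob rho p s))"
    unfolding annealed_def by (rule distr_PiM_component) (auto intro: prob_space_measure_pmf)
  finally show ?thesis .
qed

lemma measurable_annealed_component [measurable]: "(\<lambda>\<omega>. \<omega> s) \<in> measurable (annealed rho p) (count_space UNIV)"
proof -
  have "(\<lambda>\<omega>. \<omega> s) \<in> measurable (\<Pi>\<^sub>M s\<in>UNIV. count_space UNIV) (count_space UNIV)"
    by (rule measurable_component_singleton) simp
  then show ?thesis by (simp only: measurable_cong_sets[OF sets_annealed refl])
qed

lemma indep_annealed: "prob_space.indep_bools (annealed rho p) (\<lambda>s \<omega>. \<omega> s) UNIV"
proof -
  interpret prob_space "annealed rho p" by (rule annealed_prob_space)
  have "distr (annealed rho p) (\<Pi>\<^sub>M s\<in>UNIV. count_space UNIV) (\<lambda>\<omega>. \<lambda>s\<in>UNIV. \<omega> s) = annealed rho p"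
    using distr_id2[OF sets_annealed[symmetric]] by (simp add: restrict_UNIV)
  also have "\<dots> = (\<Pi>\<^sub>M s\<in>UNIV. distr (annealed rho p) (count_space UNIV) (\<lambda>\<omega>. \<omega> s))"
    unfolding annealed_component by (simp add: annealed_def)
  finally show ?thesis
    by (subst indep_vars_iff_distr_eq_PiM) auto
qed

lemma prob_annealed_site:
  assumes "0 \<le> site_prob rho p s" "site_prob rho p s \<le> 1"
  shows "measure (annealed rho p) {\<omega>. \<omega> s} = site_prob rho p s"
proof -
  have "measure (annealed rho p) {\<omega>. \<omega> s} = measure (distr (annealed rho p) (count_space UNIV) (\<lambda>\<omega>. \<omega> s)) {True}"
    by (subst measure_distr) (auto intro!: arg_cong2[where f=measure])
  also have "\<dots> = site_prob rho p s"
    unfolding annealed_component using assms by (simp add: measure_pmf_single)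
  finally show ?thesis .
qed

text \<open>A gap of mass h is crossed by at most h+1 edges. One factor p pays for
  \<open>1 - eps 0\<close>, the others for \<open>theta 0\<close> = 1/2, since p >= 1/2.\<close>

lemma field_base:
  assumes p: "p \<le> 1" "1 - eps 0 \<le> p" and X: "strict_mono X" and Y: "strict_mono Y"
    and g: "\<And>I. X (Suc I) \<le> Suc (X I) + g (Suc I)" and g': "\<And>I. Y (Suc I) \<le> Suc (Y I) + g' (Suc I)"
  shows "prob_space.field (annealed rho p) (base_site X Y) (eps 0) (theta 0) g g'"
proof -
  interpret prob_space "annealed rho p" by (rule annealed_prob_space)
  have e0: "eps 0 \<le> 1/2" using eps_bounds(2)[of 0] by simp
  have p12: "1/2 \<le> p" using p e0 by simp
  have th: "theta 0 = 1/2" by (simp add: theta_def)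
  have ind: "indep_bools (base_site X Y) UNIV"
    by (rule indep_bools_local[OF indep_annealed, where K="base_edges X Y" and f="base_site X Y"])
       (use disjoint_base_edges[OF X Y] in \<open>auto simp: base_site_def base_edges_def Let_def split: if_splits\<close>)
  have pw: "(1 - eps 0) * (1/2) ^ h \<le> p ^ n" if "n \<le> Suc h" for n h
  proof -
    have "(1 - eps 0) * (1/2) ^ h \<le> p * p ^ h"
      using p p12 e0 by (intro mult_mono power_mono) auto
    also have "\<dots> \<le> p ^ n" using power_decreasing[OF that, of p] p p12 by simp
    finally show ?thesis .
  qed
  have all: "\<P>(\<omega> in annealed rho p. \<forall>f\<in>J. \<omega> f) = p ^ card J" if "finite J" "\<And>f. f \<in> J \<Longrightarrow> site_prob rho p f = p" for J
  proof -
    have "\<P>(\<omega> in annealed rho p. \<forall>f\<in>J. \<omega> f) = (\<Prod>f\<in>J. \<P>(\<omega> in annealed rho p. \<omega> f))"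
      by (rule indep_bools_prod[OF indep_annealed that(1)]) simp
    also have "\<dots> = (\<Prod>f\<in>J. p)"
      using that(2) p p12 by (intro prod.cong) (auto simp: prob_annealed_site)
    finally show ?thesis by simp
  qed
  have "(1 - eps 0) * theta 0 ^ (wt g (fst s) + wt g' (snd s)) \<le> \<P>(\<omega> in annealed rho p. base_site X Y s \<omega>)" if us: "usable s" for s
  proof -
    obtain x y where s: "s = (x, y)" by (cases s)
    consider "odd x" "odd y" | I where "x = 2*Suc I" "odd y" | J where "odd x" "y = 2*Suc J"
    proof -
      have "odd x \<and> odd y \<or> (even x \<and> 0 < x \<and> odd y) \<or> (odd x \<and> even y \<and> 0 < y)"
        using us by (auto simp: usable_def s)
      moreover have "\<exists>I. n = 2*Suc I" if "even n" "0 < n" for n :: nat using that by presburger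
      ultimately show thesis using that by metis
    qed
    then show ?thesis
    proof cases
      case 1
      then show ?thesis using eps_bounds[of 0] prob_space by (simp add: s base_site_def wt_def)
    next
      case 2
      define J where "J = (\<lambda>i. HEdge (int i) (int (Y (y div 2)))) ` {X I..<X (Suc I)}"
      have "card J = X (Suc I) - X I" unfolding J_def by (subst card_image) (auto simp: inj_on_def)
      then have "\<P>(\<omega> in annealed rho p. \<forall>f\<in>J. \<omega> f) = p ^ (X (Suc I) - X I)"
        by (subst all) (auto simp: J_def)
      moreover have "base_site X Y s \<omega> \<longleftrightarrow> (\<forall>f\<in>J. \<omega> f)" for \<omega>
        using 2 by (auto simp: base_site_def s J_def)
      ultimately show ?thesis using pw[of "X (Suc I) - X I" "g (Suc I)"] g[of I] 2 by (simp add: s wt_def th)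
    next
      case 3
      define K where "K = (\<lambda>j. VEdge (int (X (x div 2))) (int j)) ` {Y J..<Y (Suc J)}"
      have "card K = Y (Suc J) - Y J" unfolding K_def by (subst card_image) (auto simp: inj_on_def)
      then have "\<P>(\<omega> in annealed rho p. \<forall>f\<in>K. \<omega> f) = p ^ (Y (Suc J) - Y J)"
        by (subst all) (auto simp: K_def)
      moreover have "base_site X Y s \<omega> \<longleftrightarrow> (\<forall>f\<in>K. \<omega> f)" for \<omega>
        using 3 by (auto simp: base_site_def s K_def)
      ultimately show ?thesis using pw[of "Y (Suc J) - Y J" "g' (Suc J)"] g'[of J] 3 by (simp add: s wt_def th)
    qed
  qed
  with ind show ?thesis by (simp add: field_def)
qed

text \<open>Line removals come from \<eta>, edge states from \<omega>. For two independent annealed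
  samples the mixture is again annealed, so Fubini takes the place of conditioning on the
  environment.\<close>

definition mix :: "(site \<Rightarrow> bool) \<Rightarrow> (site \<Rightarrow> bool) \<Rightarrow> site \<Rightarrow> bool" where
  "mix \<eta> \<omega> s = (case s of Col i \<Rightarrow> \<eta> s | Row j \<Rightarrow> \<eta> s | VEdge i j \<Rightarrow> \<omega> s | HEdge i j \<Rightarrow> \<omega> s)"

lemma mix_simps [simp]:
  "mix \<eta> \<omega> (Col i) = \<eta> (Col i)" "mix \<eta> \<omega> (Row i) = \<eta> (Row i)"
  "mix \<eta> \<omega> (VEdge i j) = \<omega> (VEdge i j)" "mix \<eta> \<omega> (HEdge i j) = \<omega> (HEdge i j)"
  by (simp_all add: mix_def)

definition joined :: "(site \<Rightarrow> bool) \<Rightarrow> int \<times> int \<Rightarrow> int \<times> int \<Rightarrow> bool" where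
  "joined \<omega> u v \<longleftrightarrow> (u, v) \<in> {(u, v). open_edge \<omega> u v}\<^sup>*"

lemma open_edge_sym: "open_edge \<omega> u v \<Longrightarrow> open_edge \<omega> v u"
  unfolding open_edge_def by blast

lemma equivp_joined: "equivp (joined \<omega>)"
proof (rule equivpI)
  show "reflp (joined \<omega>)" by (simp add: reflp_def joined_def)
  have "sym {(u, v). open_edge \<omega> u v}" using open_edge_sym by (auto simp: sym_def)
  then show "symp (joined \<omega>)" unfolding symp_def joined_def by (metis sym_rtrancl symD)
  show "transp (joined \<omega>)" unfolding transp_def joined_def by (auto intro: rtrancl_trans)
qed

lemma joined_line:
  assumes "\<And>i. a \<le> i \<Longrightarrow> i < b \<Longrightarrow> open_edge \<omega> (f i) (f (Suc i))" and "a \<le> b"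
  shows "joined \<omega> (f a) (f b)"
  using assms(2,1)
proof (induction rule: dec_induct)
  case base
  then show ?case by (simp add: joined_def)
next
  case (step n)
  then have "joined \<omega> (f a) (f n)" "open_edge \<omega> (f n) (f (Suc n))" by auto
  then show ?case unfolding joined_def by (auto intro: rtrancl_into_rtrancl)
qed

text \<open>The environment enters only through \<open>c\<close> and \<open>d\<close>:
  \<open>base_site\<close> reads just the edge variables of \<omega>. The annealed law can therefore
  serve as the quenched law.\<close>

primrec level_site :: "bool stream \<Rightarrow> bool stream \<Rightarrow> nat \<Rightarrow> nat \<times> nat \<Rightarrow> (site \<Rightarrow> bool) \<Rightarrow> bool" where
  "level_site c d 0 = base_site (line_index c) (line_index d)"
| "level_site c d (Suc k) = (\<lambda>s \<omega>. coarsen (half_width k) (unit_index c k) (unit_index d k) (\<lambda>s. level_site c d k s \<omega>) s)"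

primrec level_rep :: "bool stream \<Rightarrow> bool stream \<Rightarrow> (site \<Rightarrow> bool) \<Rightarrow> nat \<Rightarrow> nat \<Rightarrow> nat \<Rightarrow> int \<times> int" where
  "level_rep c d \<omega> 0 = (\<lambda>I J. (int (line_index c I), int (line_index d J)))"
| "level_rep c d \<omega> (Suc k) = coarse_rep (half_width k) (unit_index c k) (unit_index d k) (\<lambda>s. level_site c d k s \<omega>) (level_rep c d \<omega> k)"

lemma env_goodD:
  assumes "env_good c"
  shows "coarsening (half_width k) (Suc k) ((!!) (gaps c k)) (unit_index c k) ((!!) (gaps c (Suc k)))"
    and "unit_index c k 0 = 0" and "strict_mono (unit_index c k)"
    and "i < width k \<Longrightarrow> gaps c k !! i = 0"
    and "strict_mono (line_index c)" and "\<not> c !! line_index c I"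
    and "line_index c (Suc I) \<le> Suc (line_index c I) + gaps c 0 !! Suc I"
    and "line_index c 0 = 0"
proof -
  have 1: "\<forall>j. \<exists>u. \<not> shd (sdrop (1 * (j + u)) c)"
    and 2: "\<And>k. \<forall>j. \<exists>u. flat (width k) (sdrop (width k * (j + u)) (gaps c k))"
    and 3: "\<And>k. \<forall>i<width k. gaps c k !! i = 0"
    using assms unfolding env_good_def by blast+
  show "coarsening (half_width k) (Suc k) ((!!) (gaps c k)) (unit_index c k) ((!!) (gaps c (Suc k)))"
    by (rule coarsening_gaps[OF 2])
  then show "strict_mono (unit_index c k)" by (simp add: coarsening_def)
  show "unit_index c k 0 = 0" by (rule unit_index_0[OF 3])
  show "i < width k \<Longrightarrow> gaps c k !! i = 0" using 3 by blast
  show "strict_mono (line_index c)" "\<not> c !! line_index c I"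
    "line_index c (Suc I) \<le> Suc (line_index c I) + gaps c 0 !! Suc I"
    using line_index[OF 1] by blast+
  have "line_index c 0 \<le> gaps c 0 !! 0" by (rule line_index(4)[OF 1])
  also have "\<dots> = 0" by (rule 3[of 0, rule_format]) (use width_ge(1)[of 0] in simp)
  finally show "line_index c 0 = 0" by simp
qed

context
  fixes c d :: "bool stream"
  assumes c: "env_good c" and d: "env_good d"
begin

lemma level_field:
  assumes p: "p \<le> 1" "1 - eps 0 \<le> p"
  shows "prob_space.field (annealed rho p) (level_site c d k) (eps k) (theta k) ((!!) (gaps c k)) ((!!) (gaps d k))"
proof (induction k)
  case 0
  show ?case unfolding level_site.simps
    by (rule field_base[OF p]) (rule env_goodD[OF c] env_goodD[OF d])+
next
  case (Suc k)
  interpret prob_space "annealed rho p" by (rule annealed_prob_space)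
  have e: "eps k \<le> 1" using eps_bounds(2)[of k] by (rule order_trans) simp
  have th: "0 < theta k" "0 < theta (Suc k)" using theta_bounds(1)[of k] theta_bounds(1)[of "Suc k"] by linarith+
  show ?case unfolding level_site.simps
    by (rule field_coarsen[OF Suc env_goodD(1)[OF c] env_goodD(1)[OF d] width_ge(2) less_imp_le[OF eps_bounds(1)] e
         th(1) theta_bounds(2) th(2) theta_Suc eps_half eps_crossing eps_box])
qed

text \<open>Passing down one level multiplies the column index by at least \<open>width k\<close> >=
  4; the factor 3 is a crude bound, enough to send the representatives of column 1 to
  infinity.\<close>

lemma level_rep_far: "int (3 ^ k * I) \<le> fst (level_rep c d \<omega> k I J)"
proof (induction k arbitrary: I J)
  case 0
  have "I \<le> line_index c I" by (rule strict_mono_imp_increasing[OF env_goodD(5)[OF c]])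
  then show ?case by simp
next
  case (Suc k)
  define i where "i = (2 * half_width k + 2) * unit_index c k I + 1"
  define j where "j = (2 * half_width k + 2) * unit_index d k J + 1"
  have "I \<le> unit_index c k I" by (rule strict_mono_imp_increasing[OF env_goodD(3)[OF c]])
  then have "3 * I \<le> (2 * half_width k + 2) * unit_index c k I"
    using width_ge(2)[of k] by (intro mult_mono) auto
  then have i: "3 * I \<le> i" by (simp add: i_def)
  have "int (3 ^ Suc k * I) \<le> int (3 ^ k * i')" if "i \<le> i'" for i'
  proof -
    have "3 ^ k * (3 * I) \<le> 3 ^ k * i'" using i that by (intro mult_le_mono2) simp
    then show ?thesis unfolding of_nat_le_iff by (simp add: mult_ac)
  qed
  then have "int (3 ^ Suc k * I) \<le> fst (level_rep c d \<omega> k i' j)" if "i \<le> i'" for i'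
    using Suc.IH[of i' j] that by (meson order_trans)
  from this[of i] this[of "Suc i"] show ?case
    unfolding level_rep.simps coarse_rep_def Let_def i_def[symmetric] j_def[symmetric] by simp
qed

lemma level_linked:
  assumes \<eta>: "\<And>n. \<eta> (Col (int n)) = c !! n" "\<And>n. \<eta> (Row (int n)) = d !! n"
  shows "linked (\<lambda>s. level_site c d k s \<omega>) (joined (mix \<eta> \<omega>)) (level_rep c d \<omega> k)"
proof (induction k)
  case 0
  have "hlinked (\<lambda>s. level_site c d 0 s \<omega>) (joined (mix \<eta> \<omega>)) (level_rep c d \<omega> 0)"
    unfolding hlinked_def
  proof (intro allI impI)
    fix i j
    assume "level_site c d 0 (2*i+2, 2*j+1) \<omega>"
    then have h: "\<omega> (HEdge (int x) (int (line_index d j)))"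
      if "line_index c i \<le> x" "x < line_index c (Suc i)" for x
      using that by (simp add: base_site_def)
    have "\<not> \<eta> (Row (int (line_index d j)))" using env_goodD(6)[OF d] \<eta> by simp
    then have "open_edge (mix \<eta> \<omega>) (int x, int (line_index d j)) (int (Suc x), int (line_index d j))"
      if "line_index c i \<le> x" "x < line_index c (Suc i)" for x
      unfolding open_edge_def using h[OF that] by auto
    moreover have "line_index c i \<le> line_index c (Suc i)"
      using env_goodD(5)[OF c] by (simp add: strict_mono_less_eq)
    ultimately show "joined (mix \<eta> \<omega>) (level_rep c d \<omega> 0 i j) (level_rep c d \<omega> 0 (Suc i) j)"
      using joined_line[of "line_index c i" "line_index c (Suc i)" "mix \<eta> \<omega>" "\<lambda>x. (int x, int (line_index d j))"]
      by simp
  qed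
  moreover have "hlinked ((\<lambda>s. level_site c d 0 s \<omega>) \<circ> prod.swap) (joined (mix \<eta> \<omega>)) (\<lambda>i j. level_rep c d \<omega> 0 j i)"
    unfolding hlinked_def
  proof (intro allI impI)
    fix i j
    assume "((\<lambda>s. level_site c d 0 s \<omega>) \<circ> prod.swap) (2*i+2, 2*j+1)"
    then have h: "\<omega> (VEdge (int (line_index c j)) (int x))"
      if "line_index d i \<le> x" "x < line_index d (Suc i)" for x
      using that by (simp add: base_site_def)
    have "\<not> \<eta> (Col (int (line_index c j)))" using env_goodD(6)[OF c] \<eta> by simp
    then have "open_edge (mix \<eta> \<omega>) (int (line_index c j), int x) (int (line_index c j), int (Suc x))"
      if "line_index d i \<le> x" "x < line_index d (Suc i)" for x
      unfolding open_edge_def using h[OF that] by auto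
    moreover have "line_index d i \<le> line_index d (Suc i)"
      using env_goodD(5)[OF d] by (simp add: strict_mono_less_eq)
    ultimately show "joined (mix \<eta> \<omega>) (level_rep c d \<omega> 0 j i) (level_rep c d \<omega> 0 j (Suc i))"
      using joined_line[of "line_index d i" "line_index d (Suc i)" "mix \<eta> \<omega>" "\<lambda>x. (int (line_index c j), int x)"]
      by simp
  qed
  ultimately show ?case unfolding linked_def by blast
next
  case (Suc k)
  show ?case unfolding level_site.simps level_rep.simps
    by (rule coarsen_linked[OF Suc equivp_joined width_ge(2) env_goodD(3)[OF c] env_goodD(3)[OF d]])
qed

text \<open>Along these sites the representative of the block of the origin is handed over to the next level.\<close>

definition anchor :: "(nat \<times> nat) set" where
  "anchor = {(1,1), (2,1), (3,1), (3,2), (3,3)}"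

text \<open>The anchor sites link representative (0,0) of level k to (1,1), which is representative
  (0,0) of level k+1. So the origin is joined to (1,1) of every level, at horizontal distance at
  least 3^k.\<close>

lemma anchored_infinite:
  assumes \<eta>: "\<And>n. \<eta> (Col (int n)) = c !! n" "\<And>n. \<eta> (Row (int n)) = d !! n"
    and A: "\<And>k s. s \<in> anchor \<Longrightarrow> level_site c d k s \<omega>"
  shows "infinite (open_cluster (mix \<eta> \<omega>) (0, 0))"
proof
  assume fin: "finite (open_cluster (mix \<eta> \<omega>) (0, 0))"
  define R where "R = joined (mix \<eta> \<omega>)"
  have R: "equivp R" unfolding R_def by (rule equivp_joined)
  have step: "R (level_rep c d \<omega> k 0 0) (level_rep c d \<omega> k 1 1)" for k
  proof -
    have l: "hlinked (\<lambda>s. level_site c d k s \<omega>) R (level_rep c d \<omega> k)"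
      "hlinked ((\<lambda>s. level_site c d k s \<omega>) \<circ> prod.swap) R (\<lambda>i j. level_rep c d \<omega> k j i)"
      using level_linked[OF \<eta>] unfolding linked_def R_def by blast+
    have "R (level_rep c d \<omega> k 0 0) (level_rep c d \<omega> k (Suc 0) 0)"
      using l(1)[unfolded hlinked_def, rule_format, of 0 0] A[of _ k] by (simp add: anchor_def)
    moreover have "R (level_rep c d \<omega> k (Suc 0) 0) (level_rep c d \<omega> k (Suc 0) (Suc 0))"
      using l(2)[unfolded hlinked_def, rule_format, of 0 1] A[of _ k] by (simp add: anchor_def numeral_3_eq_3)
    ultimately show ?thesis using R by (metis One_nat_def equivp_transp)
  qed
  have rep0: "level_rep c d \<omega> (Suc k) 0 0 = level_rep c d \<omega> k 1 1" for k
    using A[of "(3,3)" k] env_goodD(2)[OF c, of k] env_goodD(2)[OF d, of k]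
    by (simp add: coarse_rep_def anchor_def numeral_3_eq_3)
  have "R (0, 0) (level_rep c d \<omega> k 0 0)" for k
  proof (induction k)
    case 0
    then show ?case using R env_goodD(8)[OF c] env_goodD(8)[OF d] by (simp add: equivp_reflp)
  next
    case (Suc k)
    then show ?case unfolding rep0 using step[of k] R by (meson equivp_transp)
  qed
  then have "R (0, 0) (level_rep c d \<omega> k 1 1)" for k using step[of k] R by (meson equivp_transp)
  then have mem: "level_rep c d \<omega> k 1 1 \<in> open_cluster (mix \<eta> \<omega>) (0, 0)" for k
    by (simp add: R_def joined_def open_cluster_def)
  obtain B where B: "\<And>y. y \<in> open_cluster (mix \<eta> \<omega>) (0, 0) \<Longrightarrow> fst y \<le> B"
    using finite_imageI[OF fin, of fst] by (meson Max_ge imageI)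
  have "int (nat B) < int (3 ^ nat B * 1)"
    unfolding of_nat_less_iff using power_gt_expt[of 3 "nat B"] by simp
  also have "\<dots> \<le> fst (level_rep c d \<omega> (nat B) 1 1)" by (rule level_rep_far)
  also have "\<dots> \<le> B" by (rule B[OF mem])
  finally show False by (simp split: if_split_asm)
qed

lemma quenched:
  assumes p: "p \<le> 1" "1 - eps 0 \<le> p"
    and \<eta>: "\<And>n. \<eta> (Col (int n)) = c !! n" "\<And>n. \<eta> (Row (int n)) = d !! n"
  shows "\<exists>X\<in>sets (annealed rho p). emeasure (annealed rho p) X \<le> ennreal (1/4) \<and>
     (\<forall>\<omega>. \<omega> \<notin> X \<longrightarrow> infinite (open_cluster (mix \<eta> \<omega>) (0, 0)))"
proof -
  interpret prob_space "annealed rho p" by (rule annealed_prob_space)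
  define X where "X k = (\<Union>s\<in>anchor. {\<omega>. \<not> level_site c d k s \<omega>})" for k
  note F = level_field[OF p, of rho]
  have ind: "indep_bools (level_site c d k) UNIV" for k using F by (simp add: field_def)
  have ev: "{\<omega>. \<not> level_site c d k s \<omega>} \<in> events" for k s
    using indep_bools_sets[OF indep_bools_neg[OF ind], of s k] by simp
  have ps: "prob {\<omega>. \<not> level_site c d k s \<omega>} \<le> eps k" if s: "s \<in> anchor" for k s
  proof -
    \<comment> \<open>Anchor coordinates are 1, 2 or 3, so the only gap met is the one of index 1.
      It is massless in a good environment, and no power of theta is lost.\<close>
    have g: "gaps c k !! 1 = 0" "gaps d k !! 1 = 0"
      using width_ge(2)[of k] by (auto intro!: env_goodD(4)[OF c] env_goodD(4)[OF d] simp: width_def simp del: snth.simps)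
    have "usable s" using s by (auto simp: anchor_def usable_def)
    then have "(1 - eps k) * theta k ^ (wt ((!!) (gaps c k)) (fst s) + wt ((!!) (gaps d k)) (snd s)) \<le> prob {\<omega>. level_site c d k s \<omega>}"
      using F[of k, unfolded field_def, THEN conjunct2, rule_format, of s] by simp
    moreover have "wt ((!!) (gaps c k)) (fst s) = 0" "wt ((!!) (gaps d k)) (snd s) = 0"
      using s g by (auto simp: anchor_def wt_def simp del: snth.simps)
    ultimately have "1 - eps k \<le> prob {\<omega>. level_site c d k s \<omega>}" by simp
    moreover have "prob {\<omega>. \<not> level_site c d k s \<omega>} = 1 - prob {\<omega>. level_site c d k s \<omega>}"
      using prob_neg[OF indep_bools_sets[OF ind, of s k]] by simp
    ultimately show ?thesis by simp
  qed
  have fa: "finite anchor" "card anchor \<le> 5" by (auto simp: anchor_def card_insert_if)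
  have evX: "X k \<in> events" for k unfolding X_def using fa ev by auto
  have "prob (X k) \<le> 5 * eps k" for k
  proof -
    have "prob (X k) \<le> (\<Sum>s\<in>anchor. prob {\<omega>. \<not> level_site c d k s \<omega>})"
      unfolding X_def by (rule measure_UNION_le[OF fa(1)]) (rule ev)
    also have "\<dots> \<le> (\<Sum>s\<in>anchor. eps k)" by (rule sum_mono) (rule ps)
    also have "\<dots> \<le> 5 * eps k" using fa(2) eps_bounds(1)[of k] by (simp add: mult_right_mono)
    finally show ?thesis .
  qed
  then have X: "emeasure (annealed rho p) (X k) \<le> ennreal (1/8 * (1/2)^k)" for k
  proof -
    have "5 * eps k \<le> 8 * eps k" using eps_bounds(1)[of k] by simp
    also have "\<dots> = 1 / 2 ^ (12*k+97)" by (simp add: eps_def power_add)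
    also have "\<dots> \<le> 1 / 2 ^ (k+3)" by (intro divide_left_mono power_increasing) auto
    also have "\<dots> = 1/8 * (1/2)^k" by (simp add: power_add power_one_over)
    finally show ?thesis using \<open>\<And>k. prob (X k) \<le> 5 * eps k\<close>[of k]
      unfolding emeasure_eq_measure by (intro ennreal_leI) linarith
  qed
  have "emeasure (annealed rho p) (\<Union>k. X k) \<le> (\<Sum>k. emeasure (annealed rho p) (X k))"
    by (rule emeasure_subadditive_countably) (use evX in auto)
  also have "\<dots> \<le> (\<Sum>k. ennreal (1/8 * (1/2)^k))"
    by (rule suminf_le) (use X in auto)
  also have "\<dots> = ennreal (1/8 * (1 / (1 - 1/2)))"
    by (rule suminf_ennreal_eq, simp, rule sums_mult, rule geometric_sums) simp
  finally have "emeasure (annealed rho p) (\<Union>k. X k) \<le> ennreal (1/4)" by simp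
  moreover have "infinite (open_cluster (mix \<eta> \<omega>) (0, 0))" if "\<omega> \<notin> (\<Union>k. X k)" for \<omega>
    by (rule anchored_infinite[OF \<eta>]) (use that in \<open>auto simp: X_def\<close>)
  moreover have "(\<Union>k. X k) \<in> events" using evX by auto
  ultimately show ?thesis by blast
qed

end

section \<open>Averaging over the environment\<close>

lemma measurable_open_edge: "Measurable.pred (annealed rho p) (\<lambda>\<omega>. open_edge \<omega> u v)"
proof -
  have 1: "Measurable.pred (annealed rho p) (\<lambda>\<omega>. C \<and> \<not> \<omega> s \<and> \<omega> t)" for C s t
    by (intro pred_intros_logic measurable_const measurable_annealed_component) simp
  have 2: "Measurable.pred (annealed rho p) (\<lambda>\<omega>. \<exists>(i::int) (j::int). C i j \<and> \<not> \<omega> (s i j) \<and> \<omega> (t i j))" for C s t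
    by (rule pred_intros_countable(2), rule pred_intros_countable(2), rule 1)
  show ?thesis
    unfolding open_edge_def by (intro pred_intros_logic 2)
qed

lemma measurable_connected: "Measurable.pred (annealed rho p) (\<lambda>\<omega>. v \<in> open_cluster \<omega> u)"
proof -
  have rel: "Measurable.pred (annealed rho p) (\<lambda>\<omega>. (u, v) \<in> {(u, v). open_edge \<omega> u v} ^^ n)" for n v
  proof (induction n arbitrary: v)
    case (Suc n)
    have "(u, v) \<in> {(u, v). open_edge \<omega> u v} ^^ Suc n \<longleftrightarrow>
        (\<exists>w. (u, w) \<in> {(u, v). open_edge \<omega> u v} ^^ n \<and> open_edge \<omega> w v)" for \<omega>
      by auto
    moreover have "Measurable.pred (annealed rho p) (\<lambda>\<omega>. \<exists>w. (u, w) \<in> {(u, v). open_edge \<omega> u v} ^^ n \<and> open_edge \<omega> w v)"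
      by (intro pred_intros_countable pred_intros_logic Suc measurable_open_edge)
    ultimately show ?case by simp
  qed simp
  have "v \<in> open_cluster \<omega> u \<longleftrightarrow> (\<exists>n. (u, v) \<in> {(u, v). open_edge \<omega> u v} ^^ n)" for \<omega>
    by (simp add: open_cluster_def rtrancl_power)
  then show ?thesis using pred_intros_countable(2)[OF rel] by simp
qed

lemma infinite_cluster_event: "{\<omega>. infinite (open_cluster \<omega> u)} \<in> sets (annealed rho p)"
proof -
  have "infinite C \<longleftrightarrow> (\<forall>n. \<exists>v. v \<in> C \<and> n \<le> to_nat v)" for C :: "(int \<times> int) set"
  proof -
    have "infinite C \<longleftrightarrow> infinite (to_nat ` C)" by (simp add: finite_image_iff)
    then show ?thesis unfolding infinite_nat_iff_unbounded_le image_iff by metis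
  qed
  moreover have "Measurable.pred (annealed rho p) (\<lambda>\<omega>. \<forall>n. \<exists>v. v \<in> open_cluster \<omega> u \<and> n \<le> to_nat v)"
    by (intro pred_intros_countable pred_intros_logic measurable_connected) simp
  ultimately have "Measurable.pred (annealed rho p) (\<lambda>\<omega>. infinite (open_cluster \<omega> u))" by simp
  then show ?thesis unfolding pred_def by simp
qed

lemma measurable_mix: "(\<lambda>x. mix (fst x) (snd x)) \<in> measurable (annealed rho p \<Otimes>\<^sub>M annealed rho p) (annealed rho p)"
proof -
  have "(\<lambda>x. mix (fst x) (snd x) s) \<in> measurable (annealed rho p \<Otimes>\<^sub>M annealed rho p) (count_space UNIV)" for s
    by (cases s) simp_all
  then have "(\<lambda>x s. mix (fst x) (snd x) s) \<in> measurable (annealed rho p \<Otimes>\<^sub>M annealed rho p) (\<Pi>\<^sub>M s\<in>UNIV. count_space UNIV)"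
    by (intro measurable_PiM_single') auto
  then show ?thesis by (simp only: measurable_cong_sets[OF refl sets_annealed])
qed

lemma emeasure_annealed_cylinder:
  assumes "finite J"
  shows "emeasure (annealed rho p) {\<omega>. \<forall>s\<in>J. \<omega> s \<in> A s} = (\<Prod>s\<in>J. emeasure (measure_pmf (bernoulli_pmf (site_prob rho p s))) (A s))"
proof -
  interpret product_prob_space "\<lambda>s. measure_pmf (bernoulli_pmf (site_prob rho p s))" UNIV
    by unfold_locales
  show ?thesis
    using emeasure_PiM_Collect[of J A] assms by (simp add: annealed_def space_PiM)
qed

text \<open>Checked on finite cylinders: the preimage is a rectangle, with the line coordinates
  constrained in the first factor and the edge coordinates in the second, and the product over
  \<open>J\<close> splits accordingly.\<close>

lemma annealed_resample:
  "distr (annealed rho p \<Otimes>\<^sub>M annealed rho p) (annealed rho p) (\<lambda>x. mix (fst x) (snd x)) = annealed rho p"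
proof (rule measure_eqI_PiM_infinite[symmetric])
  interpret P: prob_space "annealed rho p" by (rule annealed_prob_space)
  let ?M = "\<lambda>s. measure_pmf (bernoulli_pmf (site_prob rho p s))"
  show "sets (annealed rho p) = sets (\<Pi>\<^sub>M s\<in>UNIV. ?M s)" by (simp add: annealed_def)
  then show "sets (distr (annealed rho p \<Otimes>\<^sub>M annealed rho p) (annealed rho p) (\<lambda>x. mix (fst x) (snd x))) = sets (\<Pi>\<^sub>M s\<in>UNIV. ?M s)"
    by simp
  show "finite_measure (annealed rho p)" by unfold_locales
  fix A :: "site \<Rightarrow> bool set" and J :: "site set"
  assume J: "finite J"
  define E where "E = {s. (\<exists>i. s = Col i) \<or> (\<exists>j. s = Row j)}"
  have emb: "prod_emb UNIV ?M J (Pi\<^sub>E J A) = {\<omega>. \<forall>s\<in>J. \<omega> s \<in> A s}"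
    by (auto simp: prod_emb_def PiE_iff space_PiM)
  have ev: "{\<omega>. \<forall>s\<in>K. \<omega> s \<in> A s} \<in> sets (annealed rho p)" if "finite K" for K
  proof -
    have "Measurable.pred (annealed rho p) (\<lambda>\<omega>. \<forall>s\<in>K. \<omega> s \<in> A s)"
      using that by (intro pred_intros_finite) measurable
    then show ?thesis by (simp add: pred_def)
  qed
  have "mix \<eta> \<omega> s = (if s \<in> E then \<eta> s else \<omega> s)" for \<eta> \<omega> s
    by (cases s) (auto simp: E_def)
  then have pre: "(\<lambda>x. mix (fst x) (snd x)) -` {\<omega>. \<forall>s\<in>J. \<omega> s \<in> A s} \<inter> space (annealed rho p \<Otimes>\<^sub>M annealed rho p)
      = {\<omega>. \<forall>s\<in>J \<inter> E. \<omega> s \<in> A s} \<times> {\<omega>. \<forall>s\<in>J - E. \<omega> s \<in> A s}"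
    by (auto simp: space_pair_measure)
  have "emeasure (distr (annealed rho p \<Otimes>\<^sub>M annealed rho p) (annealed rho p) (\<lambda>x. mix (fst x) (snd x))) {\<omega>. \<forall>s\<in>J. \<omega> s \<in> A s}
      = emeasure (annealed rho p) {\<omega>. \<forall>s\<in>J \<inter> E. \<omega> s \<in> A s} * emeasure (annealed rho p) {\<omega>. \<forall>s\<in>J - E. \<omega> s \<in> A s}"
    unfolding emeasure_distr[OF measurable_mix ev[OF J]] pre
    by (rule P.emeasure_pair_measure_Times) (use J in \<open>auto intro!: ev\<close>)
  also have "\<dots> = emeasure (annealed rho p) {\<omega>. \<forall>s\<in>J. \<omega> s \<in> A s}"
  proof -
    have "J = (J \<inter> E) \<union> (J - E)" by auto
    then have "(\<Prod>s\<in>J. emeasure (?M s) (A s)) = (\<Prod>s\<in>(J \<inter> E) \<union> (J - E). emeasure (?M s) (A s))" by simp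
    also have "\<dots> = (\<Prod>s\<in>J \<inter> E. emeasure (?M s) (A s)) * (\<Prod>s\<in>J - E. emeasure (?M s) (A s))"
      by (rule prod.union_disjoint) (use J in auto)
    finally show ?thesis
      unfolding emeasure_annealed_cylinder[OF J] emeasure_annealed_cylinder[OF finite_Int[OF disjI1[OF J]]]
        emeasure_annealed_cylinder[OF finite_Diff[OF J]] by (rule sym)
  qed
  finally show "emeasure (annealed rho p) (prod_emb UNIV ?M J (Pi\<^sub>E J A)) =
      emeasure (distr (annealed rho p \<Otimes>\<^sub>M annealed rho p) (annealed rho p) (\<lambda>x. mix (fst x) (snd x))) (prod_emb UNIV ?M J (Pi\<^sub>E J A))"
    unfolding emb by (rule sym)
qed

lemma distr_flags:
  assumes f: "inj f" "\<And>n. site_prob rho p (f n) = rho"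
  shows "(\<lambda>\<eta>. to_stream (\<lambda>n::nat. \<eta> (f n))) \<in> measurable (annealed rho p) (stream_space (measure_pmf (bernoulli_pmf rho)))"
    and "distr (annealed rho p) (stream_space (measure_pmf (bernoulli_pmf rho))) (\<lambda>\<eta>. to_stream (\<lambda>n. \<eta> (f n)))
       = stream_space (measure_pmf (bernoulli_pmf rho))"
proof -
  let ?M = "\<lambda>s. measure_pmf (bernoulli_pmf (site_prob rho p s))"
  let ?N = "measure_pmf (bernoulli_pmf rho)"
  have re: "distr (annealed rho p) (\<Pi>\<^sub>M n\<in>UNIV. ?N) (\<lambda>\<eta> n. \<eta> (f n)) = (\<Pi>\<^sub>M n\<in>UNIV. ?N)"
  proof -
    have "distr (Pi\<^sub>M UNIV ?M) (\<Pi>\<^sub>M n\<in>UNIV. ?M (f n)) (\<lambda>\<omega>. \<lambda>n\<in>UNIV. \<omega> (f n)) = (\<Pi>\<^sub>M n\<in>UNIV. ?M (f n))"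
      by (rule distr_PiM_reindex) (use f prob_space_measure_pmf in auto)
    then show ?thesis using f(2) by (simp add: annealed_def restrict_UNIV)
  qed
  have m: "(\<lambda>\<eta> n. \<eta> (f n)) \<in> measurable (annealed rho p) (\<Pi>\<^sub>M n\<in>UNIV. ?N)"
  proof (rule measurable_PiM_single')
    show "(\<lambda>\<eta>. \<eta> (f n)) \<in> measurable (annealed rho p) ?N" for n
      using measurable_annealed_component[of "f n" rho p]
      by (simp only: measurable_cong_sets[OF refl sets_measure_pmf_count_space])
  qed auto
  note c = measurable_comp[OF m measurable_to_stream[of ?N]]
  show "(\<lambda>\<eta>. to_stream (\<lambda>n::nat. \<eta> (f n))) \<in> measurable (annealed rho p) (stream_space ?N)"
    using c by (simp add: comp_def)
  have "distr (annealed rho p) (stream_space ?N) (\<lambda>\<eta>. to_stream (\<lambda>n. \<eta> (f n))) =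
     distr (distr (annealed rho p) (\<Pi>\<^sub>M n\<in>UNIV. ?N) (\<lambda>\<eta> n. \<eta> (f n))) (stream_space ?N) to_stream"
    by (subst distr_distr[OF measurable_to_stream m]) (simp add: comp_def)
  also have "\<dots> = stream_space ?N" unfolding re by (rule stream_space_eq_distr[symmetric])
  finally show "distr (annealed rho p) (stream_space ?N) (\<lambda>\<eta>. to_stream (\<lambda>n. \<eta> (f n))) = stream_space ?N" .
qed

lemma flags_env_good:
  assumes rho: "0 \<le> rho" "rho \<le> 1 / 10 ^ 96"
    and f: "inj f" "\<And>n. site_prob rho p (f n) = rho"
  shows "\<exists>X\<in>sets (annealed rho p). emeasure (annealed rho p) X \<le> ennreal (1/4) \<and>
     (\<forall>\<eta>. \<eta> \<notin> X \<longrightarrow> env_good (to_stream (\<lambda>n::nat. \<eta> (f n))))"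
proof -
  let ?F = "stream_space (measure_pmf (bernoulli_pmf rho))"
  obtain Y where Y: "Y \<in> sets ?F" "emeasure ?F Y \<le> ennreal (1/4)" "\<And>b. b \<notin> Y \<Longrightarrow> env_good b"
    using env_good_prob[OF rho] by blast
  define X where "X = (\<lambda>\<eta>. to_stream (\<lambda>n. \<eta> (f n))) -` Y \<inter> space (annealed rho p)"
  have "X \<in> sets (annealed rho p)" unfolding X_def by (rule measurable_sets[OF distr_flags(1)[OF f] Y(1)])
  moreover have "emeasure (annealed rho p) X = emeasure ?F Y"
    unfolding X_def using emeasure_distr[OF distr_flags(1)[OF f] Y(1)] distr_flags(2)[OF f] by simp
  moreover have "env_good (to_stream (\<lambda>n. \<eta> (f n)))" if "\<eta> \<notin> X" for \<eta>
    using that Y(3) by (simp add: X_def)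
  ultimately show ?thesis using Y(2) by metis
qed

text \<open>Column and row environments each fail with probability at most 1/4, so both are good
  with probability at least 1/2; the quenched bound then contributes another 1/2. Fubini and
  \<open>annealed_resample\<close> give at least 1/4.\<close>

lemma percolation_positive:
  assumes rho: "0 \<le> rho" "rho \<le> 1 / 10 ^ 96" and p: "p \<le> 1" "1 - eps 0 \<le> p"
  shows "0 < emeasure (annealed rho p) {\<omega>. infinite (open_cluster \<omega> (0, 0))}"
proof -
  interpret P: prob_space "annealed rho p" by (rule annealed_prob_space)
  define B where "B = {\<omega>. infinite (open_cluster \<omega> (0, 0))}"
  have B: "B \<in> sets (annealed rho p)" unfolding B_def by (rule infinite_cluster_event)
  obtain X where X: "X \<in> P.events" "emeasure (annealed rho p) X \<le> ennreal (1/4)"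
      "\<And>\<eta>. \<eta> \<notin> X \<Longrightarrow> env_good (to_stream (\<lambda>n. \<eta> (Col (int n))))"
    using flags_env_good[OF rho, of "\<lambda>n. Col (int n)" p] by (auto simp: inj_def)
  obtain Y where Y: "Y \<in> P.events" "emeasure (annealed rho p) Y \<le> ennreal (1/4)"
      "\<And>\<eta>. \<eta> \<notin> Y \<Longrightarrow> env_good (to_stream (\<lambda>n. \<eta> (Row (int n))))"
    using flags_env_good[OF rho, of "\<lambda>n. Row (int n)" p] by (auto simp: inj_def)
  have large: "ennreal (1/2) \<le> emeasure (annealed rho p) (space (annealed rho p) - Z)"
    if "Z \<in> P.events" "emeasure (annealed rho p) Z \<le> ennreal (1/2)" for Z
  proof -
    have "P.prob Z \<le> 1/2" using that(2) unfolding P.emeasure_eq_measure by (subst (asm) ennreal_le_iff) simp_all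
    then have "1/2 \<le> P.prob (space (annealed rho p) - Z)" using P.prob_compl[OF that(1)] by simp
    then show ?thesis
      unfolding P.emeasure_eq_measure by (rule ennreal_leI)
  qed
  define mixed where "mixed = (\<lambda>x. mix (fst x) (snd x)) -` B \<inter> space (annealed rho p \<Otimes>\<^sub>M annealed rho p)"
  have mx: "mixed \<in> sets (annealed rho p \<Otimes>\<^sub>M annealed rho p)"
    unfolding mixed_def by (rule measurable_sets[OF measurable_mix B])
  have slice: "ennreal (1/2) \<le> emeasure (annealed rho p) (Pair \<eta> -` mixed)" if "\<eta> \<notin> X \<union> Y" for \<eta>
  proof -
    let ?c = "to_stream (\<lambda>n. \<eta> (Col (int n)))" and ?d = "to_stream (\<lambda>n. \<eta> (Row (int n)))"
    have \<eta>: "\<And>n. \<eta> (Col (int n)) = ?c !! n" "\<And>n. \<eta> (Row (int n)) = ?d !! n"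
      by (simp_all add: to_stream_def)
    have "env_good ?c" "env_good ?d" using X(3)[of \<eta>] Y(3)[of \<eta>] that by blast+
    from quenched[OF this p \<eta>]
    obtain Z where Z: "Z \<in> P.events" "emeasure (annealed rho p) Z \<le> ennreal (1/4)"
      and inf: "\<forall>\<omega>. \<omega> \<notin> Z \<longrightarrow> infinite (open_cluster (mix \<eta> \<omega>) (0, 0))" by blast
    have ZB: "space (annealed rho p) - Z \<subseteq> Pair \<eta> -` mixed"
      using inf by (auto simp: mixed_def space_pair_measure B_def)
    have "ennreal (1/4) \<le> ennreal (1/2)" by (intro ennreal_leI) simp
    then have "ennreal (1/2) \<le> emeasure (annealed rho p) (space (annealed rho p) - Z)"
      by (intro large Z(1) order_trans[OF Z(2)])
    also have "\<dots> \<le> emeasure (annealed rho p) (Pair \<eta> -` mixed)"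
      by (rule emeasure_mono[OF ZB sets_Pair1[OF mx]])
    finally show ?thesis .
  qed
  have XY: "X \<union> Y \<in> P.events" using X(1) Y(1) by auto
  have "emeasure (annealed rho p) (X \<union> Y) \<le> ennreal (1/4) + ennreal (1/4)"
    by (rule order_trans[OF emeasure_subadditive[OF X(1) Y(1)] add_mono[OF X(2) Y(2)]])
  also have "\<dots> = ennreal (1/2)" by (simp flip: ennreal_plus)
  finally have env: "ennreal (1/2) \<le> emeasure (annealed rho p) (space (annealed rho p) - (X \<union> Y))"
    by (rule large[OF XY])
  have "0 < ennreal (1/2 * (1/2))" by simp
  also have "\<dots> = ennreal (1/2) * ennreal (1/2)" by (rule ennreal_mult) simp_all
  also have "\<dots> \<le> ennreal (1/2) * emeasure (annealed rho p) (space (annealed rho p) - (X \<union> Y))"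
    by (rule mult_left_mono[OF env]) simp
  also have "\<dots> = (\<integral>\<^sup>+\<eta>. ennreal (1/2) * indicator (space (annealed rho p) - (X \<union> Y)) \<eta> \<partial>annealed rho p)"
    by (rule nn_integral_cmult_indicator[symmetric]) (rule sets.compl_sets[OF XY])
  also have "\<dots> \<le> (\<integral>\<^sup>+\<eta>. emeasure (annealed rho p) (Pair \<eta> -` mixed) \<partial>annealed rho p)"
  proof (rule nn_integral_mono)
    fix \<eta>
    show "ennreal (1/2) * indicator (space (annealed rho p) - (X \<union> Y)) \<eta> \<le> emeasure (annealed rho p) (Pair \<eta> -` mixed)"
    proof (cases "\<eta> \<in> X \<union> Y")
      case False
      then show ?thesis using slice[OF False] by simp
    qed simp
  qed
  also have "\<dots> = emeasure (annealed rho p \<Otimes>\<^sub>M annealed rho p) mixed"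
    by (rule P.emeasure_pair_measure_alt[OF mx, symmetric])
  also have "\<dots> = emeasure (distr (annealed rho p \<Otimes>\<^sub>M annealed rho p) (annealed rho p) (\<lambda>x. mix (fst x) (snd x))) B"
    unfolding mixed_def by (rule emeasure_distr[OF measurable_mix B, symmetric])
  also have "\<dots> = emeasure (annealed rho p) B" unfolding annealed_resample ..
  finally show ?thesis unfolding B_def .
qed

theorem theorem1p1:
  fixes rho p :: real
  defines "L \<equiv> (10::real) ^ 6"
  assumes "0 \<le> rho" and "rho < 1" and "0 \<le> p" and "p \<le> 1"
    and "rho \<le> L powr (-16)"
    and "p \<ge> (1 - L powr (-10)) powr (1/4)"
  shows "measure (annealed rho p) {\<omega> \<in> space (annealed rho p). infinite (open_cluster \<omega> (0, 0))} > 0"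
proof -
  have L0: "0 < L" unfolding L_def by (rule zero_less_power) simp
  have "L powr (- 16) = 1 / L ^ 16" "L powr (- 10) = 1 / L ^ 10"
    using L0 by (simp_all add: powr_minus_divide)
  moreover have "L ^ 16 = 10 ^ 96" "L ^ 10 = 10 ^ 60"
    unfolding L_def power_mult[symmetric] by simp_all
  ultimately have L: "L powr (- 16) = 1 / 10 ^ 96" "L powr (- 10) = 1 / 10 ^ 60" by (simp_all only:)
  define a :: real where "a = 1 - 1 / 10 ^ 60"
  have a: "0 \<le> a" "a \<le> 1" unfolding a_def by simp_all
  \<comment> \<open>\<open>eps 0\<close> = 2^-100 is about 10^-30. The fourth root in the hypothesis
    only helps: a <= a^(1/4) for a in [0,1].\<close>
  have "1 / 10 ^ 60 \<le> eps 0" unfolding eps_def by simp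
  then have a_eps: "1 - eps 0 \<le> a" unfolding a_def by linarith
  have "a powr 1 \<le> a powr (1/4)" by (rule powr_mono') (use a in auto)
  then have p: "1 - eps 0 \<le> p" using a_eps assms(7)[unfolded L(2), folded a_def] by simp
  interpret prob_space "annealed rho p" by (rule annealed_prob_space)
  have "rho \<le> 1 / 10 ^ 96" using assms(6) L(1) by simp
  from percolation_positive[OF assms(2) this assms(5) p]
  show ?thesis by (simp add: emeasure_eq_measure)
qed

end
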